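(* Let $(\Lambda,d)$ be a row-finite, source-free $k$-graph, let $v\in\Lambda^0$, let $r^{-1}(v)\cap\Lambda^1=\mathcal{E}_1\sqcup\mathcal{E}_2$ be a partition into two non-empty sets satisfying the pairing condition, and let $(\Lambda_I,d_I)$ be the in-split graph of $\Lambda$ at $v$ for the partition $\mathcal{E}_1\cup\mathcal{E}_2$. Then $C^*(\Lambda_I)\cong C^*(\Lambda)$.
   Context: Fix $k\ge1$; $0\in\mathbb{N}$; $e_1,\dots,e_k$ are the standard basis vectors of $\mathbb{N}^k$, and $\mathbb{N}^k$ is regarded as a category with one object, composition being addition. For $n=\sum n_ie_i$, $|n|=\sum n_i$. A $k$-graph is a countable category $\Lambda$ with a functor $d:\Lambda\to\mathbb{N}^k$ satisfying the factorization rule: for every morphism $\lambda$ and $n,m\in\mathbb{N}^k$ with $d(\lambda)=n+m$ there exist unique $\mu,\nu\in\Lambda$ with $d(\mu)=m$, $d(\nu)=n$, $\lambda=\mu\nu$. $\Lambda^n=d^{-1}(n)$; $\Lambda^0$ is the set of vertices (identified with objects); $\Lambda^1=\{\lambda:|d(\lambda)|=1\}$ is the set of edges. $r(\lambda),s(\lambda)\in\Lambda^0$ are the unique vertices with $r(\lambda)\lambda s(\lambda)=\lambda$. $\Lambda$ is row-finite if $|\{\lambda\in\Lambda^{e_i}:r(\lambda)=v\}|<\infty$ for all $v\in\Lambda^0$, $1\le i\le k$. A vertex $v$ is a source if $r^{-1}(v)\cap\Lambda^{e_i}=\emptyset$ for some $i$; $\Lambda$ is source-free if it has no sources. The 1-skeleton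 of $\Lambda$ is the directed graph $G=(\Lambda^0,\Lambda^1,r,s)$ with edges colored by $d$. For any $k$-colored directed graph, the path category (denoted by $*$, e.g. $G^*$) consists of all finite paths $f_n\cdots f_1$ with $s(f_i)=r(f_{i-1})$, including vertices as paths of length $0$, with range, source and (additively extended) degree. On $G^*$, $\lambda\sim\mu$ means that $\lambda$ and $\mu$ compose to the same morphism of $\Lambda$; thus $\Lambda=G^*/\sim$. Pairing condition: if $a,f\in r^{-1}(v)\cap\Lambda^1$ and there exist edges $g,b\in\Lambda^1$ such that $ag\sim fb$, then $f$ and $a$ are contained in the same set $\mathcal{E}_j$. In-splitting: define the $k$-colored graph $G_I=(\Lambda_I^0,\Lambda_I^1,r_I,s_I)$ by $\Lambda_I^0=(\Lambda^0\setminus\{v\})\cup\{v^1,v^2\}$ and $\Lambda_I^1=(\Lambda^1\setminus s^{-1}(v))\cup\{f^1,f^2: f\in\Lambda^1,\ s(f)=v\}$, with $d_I(g)=d(g)$ for $g\in\Lambda^1\setminus s^{-1}(v)$ and $d_I(f^i)=d(f)$. Sources: $s_I(f)=s(f)$ if $s(f)\ne v$; $s_I(f^i)=v^i$ if $s(f)=v$. Ranges: an edge of $G_I$ of the form $f$ or $f^j$ has range $r(f)$ if $r(f)\neq v$, and has range $v^i$ if $r(f)=v$ and $f\in\mathcal{E}_i$. Define $par:G_I^*\to G^*$ by $par(w)=w$ for $w\in\Lambda^0\setminus\{v\}$, $par(v^i)=v$; $par(f^i)=f$ for the edges $f^1,f^2$, $par(f)=f$ for the other edges; and $par$ of a path is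 the concatenation of the $par$ of its edges. Define $\lambda\sim_I\mu$ on $G_I^*$ if and only if $par(\lambda)\sim par(\mu)$, $r_I(\lambda)=r_I(\mu)$ and $s_I(\lambda)=s_I(\mu)$. Then $\Lambda_I:=G_I^*/\sim_I$, with composition induced by concatenation and degree map induced by $d_I$, is the in-split graph (it is a source-free $k$-graph). For a row-finite source-free $k$-graph $\Lambda$, a Cuntz–Krieger $\Lambda$-family is a collection of projections $\{P_v:v\in\Lambda^0\}$ and partial isometries $\{T_f:f\in\Lambda^1\}$ such that: (CK1) the $P_v$ are mutually orthogonal; (CK2) if $a,b,f,g\in\Lambda^1$ satisfy $af\sim gb$, then $T_aT_f=T_gT_b$; (CK3) $T_f^*T_f=P_{s(f)}$ for all $f\in\Lambda^1$; (CK4) $P_v=\sum_{f:\,r(f)=v,\ d(f)=e_i}T_fT_f^*$ for all $v\in\Lambda^0$, $1\le i\le k$. $C^*(\Lambda)$ is the universal $C^*$-algebra generated by a Cuntz–Krieger $\Lambda$-family. *)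

theory Defs
  imports
    "HOL-Library.Countable_Set"
    "HOL-Algebra.Module"
    "HOL-Analysis.Finite_Cartesian_Product"
begin

section \<open>Higher-rank graphs\<close>

text \<open>
  Small categories are presented by their morphisms, objects being identified with identity
  morphisms; \<open>cmp \<Lambda> \<mu> \<nu>\<close> is \<open>\<mu>\<nu>\<close>, defined when \<open>src \<Lambda> \<mu> = rng \<Lambda> \<nu>\<close>. Degrees live in
  \<open>nat ^ 'k\<close>, so the rank is \<open>k = CARD('k)\<close>, and \<open>e\<^sub>i\<close> is \<open>axis i 1\<close>.
\<close>

record ('m, 'k) graded_category =
  Mor :: "'m set"
  rng :: "'m \<Rightarrow> 'm"
  src :: "'m \<Rightarrow> 'm"
  cmp :: "'m \<Rightarrow> 'm \<Rightarrow> 'm"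
  deg :: "'m \<Rightarrow> nat ^ 'k"

locale kgraph =
  fixes \<Lambda> :: "('m, 'k::finite) graded_category"
  assumes countable_Mor: "countable (Mor \<Lambda>)"
    and rng_closed: "l \<in> Mor \<Lambda> \<Longrightarrow> rng \<Lambda> l \<in> Mor \<Lambda>"
    and src_closed: "l \<in> Mor \<Lambda> \<Longrightarrow> src \<Lambda> l \<in> Mor \<Lambda>"
    and rng_ident: "l \<in> Mor \<Lambda> \<Longrightarrow> rng \<Lambda> (rng \<Lambda> l) = rng \<Lambda> l \<and> src \<Lambda> (rng \<Lambda> l) = rng \<Lambda> l"
    and src_ident: "l \<in> Mor \<Lambda> \<Longrightarrow> rng \<Lambda> (src \<Lambda> l) = src \<Lambda> l \<and> src \<Lambda> (src \<Lambda> l) = src \<Lambda> l"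
    and cmp_closed: "\<lbrakk>l \<in> Mor \<Lambda>; m \<in> Mor \<Lambda>; src \<Lambda> l = rng \<Lambda> m\<rbrakk> \<Longrightarrow> cmp \<Lambda> l m \<in> Mor \<Lambda>"
    and rng_cmp: "\<lbrakk>l \<in> Mor \<Lambda>; m \<in> Mor \<Lambda>; src \<Lambda> l = rng \<Lambda> m\<rbrakk> \<Longrightarrow> rng \<Lambda> (cmp \<Lambda> l m) = rng \<Lambda> l"
    and src_cmp: "\<lbrakk>l \<in> Mor \<Lambda>; m \<in> Mor \<Lambda>; src \<Lambda> l = rng \<Lambda> m\<rbrakk> \<Longrightarrow> src \<Lambda> (cmp \<Lambda> l m) = src \<Lambda> m"
    and cmp_assoc: "\<lbrakk>l \<in> Mor \<Lambda>; m \<in> Mor \<Lambda>; n \<in> Mor \<Lambda>; src \<Lambda> l = rng \<Lambda> m; src \<Lambda> m = rng \<Lambda> n\<rbrakk>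
          \<Longrightarrow> cmp \<Lambda> (cmp \<Lambda> l m) n = cmp \<Lambda> l (cmp \<Lambda> m n)"
    and cmp_rng_left: "l \<in> Mor \<Lambda> \<Longrightarrow> cmp \<Lambda> (rng \<Lambda> l) l = l"
    and cmp_src_right: "l \<in> Mor \<Lambda> \<Longrightarrow> cmp \<Lambda> l (src \<Lambda> l) = l"
    and deg_ident: "l \<in> Mor \<Lambda> \<Longrightarrow> deg \<Lambda> (rng \<Lambda> l) = 0 \<and> deg \<Lambda> (src \<Lambda> l) = 0"
    and deg_cmp: "\<lbrakk>l \<in> Mor \<Lambda>; m \<in> Mor \<Lambda>; src \<Lambda> l = rng \<Lambda> m\<rbrakk>
          \<Longrightarrow> deg \<Lambda> (cmp \<Lambda> l m) = deg \<Lambda> l + deg \<Lambda> m"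
    and factorization: "\<lbrakk>l \<in> Mor \<Lambda>; deg \<Lambda> l = p + q\<rbrakk>
          \<Longrightarrow> \<exists>!(\<mu>, \<nu>). \<mu> \<in> Mor \<Lambda> \<and> \<nu> \<in> Mor \<Lambda> \<and> src \<Lambda> \<mu> = rng \<Lambda> \<nu>
                \<and> deg \<Lambda> \<mu> = q \<and> deg \<Lambda> \<nu> = p \<and> l = cmp \<Lambda> \<mu> \<nu>"

definition vertices :: "('m, 'k::finite) graded_category \<Rightarrow> 'm set" where
  "vertices \<Lambda> = {l \<in> Mor \<Lambda>. deg \<Lambda> l = 0}"

definition edges :: "('m, 'k::finite) graded_category \<Rightarrow> 'm set" where
  "edges \<Lambda> = {l \<in> Mor \<Lambda>. (\<Sum>i\<in>UNIV. deg \<Lambda> l $ i) = 1}"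

definition row_finite :: "('m, 'k::finite) graded_category \<Rightarrow> bool" where
  "row_finite \<Lambda> \<longleftrightarrow>
     (\<forall>v\<in>vertices \<Lambda>. \<forall>i. finite {l \<in> Mor \<Lambda>. deg \<Lambda> l = axis i 1 \<and> rng \<Lambda> l = v})"

definition is_source :: "('m, 'k::finite) graded_category \<Rightarrow> 'm \<Rightarrow> bool" where
  "is_source \<Lambda> v \<longleftrightarrow> (\<exists>i. {l \<in> Mor \<Lambda>. deg \<Lambda> l = axis i 1 \<and> rng \<Lambda> l = v} = {})"

definition source_free :: "('m, 'k::finite) graded_category \<Rightarrow> bool" where
  "source_free \<Lambda> \<longleftrightarrow> (\<forall>v\<in>vertices \<Lambda>. \<not> is_source \<Lambda> v)"


section \<open>Coloured graphs and their path categories\<close>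

record ('v, 'e, 'k) colored_graph =
  gverts :: "'v set"
  gedges :: "'e set"
  grng :: "'e \<Rightarrow> 'v"
  gsrc :: "'e \<Rightarrow> 'v"
  gcol :: "'e \<Rightarrow> nat ^ 'k"

text \<open>
  A path is a pair of its range vertex and its list of edges, read from range to source; the
  path of length \<open>0\<close> at \<open>w\<close> is \<open>(w, [])\<close>.
\<close>

type_synonym ('v, 'e) path = "'v \<times> 'e list"

fun is_path :: "('v, 'e, 'k::finite) colored_graph \<Rightarrow> ('v, 'e) path \<Rightarrow> bool" where
  "is_path G (w, []) \<longleftrightarrow> w \<in> gverts G"
| "is_path G (w, f # fs) \<longleftrightarrow> w \<in> gverts G \<and> f \<in> gedges G \<and> grng G f = w \<and> is_path G (gsrc G f, fs)"

definition path_rng :: "('v, 'e) path \<Rightarrow> 'v" where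
  "path_rng p = fst p"

definition path_src :: "('v, 'e, 'k::finite) colored_graph \<Rightarrow> ('v, 'e) path \<Rightarrow> 'v" where
  "path_src G p = (if snd p = [] then fst p else gsrc G (last (snd p)))"

definition path_deg :: "('v, 'e, 'k::finite) colored_graph \<Rightarrow> ('v, 'e) path \<Rightarrow> nat ^ 'k" where
  "path_deg G p = sum_list (map (gcol G) (snd p))"

definition path_append :: "('v, 'e) path \<Rightarrow> ('v, 'e) path \<Rightarrow> ('v, 'e) path" where
  "path_append p q = (fst p, snd p @ snd q)"

definition skeleton :: "('m, 'k::finite) graded_category \<Rightarrow> ('m, 'm, 'k) colored_graph" where
  "skeleton \<Lambda> = \<lparr>gverts = vertices \<Lambda>, gedges = edges \<Lambda>, grng = rng \<Lambda>, gsrc = src \<Lambda>, gcol = deg \<Lambda>\<rparr>"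

definition path_morphism :: "('m, 'k::finite) graded_category \<Rightarrow> ('m, 'm) path \<Rightarrow> 'm" where
  "path_morphism \<Lambda> p = foldl (cmp \<Lambda>) (fst p) (snd p)"

definition path_equiv :: "('m, 'k::finite) graded_category \<Rightarrow> ('m, 'm) path \<Rightarrow> ('m, 'm) path \<Rightarrow> bool" where
  "path_equiv \<Lambda> p q \<longleftrightarrow> is_path (skeleton \<Lambda>) p \<and> is_path (skeleton \<Lambda>) q
     \<and> path_morphism \<Lambda> p = path_morphism \<Lambda> q"

definition two_path :: "('m, 'k::finite) graded_category \<Rightarrow> 'm \<Rightarrow> 'm \<Rightarrow> ('m, 'm) path" where
  "two_path \<Lambda> a b = (rng \<Lambda> a, [a, b])"


section \<open>In-splitting\<close>

definition edge_partition_at ::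
    "('m, 'k::finite) graded_category \<Rightarrow> 'm \<Rightarrow> 'm set \<Rightarrow> 'm set \<Rightarrow> bool" where
  "edge_partition_at \<Lambda> v E1 E2 \<longleftrightarrow> E1 \<union> E2 = {f \<in> edges \<Lambda>. rng \<Lambda> f = v} \<and> E1 \<inter> E2 = {}
     \<and> E1 \<noteq> {} \<and> E2 \<noteq> {}"

definition pairing_condition ::
    "('m, 'k::finite) graded_category \<Rightarrow> 'm \<Rightarrow> 'm set \<Rightarrow> 'm set \<Rightarrow> bool" where
  "pairing_condition \<Lambda> v E1 E2 \<longleftrightarrow>
     (\<forall>a f. a \<in> edges \<Lambda> \<and> rng \<Lambda> a = v \<and> f \<in> edges \<Lambda> \<and> rng \<Lambda> f = v
        \<and> (\<exists>g\<in>edges \<Lambda>. \<exists>b\<in>edges \<Lambda>. path_equiv \<Lambda> (two_path \<Lambda> a g) (two_path \<Lambda> f b))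
      \<longrightarrow> (a \<in> E1 \<and> f \<in> E1) \<or> (a \<in> E2 \<and> f \<in> E2))"

text \<open>\<open>First x\<close> and \<open>Second x\<close> are the copies \<open>x\<^sup>1\<close> and \<open>x\<^sup>2\<close> of a vertex or edge \<open>x\<close>.\<close>

datatype 'm split = Orig 'm | First 'm | Second 'm

primrec unsplit :: "'m split \<Rightarrow> 'm" where
  "unsplit (Orig x) = x"
| "unsplit (First x) = x"
| "unsplit (Second x) = x"

primrec split_src :: "('m, 'k::finite) graded_category \<Rightarrow> 'm \<Rightarrow> 'm split \<Rightarrow> 'm split" where
  "split_src \<Lambda> v (Orig f) = Orig (src \<Lambda> f)"
| "split_src \<Lambda> v (First f) = First v"
| "split_src \<Lambda> v (Second f) = Second v"

text \<open>
  Since the two sets partition the edges with range \<open>v\<close>, such an edge outside \<open>E1\<close> lies in the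
  second set, which therefore need not be passed as an argument.
\<close>

definition split_rng :: "('m, 'k::finite) graded_category \<Rightarrow> 'm \<Rightarrow> 'm set \<Rightarrow> 'm split \<Rightarrow> 'm split" where
  "split_rng \<Lambda> v E1 e =
     (if rng \<Lambda> (unsplit e) \<noteq> v then Orig (rng \<Lambda> (unsplit e))
      else if unsplit e \<in> E1 then First v else Second v)"

definition split_graph ::
    "('m, 'k::finite) graded_category \<Rightarrow> 'm \<Rightarrow> 'm set \<Rightarrow> ('m split, 'm split, 'k) colored_graph" where
  "split_graph \<Lambda> v E1 =
     \<lparr>gverts = Orig ` (vertices \<Lambda> - {v}) \<union> {First v, Second v},
      gedges = Orig ` {f \<in> edges \<Lambda>. src \<Lambda> f \<noteq> v}
        \<union> First ` {f \<in> edges \<Lambda>. src \<Lambda> f = v} \<union> Second ` {f \<in> edges \<Lambda>. src \<Lambda> f = v},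
      grng = split_rng \<Lambda> v E1,
      gsrc = split_src \<Lambda> v,
      gcol = (\<lambda>e. deg \<Lambda> (unsplit e))\<rparr>"

definition par :: "('m split, 'm split) path \<Rightarrow> ('m, 'm) path" where
  "par p = (unsplit (fst p), map unsplit (snd p))"

definition split_equiv ::
    "('m, 'k::finite) graded_category \<Rightarrow> 'm \<Rightarrow> 'm set
      \<Rightarrow> (('m split, 'm split) path \<times> ('m split, 'm split) path) set" where
  "split_equiv \<Lambda> v E1 = {(p, q). is_path (split_graph \<Lambda> v E1) p \<and> is_path (split_graph \<Lambda> v E1) q
     \<and> path_equiv \<Lambda> (par p) (par q) \<and> path_rng p = path_rng q
     \<and> path_src (split_graph \<Lambda> v E1) p = path_src (split_graph \<Lambda> v E1) q}"

text \<open>The operations of the in-split graph are those induced on equivalence classes of paths.\<close>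

definition in_split ::
    "('m, 'k::finite) graded_category \<Rightarrow> 'm \<Rightarrow> 'm set
      \<Rightarrow> (('m split, 'm split) path set, 'k) graded_category" where
  "in_split \<Lambda> v E1 = (let G = split_graph \<Lambda> v E1; R = split_equiv \<Lambda> v E1 in
     \<lparr>Mor = {p. is_path G p} // R,
      rng = (\<lambda>U. \<Union>p\<in>U. R `` {(path_rng p, [])}),
      src = (\<lambda>U. \<Union>p\<in>U. R `` {(path_src G p, [])}),
      cmp = (\<lambda>U V. \<Union>p\<in>U. \<Union>q\<in>V. R `` {path_append p q}),
      deg = (\<lambda>U. the_elem (path_deg G ` U))\<rparr>)"


section \<open>C*-algebras\<close>

text \<open>
  The field \<open>one\<close> inherited from the record of rings is not used: algebras need not be unital.
\<close>

record 'a star_algebra = "(complex, 'a) module" +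
  adj :: "'a \<Rightarrow> 'a"  (\<open>star\<index>\<close>)
  cnorm :: "'a \<Rightarrow> real"  (\<open>nrm\<index>\<close>)

abbreviation complex_ring :: "complex ring" where
  "complex_ring \<equiv> \<lparr>carrier = UNIV, mult = (*), one = 1, zero = 0, add = (+)\<rparr>"

locale pre_cstar_algebra = Module.module complex_ring A for A :: "'a star_algebra" (structure) +
  assumes mult_closed [simp]: "\<lbrakk>x \<in> carrier A; y \<in> carrier A\<rbrakk> \<Longrightarrow> x \<otimes> y \<in> carrier A"
    and mult_assoc: "\<lbrakk>x \<in> carrier A; y \<in> carrier A; z \<in> carrier A\<rbrakk> \<Longrightarrow> (x \<otimes> y) \<otimes> z = x \<otimes> (y \<otimes> z)"
    and mult_distrib_right:
      "\<lbrakk>x \<in> carrier A; y \<in> carrier A; z \<in> carrier A\<rbrakk> \<Longrightarrow> (x \<oplus> y) \<otimes> z = x \<otimes> z \<oplus> y \<otimes> z"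
    and mult_distrib_left:
      "\<lbrakk>x \<in> carrier A; y \<in> carrier A; z \<in> carrier A\<rbrakk> \<Longrightarrow> z \<otimes> (x \<oplus> y) = z \<otimes> x \<oplus> z \<otimes> y"
    and smult_mult_left: "\<lbrakk>x \<in> carrier A; y \<in> carrier A\<rbrakk> \<Longrightarrow> (c \<odot> x) \<otimes> y = c \<odot> (x \<otimes> y)"
    and smult_mult_right: "\<lbrakk>x \<in> carrier A; y \<in> carrier A\<rbrakk> \<Longrightarrow> x \<otimes> (c \<odot> y) = c \<odot> (x \<otimes> y)"
    and star_closed [simp]: "x \<in> carrier A \<Longrightarrow> star x \<in> carrier A"
    and star_star [simp]: "x \<in> carrier A \<Longrightarrow> star (star x) = x"
    and star_add: "\<lbrakk>x \<in> carrier A; y \<in> carrier A\<rbrakk> \<Longrightarrow> star (x \<oplus> y) = star x \<oplus> star y"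
    and star_smult: "x \<in> carrier A \<Longrightarrow> star (c \<odot> x) = cnj c \<odot> star x"
    and star_mult: "\<lbrakk>x \<in> carrier A; y \<in> carrier A\<rbrakk> \<Longrightarrow> star (x \<otimes> y) = star y \<otimes> star x"
    and nrm_nonneg [simp]: "x \<in> carrier A \<Longrightarrow> 0 \<le> nrm x"
    and nrm_eq_0: "x \<in> carrier A \<Longrightarrow> nrm x = 0 \<longleftrightarrow> x = \<zero>"
    and nrm_add: "\<lbrakk>x \<in> carrier A; y \<in> carrier A\<rbrakk> \<Longrightarrow> nrm (x \<oplus> y) \<le> nrm x + nrm y"
    and nrm_smult: "x \<in> carrier A \<Longrightarrow> nrm (c \<odot> x) = cmod c * nrm x"
    and nrm_mult: "\<lbrakk>x \<in> carrier A; y \<in> carrier A\<rbrakk> \<Longrightarrow> nrm (x \<otimes> y) \<le> nrm x * nrm y"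
    and nrm_star_mult: "x \<in> carrier A \<Longrightarrow> nrm (star x \<otimes> x) = (nrm x)\<^sup>2"

locale cstar_algebra = pre_cstar_algebra +
  assumes complete:
    "\<lbrakk>\<And>n. x n \<in> carrier A; \<And>e. e > 0 \<Longrightarrow> \<exists>M. \<forall>m\<ge>M. \<forall>n\<ge>M. nrm (x m \<ominus> x n) < e\<rbrakk>
      \<Longrightarrow> \<exists>l\<in>carrier A. (\<lambda>n. nrm (x n \<ominus> l)) \<longlonglongrightarrow> 0"

definition star_hom :: "'a star_algebra \<Rightarrow> 'b star_algebra \<Rightarrow> ('a \<Rightarrow> 'b) \<Rightarrow> bool" where
  "star_hom A B \<phi> \<longleftrightarrow>
     (\<forall>x\<in>carrier A. \<phi> x \<in> carrier B) \<and>
     (\<forall>x\<in>carrier A. \<forall>y\<in>carrier A. \<phi> (x \<oplus>\<^bsub>A\<^esub> y) = \<phi> x \<oplus>\<^bsub>B\<^esub> \<phi> y) \<and>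
     (\<forall>c. \<forall>x\<in>carrier A. \<phi> (c \<odot>\<^bsub>A\<^esub> x) = c \<odot>\<^bsub>B\<^esub> \<phi> x) \<and>
     (\<forall>x\<in>carrier A. \<forall>y\<in>carrier A. \<phi> (x \<otimes>\<^bsub>A\<^esub> y) = \<phi> x \<otimes>\<^bsub>B\<^esub> \<phi> y) \<and>
     (\<forall>x\<in>carrier A. \<phi> (star\<^bsub>A\<^esub> x) = star\<^bsub>B\<^esub> (\<phi> x))"

definition star_isomorphic :: "'a star_algebra \<Rightarrow> 'b star_algebra \<Rightarrow> bool" where
  "star_isomorphic A B \<longleftrightarrow> (\<exists>\<phi>. star_hom A B \<phi> \<and> bij_betw \<phi> (carrier A) (carrier B))"


section \<open>Cuntz-Krieger families and their universal C*-algebra\<close>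

definition is_projection :: "'a star_algebra \<Rightarrow> 'a \<Rightarrow> bool" where
  "is_projection A p \<longleftrightarrow> p \<in> carrier A \<and> p \<otimes>\<^bsub>A\<^esub> p = p \<and> star\<^bsub>A\<^esub> p = p"

definition is_partial_isometry :: "'a star_algebra \<Rightarrow> 'a \<Rightarrow> bool" where
  "is_partial_isometry A t \<longleftrightarrow> t \<in> carrier A \<and> t \<otimes>\<^bsub>A\<^esub> star\<^bsub>A\<^esub> t \<otimes>\<^bsub>A\<^esub> t = t"

definition CK_family ::
    "('m, 'k::finite) graded_category \<Rightarrow> 'a star_algebra \<Rightarrow> ('m \<Rightarrow> 'a) \<Rightarrow> ('m \<Rightarrow> 'a) \<Rightarrow> bool" where
  "CK_family \<Lambda> A P T \<longleftrightarrow>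
     (\<forall>v\<in>vertices \<Lambda>. is_projection A (P v)) \<and>
     (\<forall>f\<in>edges \<Lambda>. is_partial_isometry A (T f)) \<and>
     (\<forall>v\<in>vertices \<Lambda>. \<forall>w\<in>vertices \<Lambda>. v \<noteq> w \<longrightarrow> P v \<otimes>\<^bsub>A\<^esub> P w = \<zero>\<^bsub>A\<^esub>) \<and>
     (\<forall>a\<in>edges \<Lambda>. \<forall>b\<in>edges \<Lambda>. \<forall>f\<in>edges \<Lambda>. \<forall>g\<in>edges \<Lambda>.
        path_equiv \<Lambda> (two_path \<Lambda> a f) (two_path \<Lambda> g b) \<longrightarrow> T a \<otimes>\<^bsub>A\<^esub> T f = T g \<otimes>\<^bsub>A\<^esub> T b) \<and>
     (\<forall>f\<in>edges \<Lambda>. star\<^bsub>A\<^esub> (T f) \<otimes>\<^bsub>A\<^esub> T f = P (src \<Lambda> f)) \<and>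
     (\<forall>v\<in>vertices \<Lambda>. \<forall>i. P v =
        finsum A (\<lambda>f. T f \<otimes>\<^bsub>A\<^esub> star\<^bsub>A\<^esub> (T f)) {f \<in> edges \<Lambda>. rng \<Lambda> f = v \<and> deg \<Lambda> f = axis i 1})"

text \<open>Formal *-polynomials (without constant term) in generators of type \<open>'x\<close>.\<close>

datatype 'x star_term =
    TZero
  | TGen 'x
  | TAdd "'x star_term" "'x star_term"
  | TScale complex "'x star_term"
  | TMult "'x star_term" "'x star_term"
  | TStar "'x star_term"

primrec eval :: "'a star_algebra \<Rightarrow> ('x \<Rightarrow> 'a) \<Rightarrow> 'x star_term \<Rightarrow> 'a" where
  "eval A h TZero = \<zero>\<^bsub>A\<^esub>"
| "eval A h (TGen x) = h x"
| "eval A h (TAdd s t) = eval A h s \<oplus>\<^bsub>A\<^esub> eval A h t"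
| "eval A h (TScale c t) = c \<odot>\<^bsub>A\<^esub> eval A h t"
| "eval A h (TMult s t) = eval A h s \<otimes>\<^bsub>A\<^esub> eval A h t"
| "eval A h (TStar t) = star\<^bsub>A\<^esub> (eval A h t)"

definition tdist :: "('x star_term \<Rightarrow> real) \<Rightarrow> 'x star_term \<Rightarrow> 'x star_term \<Rightarrow> real" where
  "tdist N s t = N (TAdd s (TScale (-1) t))"

text \<open>
  The separated completion of the *-polynomials over a set \<open>X\<close> of generators with respect to a
  C*-seminorm \<open>N\<close>, as Cauchy sequences modulo sequences at distance tending to \<open>0\<close>.
\<close>

definition cauchy_seqs :: "'x set \<Rightarrow> ('x star_term \<Rightarrow> real) \<Rightarrow> (nat \<Rightarrow> 'x star_term) set" where
  "cauchy_seqs X N = {x. (\<forall>n. set_star_term (x n) \<subseteq> X)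
     \<and> (\<forall>e>0. \<exists>M. \<forall>m\<ge>M. \<forall>n\<ge>M. tdist N (x m) (x n) < e)}"

definition null_equiv ::
    "'x set \<Rightarrow> ('x star_term \<Rightarrow> real) \<Rightarrow> ((nat \<Rightarrow> 'x star_term) \<times> (nat \<Rightarrow> 'x star_term)) set" where
  "null_equiv X N = {(x, y). x \<in> cauchy_seqs X N \<and> y \<in> cauchy_seqs X N
     \<and> (\<lambda>n. tdist N (x n) (y n)) \<longlonglongrightarrow> 0}"

definition completion ::
    "'x set \<Rightarrow> ('x star_term \<Rightarrow> real) \<Rightarrow> (nat \<Rightarrow> 'x star_term) set star_algebra" where
  "completion X N = (let R = null_equiv X N in
     \<lparr>carrier = cauchy_seqs X N // R,
      mult = (\<lambda>U V. \<Union>x\<in>U. \<Union>y\<in>V. R `` {\<lambda>n. TMult (x n) (y n)}),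
      one = undefined,
      zero = R `` {\<lambda>n. TZero},
      add = (\<lambda>U V. \<Union>x\<in>U. \<Union>y\<in>V. R `` {\<lambda>n. TAdd (x n) (y n)}),
      smult = (\<lambda>c U. \<Union>x\<in>U. R `` {\<lambda>n. TScale c (x n)}),
      adj = (\<lambda>U. \<Union>x\<in>U. R `` {\<lambda>n. TStar (x n)}),
      cnorm = (\<lambda>U. the_elem ((\<lambda>x. lim (\<lambda>n. N (x n))) ` U))\<rparr>)"

text \<open>
  The universal C*-algebra of Cuntz-Krieger families is the completion of the *-polynomials in
  symbols \<open>Inl v\<close> (for \<open>P\<^sub>v\<close>) and \<open>Inr f\<close> (for \<open>T\<^sub>f\<close>) in the largest C*-seminorm coming from a
  Cuntz-Krieger family. The supremum ranges over families in C*-algebras carried by a fixed type;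
  that type contains a copy of the C*-algebra generated by any family whatsoever, so no family is
  lost. That the result is a C*-algebra, densely generated by a Cuntz-Krieger family which maps
  to every other one (in C*-algebras over any type), is proved below, for row-finite \<open>\<Lambda>\<close>, in \<open>CK_algebra_cstar\<close>,
  \<open>CK_algebra_family\<close>, \<open>CK_algebra_dense\<close> and \<open>CK_algebra_universal\<close>.
\<close>

definition CK_norm :: "('m, 'k::finite) graded_category \<Rightarrow> ('m + 'm) star_term \<Rightarrow> real" where
  "CK_norm \<Lambda> t = Sup {nrm\<^bsub>A\<^esub> (eval A (case_sum P T) t) | A P T.
     cstar_algebra (A :: (nat \<Rightarrow> ('m + 'm) star_term) set star_algebra) \<and> CK_family \<Lambda> A P T}"

definition CK_algebra ::
    "('m, 'k::finite) graded_category \<Rightarrow> (nat \<Rightarrow> ('m + 'm) star_term) set star_algebra" where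
  "CK_algebra \<Lambda> = completion (vertices \<Lambda> <+> edges \<Lambda>) (CK_norm \<Lambda>)"


section \<open>The universal property of the Cuntz-Krieger algebra\<close>

subsection \<open>Elementary facts about C*-algebras\<close>

context pre_cstar_algebra
begin

lemma smult_cl [simp]: "x \<in> carrier A \<Longrightarrow> c \<odot> x \<in> carrier A"
  using smult_closed[of c x] by simp

lemma smult_zero_left [simp]: "x \<in> carrier A \<Longrightarrow> 0 \<odot> x = \<zero>"
  using smult_l_null[of x] by simp

lemma smult_one' [simp]: "x \<in> carrier A \<Longrightarrow> 1 \<odot> x = x"
  using smult_one[of x] by simp

lemma smult_smult: "x \<in> carrier A \<Longrightarrow> a \<odot> (b \<odot> x) = (a * b) \<odot> x"
  using smult_assoc1[of a b x] by simp

lemma smult_add_left: "x \<in> carrier A \<Longrightarrow> (a + b) \<odot> x = a \<odot> x \<oplus> b \<odot> x"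
  using smult_l_distr[of a b x] by simp

lemma smult_add_right: "x \<in> carrier A \<Longrightarrow> y \<in> carrier A \<Longrightarrow> a \<odot> (x \<oplus> y) = a \<odot> x \<oplus> a \<odot> y"
  using smult_r_distr[of a x y] by simp

lemma smult_zero_right [simp]: "a \<odot> \<zero> = \<zero>"
  using smult_r_null[of a] by simp

lemma minus_smult: "x \<in> carrier A \<Longrightarrow> \<ominus> x = (-1) \<odot> x"
  by (rule M.minus_equality) (simp_all flip: smult_add_left[of x "-1" 1, simplified])

lemma diff_smult: "x \<in> carrier A \<Longrightarrow> y \<in> carrier A \<Longrightarrow> x \<ominus> y = x \<oplus> (-1) \<odot> y"
  by (simp add: a_minus_def minus_smult)

lemma nrm_zero [simp]: "nrm \<zero> = 0"
  by (simp add: nrm_eq_0)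

lemma mult_zero_left [simp]: "x \<in> carrier A \<Longrightarrow> \<zero> \<otimes> x = \<zero>"
  using smult_mult_left[of \<zero> x 0] by simp

lemma mult_zero_right [simp]: "x \<in> carrier A \<Longrightarrow> x \<otimes> \<zero> = \<zero>"
  using smult_mult_right[of x \<zero> 0] by simp

lemma star_zero [simp]: "star \<zero> = \<zero>"
  using star_smult[of \<zero> 0] by simp

lemma nrm_star [simp]:
  assumes "x \<in> carrier A" shows "nrm (star x) = nrm x"
proof -
  have le: "nrm y \<le> nrm (star y)" if y: "y \<in> carrier A" for y
  proof (cases "nrm y = 0")
    case False
    have "nrm y * nrm y \<le> nrm (star y) * nrm y"
      using nrm_star_mult[OF y] nrm_mult[of "star y" y] y by (simp add: power2_eq_square)
    then show ?thesis using False nrm_nonneg[OF y] by simp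
  qed (use y in simp)
  show ?thesis using le[OF assms] le[of "star x"] assms by simp
qed

lemma nrm_diff_commute: "x \<in> carrier A \<Longrightarrow> y \<in> carrier A \<Longrightarrow> nrm (x \<ominus> y) = nrm (y \<ominus> x)"
  using nrm_smult[of "y \<ominus> x" "-1"]
  by (simp add: diff_smult smult_add_right smult_smult M.a_comm)

lemma nrm_diff_triangle:
  assumes "x \<in> carrier A" "y \<in> carrier A" "z \<in> carrier A"
  shows "nrm (x \<ominus> z) \<le> nrm (x \<ominus> y) + nrm (y \<ominus> z)"
proof -
  have "x \<ominus> z = (x \<ominus> y) \<oplus> (y \<ominus> z)"
    using assms by (simp add: M.minus_eq M.a_assoc M.r_neg1 M.l_neg)
  then show ?thesis using nrm_add[of "x \<ominus> y" "y \<ominus> z"] assms by simp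
qed

lemma nrm_diff_eq_0:
  assumes "x \<in> carrier A" "y \<in> carrier A" shows "nrm (x \<ominus> y) = 0 \<longleftrightarrow> x = y"
proof -
  have "x \<ominus> y = \<zero> \<longleftrightarrow> x = y"
    using assms by (metis M.add.inv_closed M.add.inv_inv M.minus_equality M.minus_eq M.r_neg)
  then show ?thesis using assms by (simp add: nrm_eq_0)
qed


lemma diff_add:
  assumes "x \<in> carrier A" "y \<in> carrier A" "x' \<in> carrier A" "y' \<in> carrier A"
  shows "(x \<oplus> y) \<ominus> (x' \<oplus> y') = (x \<ominus> x') \<oplus> (y \<ominus> y')"
  using assms by (simp add: M.minus_eq M.minus_add M.a_ac)

lemma diff_mult:
  assumes "x \<in> carrier A" "y \<in> carrier A" "x' \<in> carrier A" "y' \<in> carrier A"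
  shows "(x \<otimes> y) \<ominus> (x' \<otimes> y') = x \<otimes> (y \<ominus> y') \<oplus> (x \<ominus> x') \<otimes> y'"
proof -
  have "x \<otimes> (y \<ominus> y') \<oplus> (x \<ominus> x') \<otimes> y'
      = (x \<otimes> y \<oplus> (-1) \<odot> (x \<otimes> y')) \<oplus> (x \<otimes> y' \<oplus> (-1) \<odot> (x' \<otimes> y'))"
    using assms by (simp add: diff_smult mult_distrib_left mult_distrib_right smult_mult_left
        smult_mult_right)
  also have "\<dots> = (x \<otimes> y) \<oplus> (-1) \<odot> (x' \<otimes> y')"
    using assms by (simp add: M.a_assoc minus_smult[symmetric] M.r_neg1)
  finally show ?thesis using assms by (simp add: diff_smult)
qed

lemma nrm_diff_add:
  assumes "x \<in> carrier A" "y \<in> carrier A" "x' \<in> carrier A" "y' \<in> carrier A"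
  shows "nrm ((x \<oplus> y) \<ominus> (x' \<oplus> y')) \<le> nrm (x \<ominus> x') + nrm (y \<ominus> y')"
  using assms by (simp add: diff_add nrm_add)

lemma nrm_diff_mult:
  assumes "x \<in> carrier A" "y \<in> carrier A" "x' \<in> carrier A" "y' \<in> carrier A"
  shows "nrm ((x \<otimes> y) \<ominus> (x' \<otimes> y')) \<le> nrm x * nrm (y \<ominus> y') + nrm (x \<ominus> x') * nrm y'"
  unfolding diff_mult[OF assms]
  using assms nrm_add[of "x \<otimes> (y \<ominus> y')" "(x \<ominus> x') \<otimes> y'"]
    nrm_mult[of x "y \<ominus> y'"] nrm_mult[of "x \<ominus> x'" y'] by simp

lemma nrm_diff_smult:
  assumes "x \<in> carrier A" "x' \<in> carrier A"
  shows "nrm (c \<odot> x \<ominus> c \<odot> x') = cmod c * nrm (x \<ominus> x')"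
proof -
  have "c \<odot> x \<ominus> c \<odot> x' = c \<odot> (x \<ominus> x')"
    using assms by (simp add: diff_smult smult_add_right smult_smult)
  then show ?thesis using assms by (simp add: nrm_smult)
qed

lemma nrm_diff_star:
  assumes "x \<in> carrier A" "x' \<in> carrier A"
  shows "nrm (star x \<ominus> star x') = nrm (x \<ominus> x')"
proof -
  have "star x \<ominus> star x' = star (x \<ominus> x')"
    using assms by (simp add: diff_smult star_add star_smult)
  then show ?thesis using assms by simp
qed

lemma diff_zero [simp]: "x \<in> carrier A \<Longrightarrow> x \<ominus> \<zero> = x"
  by (simp add: M.minus_eq)

lemma nrm_le_diff:
  assumes "x \<in> carrier A" "y \<in> carrier A"
  shows "nrm x \<le> nrm y + nrm (x \<ominus> y)"
  using nrm_diff_triangle[of x y \<zero>] assms by simp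

lemma eval_closed:
  assumes "\<And>x. x \<in> X \<Longrightarrow> h x \<in> carrier A" "set_star_term t \<subseteq> X"
  shows "eval A h t \<in> carrier A"
  using assms(2) by (induction t) (auto simp: assms(1))

lemma projection_nrm_le:
  assumes "is_projection A p" shows "nrm p \<le> 1"
proof -
  have p: "p \<in> carrier A" "star p \<otimes> p = p" using assms by (auto simp: is_projection_def)
  then have "nrm p = nrm p * nrm p" using nrm_star_mult[OF p(1)] by (simp add: power2_eq_square)
  then have "nrm p = 0 \<or> nrm p = 1" by simp
  then show ?thesis by auto
qed

lemma partial_isometry_nrm_le:
  assumes "is_partial_isometry A t" shows "nrm t \<le> 1"
proof -
  have t: "t \<in> carrier A" "t \<otimes> star t \<otimes> t = t" using assms by (auto simp: is_partial_isometry_def)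
  have "is_projection A (star t \<otimes> t)"
    unfolding is_projection_def
  proof (intro conjI)
    have "star t \<otimes> t \<otimes> (star t \<otimes> t) = star t \<otimes> (t \<otimes> star t \<otimes> t)"
      using t(1) by (simp add: mult_assoc)
    then show "star t \<otimes> t \<otimes> (star t \<otimes> t) = star t \<otimes> t" using t by simp
  qed (use t in \<open>simp_all add: star_mult\<close>)
  then have "(nrm t)\<^sup>2 \<le> 1" using projection_nrm_le nrm_star_mult[OF t(1)] by fastforce
  then show ?thesis using power2_le_imp_le[of "nrm t" 1] by simp
qed


end

primrec term_bound :: "'x star_term \<Rightarrow> real" where
  "term_bound TZero = 0"
| "term_bound (TGen x) = 1"
| "term_bound (TAdd s t) = term_bound s + term_bound t"
| "term_bound (TScale c t) = cmod c * term_bound t"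
| "term_bound (TMult s t) = term_bound s * term_bound t"
| "term_bound (TStar t) = term_bound t"

lemma (in pre_cstar_algebra) eval_bounded:
  assumes h: "\<And>x. x \<in> X \<Longrightarrow> h x \<in> carrier A" "\<And>x. x \<in> X \<Longrightarrow> nrm (h x) \<le> 1"
    and t: "set_star_term t \<subseteq> X"
  shows "nrm (eval A h t) \<le> term_bound t"
  using t
proof (induction t)
  case (TAdd s t)
  then show ?case using nrm_add[of "eval A h s" "eval A h t"] eval_closed[of X h] h(1) by fastforce
next
  case (TScale c t)
  then show ?case using nrm_smult eval_closed[of X h] h(1) by (fastforce intro: mult_left_mono)
next
  case (TMult s t)
  have c: "eval A h s \<in> carrier A" "eval A h t \<in> carrier A"
    using TMult.prems eval_closed[of X h] h(1) by auto
  have "nrm (eval A h s \<otimes> eval A h t) \<le> nrm (eval A h s) * nrm (eval A h t)"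
    by (rule nrm_mult[OF c])
  also have "\<dots> \<le> term_bound s * term_bound t"
  proof (rule mult_mono)
    show "nrm (eval A h s) \<le> term_bound s" "nrm (eval A h t) \<le> term_bound t"
      using TMult by auto
    then show "0 \<le> term_bound s" using nrm_nonneg[OF c(1)] by linarith
    show "0 \<le> nrm (eval A h t)" by (rule nrm_nonneg[OF c(2)])
  qed
  finally show ?case by simp
next
  case (TStar t)
  then show ?case using eval_closed[of X h] h(1) by fastforce
qed (use h in auto)

subsection \<open>The completion in a supremum of C*-seminorms\<close>

locale sup_seminorm =
  fixes F :: "('a star_algebra \<times> ('x \<Rightarrow> 'a)) set" and X :: "'x set"
    and N :: "'x star_term \<Rightarrow> real"
  assumes F_ne: "F \<noteq> {}"
    and F_pre: "(A, h) \<in> F \<Longrightarrow> pre_cstar_algebra A"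
    and F_gen: "\<lbrakk>(A, h) \<in> F; x \<in> X\<rbrakk> \<Longrightarrow> h x \<in> carrier A"
    and F_bdd: "\<lbrakk>(A, h) \<in> F; set_star_term t \<subseteq> X\<rbrakk> \<Longrightarrow> cnorm A (eval A h t) \<le> term_bound t"
    and N_def: "N t = Sup {cnorm A (eval A h t) | A h. (A, h) \<in> F}"
begin

definition TT :: "'x star_term set" where "TT = {t. set_star_term t \<subseteq> X}"

lemma TT_simps [simp]:
  "TZero \<in> TT" "TGen x \<in> TT \<longleftrightarrow> x \<in> X" "TAdd s t \<in> TT \<longleftrightarrow> s \<in> TT \<and> t \<in> TT"
  "TScale c t \<in> TT \<longleftrightarrow> t \<in> TT" "TMult s t \<in> TT \<longleftrightarrow> s \<in> TT \<and> t \<in> TT" "TStar t \<in> TT \<longleftrightarrow> t \<in> TT"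
  by (auto simp: TT_def)

lemma eval_in: "(A, h) \<in> F \<Longrightarrow> t \<in> TT \<Longrightarrow> eval A h t \<in> carrier A"
  using pre_cstar_algebra.eval_closed[OF F_pre, of A h X h t] F_gen unfolding TT_def by blast

lemma N_ge: "(A, h) \<in> F \<Longrightarrow> t \<in> TT \<Longrightarrow> cnorm A (eval A h t) \<le> N t"
  unfolding N_def by (rule cSup_upper) (auto simp: TT_def bdd_above_def intro!: F_bdd exI[of _ "term_bound t"])

lemma N_le: "(\<And>A h. (A, h) \<in> F \<Longrightarrow> cnorm A (eval A h t) \<le> c) \<Longrightarrow> N t \<le> c"
  unfolding N_def by (rule cSup_least) (use F_ne in auto)

lemma N_nonneg: assumes t: "t \<in> TT" shows "0 \<le> N t"
proof -
  obtain A h where F: "(A, h) \<in> F" using F_ne by auto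
  interpret pre_cstar_algebra A by (rule F_pre[OF F])
  show ?thesis using N_ge[OF F t] nrm_nonneg[OF eval_in[OF F t]] by linarith
qed

abbreviation "dd \<equiv> tdist N"

lemma eval_diff: "(A, h) \<in> F \<Longrightarrow> s \<in> TT \<Longrightarrow> t \<in> TT \<Longrightarrow>
    eval A h (TAdd s (TScale (-1) t)) = eval A h s \<ominus>\<^bsub>A\<^esub> eval A h t"
  by (simp add: pre_cstar_algebra.diff_smult[OF F_pre] eval_in)

lemma dd_ge: "(A, h) \<in> F \<Longrightarrow> s \<in> TT \<Longrightarrow> t \<in> TT \<Longrightarrow>
    cnorm A (eval A h s \<ominus>\<^bsub>A\<^esub> eval A h t) \<le> dd s t"
  using N_ge[of A h "TAdd s (TScale (-1) t)"] eval_diff[of A h s t] by (simp add: tdist_def)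

lemma dd_le: "s \<in> TT \<Longrightarrow> t \<in> TT \<Longrightarrow>
   (\<And>A h. (A, h) \<in> F \<Longrightarrow> cnorm A (eval A h s \<ominus>\<^bsub>A\<^esub> eval A h t) \<le> c) \<Longrightarrow> dd s t \<le> c"
  unfolding tdist_def by (rule N_le) (simp only: eval_diff)

lemma dd_nonneg: "s \<in> TT \<Longrightarrow> t \<in> TT \<Longrightarrow> 0 \<le> dd s t"
  unfolding tdist_def by (rule N_nonneg) simp

lemma dd_eq_0: "s \<in> TT \<Longrightarrow> t \<in> TT \<Longrightarrow> (\<And>A h. (A, h) \<in> F \<Longrightarrow> eval A h s = eval A h t) \<Longrightarrow> dd s t = 0"
proof (rule antisym[OF _ dd_nonneg])
  assume a: "s \<in> TT" "t \<in> TT" "\<And>A h. (A, h) \<in> F \<Longrightarrow> eval A h s = eval A h t"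
  show "dd s t \<le> 0"
  proof (rule dd_le[OF a(1,2)])
    fix A h assume F: "(A, h) \<in> F"
    interpret pre_cstar_algebra A by (rule F_pre[OF F])
    show "cnorm A (eval A h s \<ominus>\<^bsub>A\<^esub> eval A h t) \<le> 0"
      using a(3)[OF F] nrm_diff_eq_0[OF eval_in[OF F a(2)] eval_in[OF F a(2)]] by simp
  qed
qed

lemma dd_eq_0D:
  assumes "s \<in> TT" "t \<in> TT" "dd s t = 0" and F: "(A, h) \<in> F"
  shows "eval A h s = eval A h t"
proof -
  interpret pre_cstar_algebra A by (rule F_pre[OF F])
  note e = assms(1,2)[THEN eval_in[OF F]]
  show ?thesis
    using dd_ge[OF F assms(1,2)] assms(3) nrm_diff_eq_0[OF e]
    by (metis M.minus_closed antisym e nrm_nonneg)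
qed

lemma dd_commute_le: assumes "s \<in> TT" "t \<in> TT" shows "dd s t \<le> dd t s"
proof (rule dd_le[OF assms])
  fix A h assume F: "(A, h) \<in> F"
  interpret pre_cstar_algebra A by (rule F_pre[OF F])
  show "cnorm A (eval A h s \<ominus>\<^bsub>A\<^esub> eval A h t) \<le> dd t s"
    using nrm_diff_commute[OF assms[THEN eval_in[OF F]]] dd_ge[OF F assms(2,1)] by simp
qed

lemma dd_commute: "s \<in> TT \<Longrightarrow> t \<in> TT \<Longrightarrow> dd s t = dd t s"
  using dd_commute_le by (metis antisym)

lemma dd_triangle: assumes "s \<in> TT" "t \<in> TT" "u \<in> TT" shows "dd s u \<le> dd s t + dd t u"
proof (rule dd_le[OF assms(1,3)])
  fix A h assume F: "(A, h) \<in> F"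
  interpret pre_cstar_algebra A by (rule F_pre[OF F])
  show "cnorm A (eval A h s \<ominus>\<^bsub>A\<^esub> eval A h u) \<le> dd s t + dd t u"
    using nrm_diff_triangle[of "eval A h s" "eval A h t" "eval A h u"] dd_ge[OF F, of s t]
      dd_ge[OF F, of t u] assms eval_in[OF F] by force
qed

lemma N_diff: assumes "s \<in> TT" "t \<in> TT" shows "\<bar>N s - N t\<bar> \<le> dd s t"
proof -
  have *: "N s \<le> N t + dd s t" if "s \<in> TT" "t \<in> TT" for s t
  proof (rule N_le)
    fix A h assume F: "(A, h) \<in> F"
    interpret pre_cstar_algebra A by (rule F_pre[OF F])
    show "cnorm A (eval A h s) \<le> N t + dd s t"
      using nrm_le_diff[of "eval A h s" "eval A h t"] dd_ge[OF F that] N_ge[OF F that(2)]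
        eval_in[OF F] that by force
  qed
  show ?thesis using *[OF assms] *[OF assms(2,1)] dd_commute[OF assms] by linarith
qed

lemma dd_add: assumes "s \<in> TT" "t \<in> TT" "s' \<in> TT" "t' \<in> TT"
  shows "dd (TAdd s t) (TAdd s' t') \<le> dd s s' + dd t t'"
proof (rule dd_le)
  fix A h assume F: "(A, h) \<in> F"
  interpret pre_cstar_algebra A by (rule F_pre[OF F])
  show "cnorm A (eval A h (TAdd s t) \<ominus>\<^bsub>A\<^esub> eval A h (TAdd s' t')) \<le> dd s s' + dd t t'"
    using nrm_diff_add[of "eval A h s" "eval A h t" "eval A h s'" "eval A h t'"] dd_ge[OF F, of s s']
      dd_ge[OF F, of t t'] assms eval_in[OF F] by force
qed (use assms in auto)

lemma dd_mult: assumes "s \<in> TT" "t \<in> TT" "s' \<in> TT" "t' \<in> TT"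
  shows "dd (TMult s t) (TMult s' t') \<le> N s * dd t t' + dd s s' * N t'"
proof (rule dd_le)
  fix A h assume F: "(A, h) \<in> F"
  interpret pre_cstar_algebra A by (rule F_pre[OF F])
  note e = assms[THEN eval_in[OF F]]
  have "cnorm A (eval A h s) * cnorm A (eval A h t \<ominus>\<^bsub>A\<^esub> eval A h t') \<le> N s * dd t t'"
    by (intro mult_mono N_ge dd_ge F assms N_nonneg) (use e in auto)
  moreover have "cnorm A (eval A h s \<ominus>\<^bsub>A\<^esub> eval A h s') * cnorm A (eval A h t') \<le> dd s s' * N t'"
    by (intro mult_mono N_ge dd_ge F assms dd_nonneg) (use e in auto)
  ultimately show "cnorm A (eval A h (TMult s t) \<ominus>\<^bsub>A\<^esub> eval A h (TMult s' t')) \<le> N s * dd t t' + dd s s' * N t'"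
    using nrm_diff_mult[OF e] by simp
qed (use assms in auto)

lemma dd_scale: assumes "s \<in> TT" "s' \<in> TT"
  shows "dd (TScale c s) (TScale c s') \<le> cmod c * dd s s'"
proof (rule dd_le)
  fix A h assume F: "(A, h) \<in> F"
  interpret pre_cstar_algebra A by (rule F_pre[OF F])
  note e = assms[THEN eval_in[OF F]]
  show "cnorm A (eval A h (TScale c s) \<ominus>\<^bsub>A\<^esub> eval A h (TScale c s')) \<le> cmod c * dd s s'"
    using nrm_diff_smult[OF e] dd_ge[OF F assms] by (simp add: mult_left_mono)
qed (use assms in auto)

lemma dd_star: assumes "s \<in> TT" "s' \<in> TT"
  shows "dd (TStar s) (TStar s') \<le> dd s s'"
proof (rule dd_le)
  fix A h assume F: "(A, h) \<in> F"
  interpret pre_cstar_algebra A by (rule F_pre[OF F])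
  note e = assms[THEN eval_in[OF F]]
  show "cnorm A (eval A h (TStar s) \<ominus>\<^bsub>A\<^esub> eval A h (TStar s')) \<le> dd s s'"
    using nrm_diff_star[OF e] dd_ge[OF F assms] by simp
qed (use assms in auto)

lemma N_zero: "N TZero = 0"
proof (rule antisym)
  show "N TZero \<le> 0" by (rule N_le) (simp add: pre_cstar_algebra.nrm_zero[OF F_pre])
qed (simp add: N_nonneg)

lemma N_add: assumes "s \<in> TT" "t \<in> TT" shows "N (TAdd s t) \<le> N s + N t"
proof (rule N_le)
  fix A h assume F: "(A, h) \<in> F"
  interpret pre_cstar_algebra A by (rule F_pre[OF F])
  show "cnorm A (eval A h (TAdd s t)) \<le> N s + N t"
    using nrm_add[of "eval A h s" "eval A h t"] assms[THEN N_ge[OF F]] assms[THEN eval_in[OF F]] by force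
qed

lemma N_mult: assumes "s \<in> TT" "t \<in> TT" shows "N (TMult s t) \<le> N s * N t"
proof (rule N_le)
  fix A h assume F: "(A, h) \<in> F"
  interpret pre_cstar_algebra A by (rule F_pre[OF F])
  note e = assms[THEN eval_in[OF F]]
  have "cnorm A (eval A h s) * cnorm A (eval A h t) \<le> N s * N t"
    by (intro mult_mono N_ge F assms N_nonneg) (use e in auto)
  then show "cnorm A (eval A h (TMult s t)) \<le> N s * N t"
    using nrm_mult[OF e] by simp
qed

lemma N_scale: assumes "t \<in> TT" shows "N (TScale c t) = cmod c * N t"
proof -
  have *: "N (TScale c t) \<le> cmod c * N t" if "t \<in> TT" for t c
  proof (rule N_le)
    fix A h assume F: "(A, h) \<in> F"
    interpret pre_cstar_algebra A by (rule F_pre[OF F])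
    show "cnorm A (eval A h (TScale c t)) \<le> cmod c * N t"
      using nrm_smult[OF eval_in[OF F that]] N_ge[OF F that] by (simp add: mult_left_mono)
  qed
  show ?thesis
  proof (cases "c = 0")
    case True
    then show ?thesis using *[OF assms, of 0] N_nonneg[of "TScale c t"] assms by simp
  next
    case False
    have "N t = N (TScale (inverse c) (TScale c t))"
    proof -
      have "dd t (TScale (inverse c) (TScale c t)) = 0"
      proof (rule dd_eq_0)
        fix A h assume F: "(A, h) \<in> F"
        interpret pre_cstar_algebra A by (rule F_pre[OF F])
        show "eval A h t = eval A h (TScale (inverse c) (TScale c t))"
          using eval_in[OF F assms] False by (simp add: smult_smult)
      qed (use assms in auto)
      then show ?thesis using N_diff[of t "TScale (inverse c) (TScale c t)"] assms by simp
    qed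
    also have "\<dots> \<le> cmod (inverse c) * N (TScale c t)" using assms by (intro *) simp
    finally have "cmod c * N t \<le> N (TScale c t)" using False
      by (simp add: norm_inverse norm_divide divide_simps mult.commute)
    then show ?thesis using *[OF assms, of c] by simp
  qed
qed

lemma N_star_mult: assumes "t \<in> TT" shows "N (TMult (TStar t) t) = (N t)\<^sup>2"
proof (rule antisym)
  show "N (TMult (TStar t) t) \<le> (N t)\<^sup>2"
  proof (rule N_le)
    fix A h assume F: "(A, h) \<in> F"
    interpret pre_cstar_algebra A by (rule F_pre[OF F])
    show "cnorm A (eval A h (TMult (TStar t) t)) \<le> (N t)\<^sup>2"
      using nrm_star_mult[OF eval_in[OF F assms]] N_ge[OF F assms] eval_in[OF F assms] by (simp add: power_mono)
  qed
  have "N t \<le> sqrt (N (TMult (TStar t) t))"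
  proof (rule N_le)
    fix A h assume F: "(A, h) \<in> F"
    interpret pre_cstar_algebra A by (rule F_pre[OF F])
    show "cnorm A (eval A h t) \<le> sqrt (N (TMult (TStar t) t))"
      using nrm_star_mult[OF eval_in[OF F assms]] N_ge[OF F, of "TMult (TStar t) t"] assms
      by (auto intro: real_le_rsqrt)
  qed
  then show "(N t)\<^sup>2 \<le> N (TMult (TStar t) t)"
    using power_mono[of "N t" _ 2] N_nonneg[of t] N_nonneg[of "TMult (TStar t) t"] assms by fastforce
qed

end

context sup_seminorm
begin

abbreviation "CS \<equiv> cauchy_seqs X N"
abbreviation "RR \<equiv> null_equiv X N"
abbreviation "CC \<equiv> completion X N"
abbreviation cls :: "(nat \<Rightarrow> 'x star_term) \<Rightarrow> (nat \<Rightarrow> 'x star_term) set" where "cls x \<equiv> RR `` {x}"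

lemma CS_TT: "x \<in> CS \<Longrightarrow> x n \<in> TT"
  by (auto simp: cauchy_seqs_def TT_def)

lemma CS_D: "x \<in> CS \<Longrightarrow> e > 0 \<Longrightarrow> \<exists>M. \<forall>m\<ge>M. \<forall>n\<ge>M. dd (x m) (x n) < e"
  by (simp add: cauchy_seqs_def)

lemma CS_I: "(\<And>n. x n \<in> TT) \<Longrightarrow> (\<And>e. e > 0 \<Longrightarrow> \<exists>M. \<forall>m\<ge>M. \<forall>n\<ge>M. dd (x m) (x n) < e) \<Longrightarrow> x \<in> CS"
  by (auto simp: cauchy_seqs_def TT_def)

lemma dd_refl [simp]: "t \<in> TT \<Longrightarrow> dd t t = 0"
  by (rule dd_eq_0) auto

lemma const_CS: "t \<in> TT \<Longrightarrow> (\<lambda>n. t) \<in> CS"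
  by (rule CS_I) auto

lemma RR_iff: "(x, y) \<in> RR \<longleftrightarrow> x \<in> CS \<and> y \<in> CS \<and> (\<lambda>n. dd (x n) (y n)) \<longlonglongrightarrow> 0"
  by (auto simp: null_equiv_def)

lemma null_by_bound:
  fixes f g :: "nat \<Rightarrow> real"
  assumes "\<And>n. 0 \<le> f n" "\<And>n. f n \<le> g n" "g \<longlonglongrightarrow> 0"
  shows "f \<longlonglongrightarrow> 0"
  by (rule tendsto_sandwich[OF _ _ tendsto_const assms(3)]) (auto simp: assms)

lemma equivRR: "equiv CS RR"
proof (rule equivI)
  show "RR \<subseteq> CS \<times> CS" by (auto simp: RR_iff)
  show "refl_on CS RR" by (auto simp: refl_on_def RR_iff CS_TT)
  show "sym RR" by (rule symI) (simp add: RR_iff CS_TT dd_commute)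
  show "trans RR"
  proof (rule transI)
    fix x y z assume *: "(x, y) \<in> RR" "(y, z) \<in> RR"
    then have "(\<lambda>n. dd (x n) (y n) + dd (y n) (z n)) \<longlonglongrightarrow> 0"
      by (auto simp: RR_iff intro: tendsto_add_zero)
    then have "(\<lambda>n. dd (x n) (z n)) \<longlonglongrightarrow> 0"
      by (rule null_by_bound[rotated 2]) (use * in \<open>auto simp: RR_iff CS_TT dd_nonneg dd_triangle\<close>)
    then show "(x, z) \<in> RR" using * by (simp add: RR_iff)
  qed
qed

lemma cls_eq: "x \<in> CS \<Longrightarrow> y \<in> CS \<Longrightarrow> cls x = cls y \<longleftrightarrow> (\<lambda>n. dd (x n) (y n)) \<longlonglongrightarrow> 0"
  using eq_equiv_class_iff[OF equivRR] by (simp add: RR_iff)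

lemma cls_eqI:
  assumes "x \<in> CS" "y \<in> CS"
    "\<And>A h n. (A, h) \<in> F \<Longrightarrow> pre_cstar_algebra A \<Longrightarrow> (\<And>t. t \<in> TT \<Longrightarrow> eval A h t \<in> carrier A)
       \<Longrightarrow> eval A h (x n) = eval A h (y n)"
  shows "cls x = cls y"
proof -
  have "dd (x n) (y n) = 0" for n
    by (rule dd_eq_0) (auto simp: assms CS_TT F_pre eval_in)
  then show ?thesis by (simp add: cls_eq assms)
qed

lemma in_CC: "U \<in> carrier CC \<longleftrightarrow> (\<exists>x\<in>CS. U = cls x)"
  by (auto simp: completion_def Let_def quotient_def)

lemma cls_in_CC [simp]: "x \<in> CS \<Longrightarrow> cls x \<in> carrier CC"
  by (auto simp: in_CC)

lemma N_tendsto: assumes "x \<in> CS" shows "(\<lambda>n. N (x n)) \<longlonglongrightarrow> lim (\<lambda>n. N (x n))"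
proof -
  have "Cauchy (\<lambda>n. N (x n))"
  proof (rule CauchyI)
    fix e :: real assume "e > 0"
    then obtain M where M: "\<forall>m\<ge>M. \<forall>n\<ge>M. dd (x m) (x n) < e" using CS_D[OF assms] by blast
    have "norm (N (x m) - N (x n)) < e" if "m \<ge> M" "n \<ge> M" for m n
      using M that N_diff[of "x m" "x n"] CS_TT[OF assms] by (auto intro: le_less_trans)
    then show "\<exists>M. \<forall>m\<ge>M. \<forall>n\<ge>M. norm (N (x m) - N (x n)) < e" by blast
  qed
  then show ?thesis using Cauchy_convergent convergent_LIMSEQ_iff by blast
qed

lemma CS_bdd: assumes "x \<in> CS" obtains B where "B > 0" "\<And>n. N (x n) \<le> B"
proof -
  have "Bseq (\<lambda>n. N (x n))" using N_tendsto[OF assms] by (auto intro: convergent_imp_Bseq convergentI)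
  then obtain B where "B > 0" "\<forall>n. norm (N (x n)) \<le> B" by (auto elim: BseqE)
  then show thesis by (intro that[of B]) (auto intro: order_trans[OF abs_ge_self])
qed

lemma CS_I2:
  assumes "x \<in> CS" "y \<in> CS" "0 \<le> a" "0 \<le> b" "\<And>n. z n \<in> TT"
    "\<And>m n. dd (z m) (z n) \<le> a * dd (x m) (x n) + b * dd (y m) (y n)"
  shows "z \<in> CS"
proof (rule CS_I[OF assms(5)])
  fix e :: real assume e: "e > 0"
  define d where "d = e / (a + b + 1)"
  have d: "d > 0" using e assms(3,4) by (simp add: d_def)
  obtain M1 where M1: "\<forall>m\<ge>M1. \<forall>n\<ge>M1. dd (x m) (x n) < d" using CS_D[OF assms(1) d] by blast
  obtain M2 where M2: "\<forall>m\<ge>M2. \<forall>n\<ge>M2. dd (y m) (y n) < d" using CS_D[OF assms(2) d] by blast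
  have "dd (z m) (z n) < e" if "m \<ge> max M1 M2" "n \<ge> max M1 M2" for m n
  proof -
    have "a * dd (x m) (x n) + b * dd (y m) (y n) \<le> a * d + b * d"
      using M1 M2 that assms(3,4) by (intro add_mono mult_left_mono) (auto intro: less_imp_le)
    also have "\<dots> < (a + b + 1) * d" using d by (simp add: algebra_simps)
    also have "\<dots> = e" using assms(3,4) by (simp add: d_def)
    finally show ?thesis using assms(6)[of m n] by linarith
  qed
  then show "\<exists>M. \<forall>m\<ge>M. \<forall>n\<ge>M. dd (z m) (z n) < e" by blast
qed

lemma CS_zero [simp]: "(\<lambda>n. TZero) \<in> CS" by (rule const_CS) simp

lemma CS_add [simp]: "x \<in> CS \<Longrightarrow> y \<in> CS \<Longrightarrow> (\<lambda>n. TAdd (x n) (y n)) \<in> CS"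
  by (rule CS_I2[of x y 1 1]) (auto simp: CS_TT dd_add)

lemma CS_scale [simp]: "x \<in> CS \<Longrightarrow> (\<lambda>n. TScale c (x n)) \<in> CS"
  by (rule CS_I2[of x x "cmod c" 0]) (auto simp: CS_TT dd_scale)

lemma CS_star [simp]: "x \<in> CS \<Longrightarrow> (\<lambda>n. TStar (x n)) \<in> CS"
  by (rule CS_I2[of x x 1 0]) (auto simp: CS_TT dd_star)

lemma dd_mult_bound:
  assumes "s \<in> TT" "t \<in> TT" "s' \<in> TT" "t' \<in> TT" "N s \<le> B" "N t' \<le> B'"
  shows "dd (TMult s t) (TMult s' t') \<le> B' * dd s s' + B * dd t t'"
proof -
  have "N s * dd t t' \<le> B * dd t t'" "dd s s' * N t' \<le> B' * dd s s'"
    using assms by (simp_all add: dd_nonneg mult_right_mono mult_left_mono mult.commute)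
  then show ?thesis using dd_mult[OF assms(1-4)] by linarith
qed

lemma CS_mult [simp]: assumes x: "x \<in> CS" and y: "y \<in> CS" shows "(\<lambda>n. TMult (x n) (y n)) \<in> CS"
proof -
  obtain B where B: "B > 0" "\<And>n. N (x n) \<le> B" by (rule CS_bdd[OF x]) blast
  obtain B' where B': "B' > 0" "\<And>n. N (y n) \<le> B'" by (rule CS_bdd[OF y]) blast
  show ?thesis by (rule CS_I2[OF x y, of B' B]) (use B B' x y in \<open>auto simp: CS_TT intro!: dd_mult_bound\<close>)
qed

lemma RR_I2:
  assumes "(x, x') \<in> RR" "(y, y') \<in> RR" "z \<in> CS" "z' \<in> CS"
    "\<And>n. dd (z n) (z' n) \<le> a * dd (x n) (x' n) + b * dd (y n) (y' n)"
  shows "(z, z') \<in> RR"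
proof -
  have "(\<lambda>n. a * dd (x n) (x' n) + b * dd (y n) (y' n)) \<longlonglongrightarrow> a * 0 + b * 0"
    using assms(1,2) by (intro tendsto_intros) (auto simp: RR_iff)
  then have "(\<lambda>n. dd (z n) (z' n)) \<longlonglongrightarrow> 0"
    by (intro null_by_bound[OF _ assms(5)]) (auto simp: dd_nonneg CS_TT assms(3,4))
  then show ?thesis using assms by (simp add: RR_iff)
qed

lemma RR_add: "(x, x') \<in> RR \<Longrightarrow> (y, y') \<in> RR \<Longrightarrow> (\<lambda>n. TAdd (x n) (y n), \<lambda>n. TAdd (x' n) (y' n)) \<in> RR"
  by (rule RR_I2[of x x' y y' _ _ 1 1]) (auto simp: RR_iff CS_TT dd_add)

lemma RR_scale: "(x, x') \<in> RR \<Longrightarrow> (\<lambda>n. TScale c (x n), \<lambda>n. TScale c (x' n)) \<in> RR"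
  by (rule RR_I2[of x x' x x' _ _ "cmod c" 0]) (auto simp: RR_iff CS_TT dd_scale)

lemma RR_star: "(x, x') \<in> RR \<Longrightarrow> (\<lambda>n. TStar (x n), \<lambda>n. TStar (x' n)) \<in> RR"
  by (rule RR_I2[of x x' x x' _ _ 1 0]) (auto simp: RR_iff CS_TT dd_star)

lemma RR_mult: assumes "(x, x') \<in> RR" "(y, y') \<in> RR"
  shows "(\<lambda>n. TMult (x n) (y n), \<lambda>n. TMult (x' n) (y' n)) \<in> RR"
proof -
  have CS: "x \<in> CS" "x' \<in> CS" "y \<in> CS" "y' \<in> CS" using assms by (auto simp: RR_iff)
  obtain B where B: "B > 0" "\<And>n. N (x n) \<le> B" by (rule CS_bdd[OF CS(1)]) blast
  obtain B' where B': "B' > 0" "\<And>n. N (y' n) \<le> B'" by (rule CS_bdd[OF CS(4)]) blast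
  show ?thesis
    by (rule RR_I2[OF assms, of _ _ B' B]) (use B B' CS in \<open>auto simp: CS_TT intro!: dd_mult_bound\<close>)
qed

lemma CC_zero: "\<zero>\<^bsub>CC\<^esub> = cls (\<lambda>n. TZero)"
  by (simp add: completion_def Let_def)

lemma UN_cls2:
  assumes "\<And>x x' y y'. (x, x') \<in> RR \<Longrightarrow> (y, y') \<in> RR \<Longrightarrow> (f x y, f x' y') \<in> RR" "x \<in> CS" "y \<in> CS"
  shows "(\<Union>x\<in>cls x. \<Union>y\<in>cls y. cls (f x y)) = cls (f x y)"
proof (rule UN_equiv_class2[OF equivRR equivRR])
  show "congruent2 RR RR (\<lambda>x y. cls (f x y))"
    by (rule congruent2I') (rule equiv_class_eq[OF equivRR assms(1)])
qed (use assms in auto)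

lemma UN_cls1:
  assumes "\<And>x x'. (x, x') \<in> RR \<Longrightarrow> (f x, f x') \<in> RR" "x \<in> CS"
  shows "(\<Union>x\<in>cls x. cls (f x)) = cls (f x)"
proof (rule UN_equiv_class[OF equivRR])
  show "congruent RR (\<lambda>x. cls (f x))"
    by (rule congruentI) (rule equiv_class_eq[OF equivRR assms(1)])
qed (use assms in auto)

lemma CC_add: "x \<in> CS \<Longrightarrow> y \<in> CS \<Longrightarrow> cls x \<oplus>\<^bsub>CC\<^esub> cls y = cls (\<lambda>n. TAdd (x n) (y n))"
  using UN_cls2[of "\<lambda>x y n. TAdd (x n) (y n)" x y] RR_add by (simp add: completion_def Let_def)

lemma CC_mult: "x \<in> CS \<Longrightarrow> y \<in> CS \<Longrightarrow> cls x \<otimes>\<^bsub>CC\<^esub> cls y = cls (\<lambda>n. TMult (x n) (y n))"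
  using UN_cls2[of "\<lambda>x y n. TMult (x n) (y n)" x y] RR_mult by (simp add: completion_def Let_def)

lemma CC_scale: "x \<in> CS \<Longrightarrow> c \<odot>\<^bsub>CC\<^esub> cls x = cls (\<lambda>n. TScale c (x n))"
  using UN_cls1[of "\<lambda>x n. TScale c (x n)" x] RR_scale by (simp add: completion_def Let_def)

lemma CC_star: "x \<in> CS \<Longrightarrow> adj CC (cls x) = cls (\<lambda>n. TStar (x n))"
  using UN_cls1[of "\<lambda>x n. TStar (x n)" x] RR_star by (simp add: completion_def Let_def)

lemma CC_nrm: assumes x: "x \<in> CS" shows "cnorm CC (cls x) = lim (\<lambda>n. N (x n))"
proof -
  have "lim (\<lambda>n. N (y n)) = lim (\<lambda>n. N (x n))" if y: "y \<in> cls x" for y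
  proof -
    have RR: "(y, x) \<in> RR" using y equivRR by (simp add: equiv_def symD)
    have "(\<lambda>n. N (y n) - N (x n)) \<longlonglongrightarrow> 0"
      by (rule tendsto_rabs_zero_cancel, rule null_by_bound[of _ "\<lambda>n. dd (y n) (x n)"])
        (use RR in \<open>auto simp: RR_iff N_diff CS_TT\<close>)
    from tendsto_add[OF this N_tendsto[OF x]] have "(\<lambda>n. N (y n)) \<longlonglongrightarrow> lim (\<lambda>n. N (x n))" by simp
    then show ?thesis by (rule limI)
  qed
  moreover have "x \<in> cls x" by (rule equiv_class_self[OF equivRR x])
  ultimately have "(\<lambda>x. lim (\<lambda>n. N (x n))) ` cls x = {lim (\<lambda>n. N (x n))}" by blast
  then show ?thesis by (simp add: completion_def Let_def)
qed

lemma CC_nrm_tendsto: "x \<in> CS \<Longrightarrow> (\<lambda>n. N (x n)) \<longlonglongrightarrow> cnorm CC (cls x)"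
  by (simp add: CC_nrm N_tendsto)

lemmas CC_ops = CC_zero CC_add CC_mult CC_scale CC_star

lemma dd_zero: "t \<in> TT \<Longrightarrow> dd t TZero = N t"
  using N_diff[of t TZero] N_add[of t "TScale (-1) TZero"] N_scale[of TZero "-1"]
  by (simp add: N_zero tdist_def)

lemma cring_complex: "cring complex_ring"
  by (rule cringI) (auto intro!: abelian_groupI comm_monoidI exI[of _ "- x" for x] simp: algebra_simps)

end

context sup_seminorm
begin

lemma CC_abelian_group: "abelian_group CC"
proof (rule abelian_groupI)
  fix U V W assume "U \<in> carrier CC" "V \<in> carrier CC" "W \<in> carrier CC"
  then obtain x y z where *: "x \<in> CS" "y \<in> CS" "z \<in> CS" "U = cls x" "V = cls y" "W = cls z"
    by (auto simp: in_CC)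
  show "U \<oplus>\<^bsub>CC\<^esub> V \<in> carrier CC" using * by (simp add: CC_ops)
  show "U \<oplus>\<^bsub>CC\<^esub> V \<oplus>\<^bsub>CC\<^esub> W = U \<oplus>\<^bsub>CC\<^esub> (V \<oplus>\<^bsub>CC\<^esub> W)"
    unfolding * using *(1-3)
  proof (simp add: CC_ops, intro cls_eqI)
    fix A h n assume F: "(A, h) \<in> F" "pre_cstar_algebra A" "\<And>t. t \<in> TT \<Longrightarrow> eval A h t \<in> carrier A"
    interpret pre_cstar_algebra A by fact
    show "eval A h (TAdd (TAdd (x n) (y n)) (z n)) = eval A h (TAdd (x n) (TAdd (y n) (z n)))"
      using * F(3) by (simp add: CS_TT M.a_assoc)
  qed simp_all
  show "U \<oplus>\<^bsub>CC\<^esub> V = V \<oplus>\<^bsub>CC\<^esub> U"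
    unfolding * using *(1-3)
  proof (simp add: CC_ops, intro cls_eqI)
    fix A h n assume F: "(A, h) \<in> F" "pre_cstar_algebra A" "\<And>t. t \<in> TT \<Longrightarrow> eval A h t \<in> carrier A"
    interpret pre_cstar_algebra A by fact
    show "eval A h (TAdd (x n) (y n)) = eval A h (TAdd (y n) (x n))"
      using * F(3) by (simp add: CS_TT M.a_comm)
  qed simp_all
  show "\<zero>\<^bsub>CC\<^esub> \<oplus>\<^bsub>CC\<^esub> U = U"
    unfolding * using *(1-3)
  proof (simp add: CC_ops, intro cls_eqI)
    fix A h n assume F: "(A, h) \<in> F" "pre_cstar_algebra A" "\<And>t. t \<in> TT \<Longrightarrow> eval A h t \<in> carrier A"
    interpret pre_cstar_algebra A by fact
    show "eval A h (TAdd TZero (x n)) = eval A h (x n)"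
      using * F(3) by (simp add: CS_TT)
  qed simp_all
  have "(-1) \<odot>\<^bsub>CC\<^esub> U \<oplus>\<^bsub>CC\<^esub> U = \<zero>\<^bsub>CC\<^esub>"
    unfolding * using *(1-3)
  proof (simp add: CC_ops, intro cls_eqI)
    fix A h n assume F: "(A, h) \<in> F" "pre_cstar_algebra A" "\<And>t. t \<in> TT \<Longrightarrow> eval A h t \<in> carrier A"
    interpret pre_cstar_algebra A by fact
    show "eval A h (TAdd (TScale (-1) (x n)) (x n)) = eval A h TZero"
      using * F(3) by (simp add: CS_TT M.l_neg flip: minus_smult)
  qed simp_all
  moreover have "(-1) \<odot>\<^bsub>CC\<^esub> U \<in> carrier CC" using * by (simp add: CC_ops)
  ultimately show "\<exists>V\<in>carrier CC. V \<oplus>\<^bsub>CC\<^esub> U = \<zero>\<^bsub>CC\<^esub>" by blast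
qed (simp add: CC_ops)

lemma CC_module: "Module.module complex_ring CC"
proof (rule moduleI[OF cring_complex CC_abelian_group])
  fix a b U V assume "U \<in> carrier CC" "V \<in> carrier CC"
  then obtain x y where *: "x \<in> CS" "y \<in> CS" "U = cls x" "V = cls y"
    by (auto simp: in_CC)
  show "a \<odot>\<^bsub>CC\<^esub> U \<in> carrier CC" using * by (simp add: CC_ops)
  show "(a \<oplus>\<^bsub>complex_ring\<^esub> b) \<odot>\<^bsub>CC\<^esub> U = a \<odot>\<^bsub>CC\<^esub> U \<oplus>\<^bsub>CC\<^esub> b \<odot>\<^bsub>CC\<^esub> U"
    unfolding * using *(1,2)
  proof (simp add: CC_ops, intro cls_eqI)
    fix A h n assume F: "(A, h) \<in> F" "pre_cstar_algebra A" "\<And>t. t \<in> TT \<Longrightarrow> eval A h t \<in> carrier A"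
    interpret pre_cstar_algebra A by fact
    show "eval A h (TScale (a + b) (x n)) = eval A h (TAdd (TScale a (x n)) (TScale b (x n)))"
      using * F(3) by (simp add: CS_TT smult_add_left)
  qed simp_all
  show "a \<odot>\<^bsub>CC\<^esub> (U \<oplus>\<^bsub>CC\<^esub> V) = a \<odot>\<^bsub>CC\<^esub> U \<oplus>\<^bsub>CC\<^esub> a \<odot>\<^bsub>CC\<^esub> V"
    unfolding * using *(1,2)
  proof (simp add: CC_ops, intro cls_eqI)
    fix A h n assume F: "(A, h) \<in> F" "pre_cstar_algebra A" "\<And>t. t \<in> TT \<Longrightarrow> eval A h t \<in> carrier A"
    interpret pre_cstar_algebra A by fact
    show "eval A h (TScale a (TAdd (x n) (y n))) = eval A h (TAdd (TScale a (x n)) (TScale a (y n)))"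
      using * F(3) by (simp add: CS_TT smult_add_right)
  qed simp_all
  show "(a \<otimes>\<^bsub>complex_ring\<^esub> b) \<odot>\<^bsub>CC\<^esub> U = a \<odot>\<^bsub>CC\<^esub> (b \<odot>\<^bsub>CC\<^esub> U)"
    unfolding * using *(1,2)
  proof (simp add: CC_ops, intro cls_eqI)
    fix A h n assume F: "(A, h) \<in> F" "pre_cstar_algebra A" "\<And>t. t \<in> TT \<Longrightarrow> eval A h t \<in> carrier A"
    interpret pre_cstar_algebra A by fact
    show "eval A h (TScale (a * b) (x n)) = eval A h (TScale a (TScale b (x n)))"
      using * F(3) by (simp add: CS_TT smult_smult)
  qed simp_all
  show "\<one>\<^bsub>complex_ring\<^esub> \<odot>\<^bsub>CC\<^esub> U = U"
    unfolding * using *(1,2)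
  proof (simp add: CC_ops, intro cls_eqI)
    fix A h n assume F: "(A, h) \<in> F" "pre_cstar_algebra A" "\<And>t. t \<in> TT \<Longrightarrow> eval A h t \<in> carrier A"
    interpret pre_cstar_algebra A by fact
    show "eval A h (TScale 1 (x n)) = eval A h (x n)"
      using * F(3) by (simp add: CS_TT)
  qed simp_all
qed

lemma CC_pre_cstar: "pre_cstar_algebra CC"
proof (rule pre_cstar_algebra.intro[OF CC_module], unfold_locales)
  fix U V W c assume "U \<in> carrier CC" "V \<in> carrier CC" "W \<in> carrier CC"
  then obtain x y z where *: "x \<in> CS" "y \<in> CS" "z \<in> CS" "U = cls x" "V = cls y" "W = cls z"
    by (auto simp: in_CC)
  show "U \<otimes>\<^bsub>CC\<^esub> V \<otimes>\<^bsub>CC\<^esub> W = U \<otimes>\<^bsub>CC\<^esub> (V \<otimes>\<^bsub>CC\<^esub> W)"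
    unfolding * using *(1-3)
  proof (simp add: CC_ops, intro cls_eqI)
    fix A h n assume F: "(A, h) \<in> F" "pre_cstar_algebra A" "\<And>t. t \<in> TT \<Longrightarrow> eval A h t \<in> carrier A"
    interpret pre_cstar_algebra A by fact
    show "eval A h (TMult (TMult (x n) (y n)) (z n)) = eval A h (TMult (x n) (TMult (y n) (z n)))"
      using * F(3) by (simp add: CS_TT mult_assoc)
  qed simp_all
  show "(U \<oplus>\<^bsub>CC\<^esub> V) \<otimes>\<^bsub>CC\<^esub> W = U \<otimes>\<^bsub>CC\<^esub> W \<oplus>\<^bsub>CC\<^esub> V \<otimes>\<^bsub>CC\<^esub> W"
    unfolding * using *(1-3)
  proof (simp add: CC_ops, intro cls_eqI)
    fix A h n assume F: "(A, h) \<in> F" "pre_cstar_algebra A" "\<And>t. t \<in> TT \<Longrightarrow> eval A h t \<in> carrier A"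
    interpret pre_cstar_algebra A by fact
    show "eval A h (TMult (TAdd (x n) (y n)) (z n)) = eval A h (TAdd (TMult (x n) (z n)) (TMult (y n) (z n)))"
      using * F(3) by (simp add: CS_TT mult_distrib_right)
  qed simp_all
  show "W \<otimes>\<^bsub>CC\<^esub> (U \<oplus>\<^bsub>CC\<^esub> V) = W \<otimes>\<^bsub>CC\<^esub> U \<oplus>\<^bsub>CC\<^esub> W \<otimes>\<^bsub>CC\<^esub> V"
    unfolding * using *(1-3)
  proof (simp add: CC_ops, intro cls_eqI)
    fix A h n assume F: "(A, h) \<in> F" "pre_cstar_algebra A" "\<And>t. t \<in> TT \<Longrightarrow> eval A h t \<in> carrier A"
    interpret pre_cstar_algebra A by fact
    show "eval A h (TMult (z n) (TAdd (x n) (y n))) = eval A h (TAdd (TMult (z n) (x n)) (TMult (z n) (y n)))"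
      using * F(3) by (simp add: CS_TT mult_distrib_left)
  qed simp_all
  show "(c \<odot>\<^bsub>CC\<^esub> U) \<otimes>\<^bsub>CC\<^esub> V = c \<odot>\<^bsub>CC\<^esub> (U \<otimes>\<^bsub>CC\<^esub> V)"
    unfolding * using *(1-3)
  proof (simp add: CC_ops, intro cls_eqI)
    fix A h n assume F: "(A, h) \<in> F" "pre_cstar_algebra A" "\<And>t. t \<in> TT \<Longrightarrow> eval A h t \<in> carrier A"
    interpret pre_cstar_algebra A by fact
    show "eval A h (TMult (TScale c (x n)) (y n)) = eval A h (TScale c (TMult (x n) (y n)))"
      using * F(3) by (simp add: CS_TT smult_mult_left)
  qed simp_all
  show "U \<otimes>\<^bsub>CC\<^esub> (c \<odot>\<^bsub>CC\<^esub> V) = c \<odot>\<^bsub>CC\<^esub> (U \<otimes>\<^bsub>CC\<^esub> V)"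
    unfolding * using *(1-3)
  proof (simp add: CC_ops, intro cls_eqI)
    fix A h n assume F: "(A, h) \<in> F" "pre_cstar_algebra A" "\<And>t. t \<in> TT \<Longrightarrow> eval A h t \<in> carrier A"
    interpret pre_cstar_algebra A by fact
    show "eval A h (TMult (x n) (TScale c (y n))) = eval A h (TScale c (TMult (x n) (y n)))"
      using * F(3) by (simp add: CS_TT smult_mult_right)
  qed simp_all
  show "adj CC (adj CC U) = U"
    unfolding * using *(1-3)
  proof (simp add: CC_ops, intro cls_eqI)
    fix A h n assume F: "(A, h) \<in> F" "pre_cstar_algebra A" "\<And>t. t \<in> TT \<Longrightarrow> eval A h t \<in> carrier A"
    interpret pre_cstar_algebra A by fact
    show "eval A h (TStar (TStar (x n))) = eval A h (x n)"
      using * F(3) by (simp add: CS_TT)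
  qed simp_all
  show "adj CC (U \<oplus>\<^bsub>CC\<^esub> V) = adj CC U \<oplus>\<^bsub>CC\<^esub> adj CC V"
    unfolding * using *(1-3)
  proof (simp add: CC_ops, intro cls_eqI)
    fix A h n assume F: "(A, h) \<in> F" "pre_cstar_algebra A" "\<And>t. t \<in> TT \<Longrightarrow> eval A h t \<in> carrier A"
    interpret pre_cstar_algebra A by fact
    show "eval A h (TStar (TAdd (x n) (y n))) = eval A h (TAdd (TStar (x n)) (TStar (y n)))"
      using * F(3) by (simp add: CS_TT star_add)
  qed simp_all
  show "adj CC (c \<odot>\<^bsub>CC\<^esub> U) = cnj c \<odot>\<^bsub>CC\<^esub> adj CC U"
    unfolding * using *(1-3)
  proof (simp add: CC_ops, intro cls_eqI)
    fix A h n assume F: "(A, h) \<in> F" "pre_cstar_algebra A" "\<And>t. t \<in> TT \<Longrightarrow> eval A h t \<in> carrier A"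
    interpret pre_cstar_algebra A by fact
    show "eval A h (TStar (TScale c (x n))) = eval A h (TScale (cnj c) (TStar (x n)))"
      using * F(3) by (simp add: CS_TT star_smult)
  qed simp_all
  show "adj CC (U \<otimes>\<^bsub>CC\<^esub> V) = adj CC V \<otimes>\<^bsub>CC\<^esub> adj CC U"
    unfolding * using *(1-3)
  proof (simp add: CC_ops, intro cls_eqI)
    fix A h n assume F: "(A, h) \<in> F" "pre_cstar_algebra A" "\<And>t. t \<in> TT \<Longrightarrow> eval A h t \<in> carrier A"
    interpret pre_cstar_algebra A by fact
    show "eval A h (TStar (TMult (x n) (y n))) = eval A h (TMult (TStar (y n)) (TStar (x n)))"
      using * F(3) by (simp add: CS_TT star_mult)
  qed simp_all
  note L = CC_nrm_tendsto
  show "0 \<le> cnorm CC U"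
    unfolding * by (rule LIMSEQ_le_const[OF L]) (use * in \<open>auto simp: N_nonneg CS_TT\<close>)
  show "cnorm CC U = 0 \<longleftrightarrow> U = \<zero>\<^bsub>CC\<^esub>"
    unfolding * using L[OF *(1)] *(1)
    by (auto simp: CC_zero cls_eq dd_zero CS_TT dest: LIMSEQ_unique)
  show "cnorm CC (U \<oplus>\<^bsub>CC\<^esub> V) \<le> cnorm CC U + cnorm CC V"
    unfolding * using *(1,2)
    by (auto simp: CC_add N_add CS_TT intro!: LIMSEQ_le[OF L tendsto_add[OF L L]])
  show "cnorm CC (c \<odot>\<^bsub>CC\<^esub> U) = cmod c * cnorm CC U"
  proof -
    have "(\<lambda>n. cmod c * N (x n)) \<longlonglongrightarrow> cnorm CC (c \<odot>\<^bsub>CC\<^esub> U)"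
      using L[of "\<lambda>n. TScale c (x n)"] * by (simp add: CC_scale N_scale CS_TT)
    moreover have "(\<lambda>n. cmod c * N (x n)) \<longlonglongrightarrow> cmod c * cnorm CC U"
      unfolding * by (rule tendsto_mult_left[OF L[OF *(1)]])
    ultimately show ?thesis by (rule LIMSEQ_unique)
  qed
  show "cnorm CC (U \<otimes>\<^bsub>CC\<^esub> V) \<le> cnorm CC U * cnorm CC V"
    unfolding * using *(1,2)
    by (auto simp: CC_mult N_mult CS_TT intro!: LIMSEQ_le[OF L tendsto_mult[OF L L]])
  show "cnorm CC (adj CC U \<otimes>\<^bsub>CC\<^esub> U) = (cnorm CC U)\<^sup>2"
  proof -
    have "(\<lambda>n. (N (x n))\<^sup>2) \<longlonglongrightarrow> cnorm CC (adj CC U \<otimes>\<^bsub>CC\<^esub> U)"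
      using L[of "\<lambda>n. TMult (TStar (x n)) (x n)"] * by (simp add: CC_star CC_mult N_star_mult CS_TT)
    moreover have "(\<lambda>n. (N (x n))\<^sup>2) \<longlonglongrightarrow> (cnorm CC U)\<^sup>2"
      unfolding * by (rule tendsto_power[OF L[OF *(1)]])
    ultimately show ?thesis by (rule LIMSEQ_unique)
  qed
  show "U \<otimes>\<^bsub>CC\<^esub> V \<in> carrier CC" "adj CC U \<in> carrier CC"
    using * by (simp_all add: CC_ops)
qed

lemma CC_diff_nrm:
  assumes "x \<in> CS" "y \<in> CS"
  shows "(\<lambda>n. dd (x n) (y n)) \<longlonglongrightarrow> cnorm CC (cls x \<ominus>\<^bsub>CC\<^esub> cls y)"
proof -
  interpret C: pre_cstar_algebra CC by (rule CC_pre_cstar)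
  show ?thesis
    using CC_nrm_tendsto[of "\<lambda>n. TAdd (x n) (TScale (-1) (y n))"] assms
    by (simp add: C.diff_smult CC_ops tdist_def)
qed

lemma CC_const_nrm: "s \<in> TT \<Longrightarrow> t \<in> TT \<Longrightarrow> cnorm CC (cls (\<lambda>_. s) \<ominus>\<^bsub>CC\<^esub> cls (\<lambda>_. t)) = dd s t"
  using CC_diff_nrm[of "\<lambda>_. s" "\<lambda>_. t"] by (simp add: const_CS LIMSEQ_const_iff)

lemma CC_approx:
  assumes x: "x \<in> CS" and e: "e > 0"
  shows "\<exists>M. \<forall>m\<ge>M. cnorm CC (cls x \<ominus>\<^bsub>CC\<^esub> cls (\<lambda>_. x m)) \<le> e"
proof -
  obtain M where M: "\<forall>m\<ge>M. \<forall>n\<ge>M. dd (x m) (x n) < e" using CS_D[OF x e] by blast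
  have "cnorm CC (cls x \<ominus>\<^bsub>CC\<^esub> cls (\<lambda>_. x m)) \<le> e" if "m \<ge> M" for m
    by (rule LIMSEQ_le_const2[OF CC_diff_nrm]) (use x M that in \<open>auto simp: const_CS CS_TT intro!: exI[of _ M] less_imp_le\<close>)
  then show ?thesis by blast
qed

lemma CC_cstar: "cstar_algebra CC"
proof -
  interpret C: pre_cstar_algebra CC by (rule CC_pre_cstar)
  show ?thesis
  proof unfold_locales
    fix U :: "nat \<Rightarrow> (nat \<Rightarrow> 'x star_term) set"
    assume U: "\<And>n. U n \<in> carrier CC"
      and cau: "\<And>e. e > 0 \<Longrightarrow> \<exists>M. \<forall>m\<ge>M. \<forall>n\<ge>M. cnorm CC (U m \<ominus>\<^bsub>CC\<^esub> U n) < e"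
    have "\<exists>t. t \<in> TT \<and> cnorm CC (U m \<ominus>\<^bsub>CC\<^esub> cls (\<lambda>_. t)) \<le> inverse (Suc m)" for m
    proof -
      obtain x where x: "x \<in> CS" "U m = cls x" using U[of m] by (auto simp: in_CC)
      have "inverse (real (Suc m)) > 0" by simp
      from CC_approx[OF x(1) this] show ?thesis using CS_TT[OF x(1)] x(2) by auto
    qed
    then obtain t where t: "\<And>m. t m \<in> TT"
      and tU: "\<And>m. cnorm CC (U m \<ominus>\<^bsub>CC\<^esub> cls (\<lambda>_. t m)) \<le> inverse (Suc m)"
      by metis
    have tc: "cls (\<lambda>_. t m) \<in> carrier CC" for m using t by (simp add: const_CS)
    have null: "(\<lambda>m. inverse (real (Suc m))) \<longlonglongrightarrow> 0" by (rule LIMSEQ_inverse_real_of_nat)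
    have tCS: "t \<in> CS"
    proof (rule CS_I[OF t])
      fix e :: real assume e: "e > 0"
      obtain M1 where M1: "\<forall>m\<ge>M1. \<forall>n\<ge>M1. cnorm CC (U m \<ominus>\<^bsub>CC\<^esub> U n) < e / 3"
        using cau[of "e / 3"] e by auto
      obtain M2 where M2: "\<forall>m\<ge>M2. inverse (real (Suc m)) < e / 3"
        using order_tendstoD(2)[OF null, of "e / 3"] e by (auto simp: eventually_sequentially)
      have "dd (t m) (t n) < e" if mn: "m \<ge> max M1 M2" "n \<ge> max M1 M2" for m n
      proof -
        have "dd (t m) (t n) = cnorm CC (cls (\<lambda>_. t m) \<ominus>\<^bsub>CC\<^esub> cls (\<lambda>_. t n))"
          by (simp add: CC_const_nrm t)
        also have "\<dots> \<le> cnorm CC (cls (\<lambda>_. t m) \<ominus>\<^bsub>CC\<^esub> U m) + cnorm CC (U m \<ominus>\<^bsub>CC\<^esub> cls (\<lambda>_. t n))"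
          by (rule C.nrm_diff_triangle[OF tc U tc])
        also have "cnorm CC (U m \<ominus>\<^bsub>CC\<^esub> cls (\<lambda>_. t n))
            \<le> cnorm CC (U m \<ominus>\<^bsub>CC\<^esub> U n) + cnorm CC (U n \<ominus>\<^bsub>CC\<^esub> cls (\<lambda>_. t n))"
          by (rule C.nrm_diff_triangle[OF U U tc])
        also have "cnorm CC (cls (\<lambda>_. t m) \<ominus>\<^bsub>CC\<^esub> U m) = cnorm CC (U m \<ominus>\<^bsub>CC\<^esub> cls (\<lambda>_. t m))"
          by (rule C.nrm_diff_commute[OF tc U])
        finally have "dd (t m) (t n) \<le> inverse (Suc m) + (cnorm CC (U m \<ominus>\<^bsub>CC\<^esub> U n) + inverse (Suc n))"
          using tU[of m] tU[of n] by linarith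
        moreover have "inverse (real (Suc m)) < e / 3" "inverse (real (Suc n)) < e / 3"
          "cnorm CC (U m \<ominus>\<^bsub>CC\<^esub> U n) < e / 3" using M1 M2 mn by auto
        ultimately show ?thesis by linarith
      qed
      then show "\<exists>M. \<forall>m\<ge>M. \<forall>n\<ge>M. dd (t m) (t n) < e" by blast
    qed
    have "(\<lambda>m. cnorm CC (cls t \<ominus>\<^bsub>CC\<^esub> cls (\<lambda>_. t m))) \<longlonglongrightarrow> 0"
    proof (rule LIMSEQ_I)
      fix e :: real assume e: "e > 0"
      obtain M where "\<forall>m\<ge>M. cnorm CC (cls t \<ominus>\<^bsub>CC\<^esub> cls (\<lambda>_. t m)) \<le> e / 2"
        using CC_approx[OF tCS, of "e / 2"] e by auto
      then show "\<exists>M. \<forall>m\<ge>M. norm (cnorm CC (cls t \<ominus>\<^bsub>CC\<^esub> cls (\<lambda>_. t m)) - 0) < e"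
        using e tc tCS by (auto intro!: exI[of _ M] simp: abs_of_nonneg intro: le_less_trans)
    qed
    from tendsto_add_zero[OF null this]
    have "(\<lambda>m. cnorm CC (U m \<ominus>\<^bsub>CC\<^esub> cls t)) \<longlonglongrightarrow> 0"
    proof (rule null_by_bound[rotated 2])
      fix m
      show "cnorm CC (U m \<ominus>\<^bsub>CC\<^esub> cls t) \<le> inverse (real (Suc m)) + cnorm CC (cls t \<ominus>\<^bsub>CC\<^esub> cls (\<lambda>_. t m))"
        using C.nrm_diff_triangle[OF U[of m] tc[of m] cls_in_CC[OF tCS]] tU[of m]
          C.nrm_diff_commute[OF tc[of m] cls_in_CC[OF tCS]] by linarith
    qed (use U tCS in simp)
    then show "\<exists>l\<in>carrier CC. (\<lambda>m. cnorm CC (U m \<ominus>\<^bsub>CC\<^esub> l)) \<longlonglongrightarrow> 0"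
      using tCS by (auto intro: bexI[of _ "cls t"])
  qed
qed

definition gen :: "'x \<Rightarrow> (nat \<Rightarrow> 'x star_term) set" where "gen x = cls (\<lambda>_. TGen x)"

lemma gen_in: "x \<in> X \<Longrightarrow> gen x \<in> carrier CC"
  by (simp add: gen_def const_CS)

lemma eval_gen: "t \<in> TT \<Longrightarrow> eval CC gen t = cls (\<lambda>_. t)"
  by (induction t) (simp_all add: CC_ops gen_def const_CS)

lemma eval_gen_nrm: "t \<in> TT \<Longrightarrow> cnorm CC (eval CC gen t) = N t"
  by (simp add: eval_gen CC_nrm const_CS)

lemma eval_gen_eqI:
  assumes "s \<in> TT" "t \<in> TT" "\<And>A h. (A, h) \<in> F \<Longrightarrow> eval A h s = eval A h t"
  shows "eval CC gen s = eval CC gen t"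
proof -
  have "cls (\<lambda>_. s) = cls (\<lambda>_. t)" by (rule cls_eqI) (use assms in \<open>auto simp: const_CS\<close>)
  then show ?thesis using assms by (simp add: eval_gen)
qed

lemma CC_dense:
  assumes "U \<in> carrier CC" "e > 0"
  shows "\<exists>t. t \<in> TT \<and> cnorm CC (U \<ominus>\<^bsub>CC\<^esub> eval CC gen t) < e"
proof -
  obtain x where x: "x \<in> CS" "U = cls x" using assms by (auto simp: in_CC)
  have "e / 2 > 0" using assms by simp
  from CC_approx[OF x(1) this] obtain m where "cnorm CC (cls x \<ominus>\<^bsub>CC\<^esub> cls (\<lambda>_. x m)) \<le> e / 2" by auto
  then show ?thesis using x assms CS_TT[OF x(1), of m] by (intro exI[of _ "x m"]) (simp add: eval_gen)
qed

end

lemma (in sup_seminorm) extension: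
  fixes B :: "'b star_algebra"
  assumes B: "cstar_algebra B" and h: "\<And>x. x \<in> X \<Longrightarrow> h x \<in> carrier B"
    and le: "\<And>t. t \<in> TT \<Longrightarrow> cnorm B (eval B h t) \<le> N t"
  shows "\<exists>\<phi>. star_hom CC B \<phi> \<and> (\<forall>x\<in>X. \<phi> (gen x) = h x)
           \<and> (\<forall>U\<in>carrier CC. cnorm B (\<phi> U) \<le> cnorm CC U)"
proof -
  interpret B: cstar_algebra B by (rule B)
  let ?e = "eval B h"
  have ec [simp]: "?e t \<in> carrier B" if "t \<in> TT" for t
    using B.eval_closed[of X h t] h that by (auto simp: TT_def)
  have dle: "cnorm B (?e s \<ominus>\<^bsub>B\<^esub> ?e t) \<le> dd s t" if "s \<in> TT" "t \<in> TT" for s t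
    using le[of "TAdd s (TScale (-1) t)"] that by (simp add: tdist_def B.diff_smult)
  define conv where "conv x l \<longleftrightarrow> l \<in> carrier B \<and> (\<lambda>n. cnorm B (?e (x n) \<ominus>\<^bsub>B\<^esub> l)) \<longlonglongrightarrow> 0" for x l
  have conv_ex: "\<exists>l. conv x l" if x: "x \<in> CS" for x
  proof -
    have "\<exists>l\<in>carrier B. (\<lambda>n. cnorm B (?e (x n) \<ominus>\<^bsub>B\<^esub> l)) \<longlonglongrightarrow> 0"
    proof (rule B.complete)
      fix e :: real assume "e > 0"
      from CS_D[OF x this] show "\<exists>M. \<forall>m\<ge>M. \<forall>n\<ge>M. cnorm B (?e (x m) \<ominus>\<^bsub>B\<^esub> ?e (x n)) < e"
        using dle CS_TT[OF x] by (meson le_less_trans)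
    qed (simp add: CS_TT[OF x])
    then show ?thesis by (auto simp: conv_def)
  qed
  have conv_unique: "l = m" if x: "x \<in> CS" "y \<in> CS" "(x, y) \<in> RR" and c: "conv x l" "conv y m" for x y l m
  proof -
    have lm: "l \<in> carrier B" "m \<in> carrier B" using c by (auto simp: conv_def)
    have "(\<lambda>n. cnorm B (?e (x n) \<ominus>\<^bsub>B\<^esub> l) + (dd (x n) (y n) + cnorm B (?e (y n) \<ominus>\<^bsub>B\<^esub> m))) \<longlonglongrightarrow> 0"
      using x c by (intro tendsto_add_zero) (auto simp: conv_def RR_iff)
    moreover have "cnorm B (l \<ominus>\<^bsub>B\<^esub> m) \<le> cnorm B (?e (x n) \<ominus>\<^bsub>B\<^esub> l) + (dd (x n) (y n) + cnorm B (?e (y n) \<ominus>\<^bsub>B\<^esub> m))" for n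
    proof -
      note xy = ec[OF CS_TT[OF x(1), of n]] ec[OF CS_TT[OF x(2), of n]]
      show ?thesis
        using B.nrm_diff_triangle[OF lm(1) xy(1) lm(2)] B.nrm_diff_triangle[OF xy(1) xy(2) lm(2)]
          B.nrm_diff_commute[OF lm(1) xy(1)] dle[OF CS_TT[OF x(1)] CS_TT[OF x(2)], of n n] by linarith
    qed
    ultimately have "cnorm B (l \<ominus>\<^bsub>B\<^esub> m) \<le> 0" by (intro LIMSEQ_le_const) auto
    then show ?thesis using B.nrm_diff_eq_0[OF lm] B.nrm_nonneg[of "l \<ominus>\<^bsub>B\<^esub> m"] lm by (metis B.M.minus_closed antisym)
  qed
  define \<phi> where "\<phi> U = (SOME l. \<exists>x\<in>CS. U = cls x \<and> conv x l)" for U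
  have phi_eq: "\<phi> (cls x) = l" if x: "x \<in> CS" "conv x l" for x l
  proof -
    have "\<exists>l. \<exists>y\<in>CS. cls x = cls y \<and> conv y l" using x by blast
    from someI_ex[OF this] obtain y where y: "y \<in> CS" "cls x = cls y" "conv y (\<phi> (cls x))"
      unfolding \<phi>_def by blast
    then have "(y, x) \<in> RR" using x by (metis eq_equiv_class_iff equivRR)
    then show ?thesis using conv_unique[OF y(1) x(1)] y x by blast
  qed
  have conv_phi: "conv x (\<phi> (cls x))" if "x \<in> CS" for x
    using conv_ex[OF that] phi_eq[OF that] by auto
  have phi_in: "\<phi> (cls x) \<in> carrier B" if "x \<in> CS" for x
    using conv_phi[OF that] by (simp add: conv_def)
  have phi_lim: "(\<lambda>n. cnorm B (?e (x n) \<ominus>\<^bsub>B\<^esub> \<phi> (cls x))) \<longlonglongrightarrow> 0" if "x \<in> CS" for x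
    using conv_phi[OF that] by (simp add: conv_def)
  have phi_le: "cnorm B (\<phi> (cls x)) \<le> cnorm CC (cls x)" if x: "x \<in> CS" for x
  proof -
    have "(\<lambda>n. N (x n) + cnorm B (?e (x n) \<ominus>\<^bsub>B\<^esub> \<phi> (cls x))) \<longlonglongrightarrow> cnorm CC (cls x) + 0"
      by (intro tendsto_add CC_nrm_tendsto phi_lim x)
    moreover have "cnorm B (\<phi> (cls x)) \<le> N (x n) + cnorm B (?e (x n) \<ominus>\<^bsub>B\<^esub> \<phi> (cls x))" for n
      using B.nrm_le_diff[OF phi_in[OF x] ec[OF CS_TT[OF x]], of n] le[OF CS_TT[OF x], of n]
        B.nrm_diff_commute[OF phi_in[OF x] ec[OF CS_TT[OF x]], of n] by linarith
    ultimately show ?thesis by (intro LIMSEQ_le_const[of _ "cnorm CC (cls x)"]) auto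
  qed
  have lim0: "(\<lambda>n. f n) \<longlonglongrightarrow> 0" if "\<And>n. 0 \<le> f n" "\<And>n. f n \<le> g n" "g \<longlonglongrightarrow> 0" for f g :: "nat \<Rightarrow> real"
    using null_by_bound[OF that] .
  have "star_hom CC B \<phi>"
    unfolding star_hom_def
  proof (intro conjI ballI allI)
    fix U assume "U \<in> carrier CC"
    then obtain x where x: "x \<in> CS" "U = cls x" by (auto simp: in_CC)
    note cx = ec[OF CS_TT[OF x(1)]] phi_in[OF x(1)] phi_lim[OF x(1)]
    show "\<phi> U \<in> carrier B" using x phi_in by simp
    show "\<phi> (c \<odot>\<^bsub>CC\<^esub> U) = c \<odot>\<^bsub>B\<^esub> \<phi> U" for c
    proof -
      have "conv (\<lambda>n. TScale c (x n)) (c \<odot>\<^bsub>B\<^esub> \<phi> (cls x))"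
        using cx tendsto_mult_right_zero[OF cx(3), of "cmod c"] by (simp add: conv_def B.nrm_diff_smult)
      then show ?thesis using x by (simp add: CC_scale phi_eq)
    qed
    show "\<phi> (adj CC U) = adj B (\<phi> U)"
    proof -
      have "conv (\<lambda>n. TStar (x n)) (adj B (\<phi> (cls x)))"
        using cx by (simp add: conv_def B.nrm_diff_star)
      then show ?thesis using x by (simp add: CC_star phi_eq)
    qed
    fix V assume "V \<in> carrier CC"
    then obtain y where y: "y \<in> CS" "V = cls y" by (auto simp: in_CC)
    note cy = ec[OF CS_TT[OF y(1)]] phi_in[OF y(1)] phi_lim[OF y(1)]
    show "\<phi> (U \<oplus>\<^bsub>CC\<^esub> V) = \<phi> U \<oplus>\<^bsub>B\<^esub> \<phi> V"
    proof -
      have "(\<lambda>n. cnorm B (?e (TAdd (x n) (y n)) \<ominus>\<^bsub>B\<^esub> (\<phi> (cls x) \<oplus>\<^bsub>B\<^esub> \<phi> (cls y)))) \<longlonglongrightarrow> 0"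
        by (rule lim0[OF _ _ tendsto_add_zero[OF cx(3) cy(3)]]) (use cx cy in \<open>auto intro!: B.nrm_diff_add\<close>)
      then have "conv (\<lambda>n. TAdd (x n) (y n)) (\<phi> (cls x) \<oplus>\<^bsub>B\<^esub> \<phi> (cls y))"
        using cx cy by (simp add: conv_def)
      then show ?thesis using x y by (simp add: CC_add phi_eq)
    qed
    show "\<phi> (U \<otimes>\<^bsub>CC\<^esub> V) = \<phi> U \<otimes>\<^bsub>B\<^esub> \<phi> V"
    proof -
      obtain C where C: "\<And>n. N (x n) \<le> C" by (rule CS_bdd[OF x(1)]) blast
      have eC: "cnorm B (?e (x n)) \<le> C" for n using le[OF CS_TT[OF x(1)], of n] C[of n] by linarith
      have l: "(\<lambda>n. C * cnorm B (?e (y n) \<ominus>\<^bsub>B\<^esub> \<phi> (cls y)) + cnorm B (?e (x n) \<ominus>\<^bsub>B\<^esub> \<phi> (cls x)) * cnorm B (\<phi> (cls y))) \<longlonglongrightarrow> 0"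
        by (intro tendsto_add_zero tendsto_mult_right_zero tendsto_mult_left_zero cx(3) cy(3))
      have "(\<lambda>n. cnorm B (?e (TMult (x n) (y n)) \<ominus>\<^bsub>B\<^esub> (\<phi> (cls x) \<otimes>\<^bsub>B\<^esub> \<phi> (cls y)))) \<longlonglongrightarrow> 0"
      proof (rule lim0[OF _ _ l])
        fix n
        have "cnorm B (?e (x n)) * cnorm B (?e (y n) \<ominus>\<^bsub>B\<^esub> \<phi> (cls y)) \<le> C * cnorm B (?e (y n) \<ominus>\<^bsub>B\<^esub> \<phi> (cls y))"
          by (rule mult_right_mono[OF eC]) (use cy in simp)
        then show "cnorm B (?e (TMult (x n) (y n)) \<ominus>\<^bsub>B\<^esub> (\<phi> (cls x) \<otimes>\<^bsub>B\<^esub> \<phi> (cls y)))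
          \<le> C * cnorm B (?e (y n) \<ominus>\<^bsub>B\<^esub> \<phi> (cls y)) + cnorm B (?e (x n) \<ominus>\<^bsub>B\<^esub> \<phi> (cls x)) * cnorm B (\<phi> (cls y))"
          using B.nrm_diff_mult[OF cx(1) cy(1) cx(2) cy(2), of n n] by simp
      qed (use cx cy in simp)
      then have "conv (\<lambda>n. TMult (x n) (y n)) (\<phi> (cls x) \<otimes>\<^bsub>B\<^esub> \<phi> (cls y))"
        using cx cy by (simp add: conv_def)
      then show ?thesis using x y by (simp add: CC_mult phi_eq)
    qed
  qed
  moreover have "\<phi> (gen x) = h x" if "x \<in> X" for x
    unfolding gen_def by (rule phi_eq) (use that h in \<open>auto simp: const_CS conv_def B.nrm_diff_eq_0[THEN iffD2]\<close>)
  moreover have "cnorm B (\<phi> U) \<le> cnorm CC U" if "U \<in> carrier CC" for U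
    using that phi_le by (auto simp: in_CC)
  ultimately show ?thesis by blast
qed

primrec tsum :: "('f \<Rightarrow> 'x star_term) \<Rightarrow> 'f list \<Rightarrow> 'x star_term" where
  "tsum w [] = TZero"
| "tsum w (f # fs) = TAdd (w f) (tsum w fs)"

lemma set_tsum: "set_star_term (tsum w fs) = (\<Union>f\<in>set fs. set_star_term (w f))"
  by (induction fs) auto

lemma (in pre_cstar_algebra) eval_tsum:
  assumes "distinct fs" "\<And>f. f \<in> set fs \<Longrightarrow> eval A h (w f) \<in> carrier A"
  shows "eval A h (tsum w fs) = finsum A (\<lambda>f. eval A h (w f)) (set fs)"
  using assms by (induction fs) (auto simp: M.finsum_insert)

lemma completion_CK_family:
  fixes \<Lambda> :: "('m, 'k::finite) graded_category" and F :: "('a star_algebra \<times> ('m + 'm \<Rightarrow> 'a)) set"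
  assumes sup: "sup_seminorm F (vertices \<Lambda> <+> edges \<Lambda>) N"
    and fam: "\<And>A h. (A, h) \<in> F \<Longrightarrow> CK_family \<Lambda> A (h \<circ> Inl) (h \<circ> Inr)"
    and src: "\<And>f. f \<in> edges \<Lambda> \<Longrightarrow> src \<Lambda> f \<in> vertices \<Lambda>" and rf: "row_finite \<Lambda>"
  shows "CK_family \<Lambda> (completion (vertices \<Lambda> <+> edges \<Lambda>) N)
    (sup_seminorm.gen (vertices \<Lambda> <+> edges \<Lambda>) N \<circ> Inl) (sup_seminorm.gen (vertices \<Lambda> <+> edges \<Lambda>) N \<circ> Inr)"
proof -
  interpret sup_seminorm F "vertices \<Lambda> <+> edges \<Lambda>" N by (rule sup)
  interpret C: pre_cstar_algebra CC by (rule CC_pre_cstar)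
  let ?p = "\<lambda>v. TGen (Inl v) :: ('m + 'm) star_term" and ?t = "\<lambda>f. TGen (Inr f) :: ('m + 'm) star_term"
  have p: "?p v \<in> TT" if "v \<in> vertices \<Lambda>" for v using that by (simp add: InlI InrI)
  have t: "?t f \<in> TT" if "f \<in> edges \<Lambda>" for f using that by (simp add: InlI InrI)
  note fam' = fam[unfolded CK_family_def is_projection_def is_partial_isometry_def comp_def]
  show ?thesis
    unfolding CK_family_def is_projection_def is_partial_isometry_def comp_def
  proof (intro conjI ballI allI impI)
    fix v assume v: "v \<in> vertices \<Lambda>"
    show "gen (Inl v) \<in> carrier CC" using v by (intro gen_in InlI)
    show "gen (Inl v) \<otimes>\<^bsub>CC\<^esub> gen (Inl v) = gen (Inl v)"
      using eval_gen_eqI[of "TMult (?p v) (?p v)" "?p v"] p[OF v] fam' v by simp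
    show "adj CC (gen (Inl v)) = gen (Inl v)"
      using eval_gen_eqI[of "TStar (?p v)" "?p v"] p[OF v] fam' v by simp
    show "gen (Inl v) \<otimes>\<^bsub>CC\<^esub> gen (Inl w) = \<zero>\<^bsub>CC\<^esub>" if "w \<in> vertices \<Lambda>" "v \<noteq> w" for w
      using eval_gen_eqI[of "TMult (?p v) (?p w)" "TZero"] p[OF v] p[of w] fam' v that by simp
  next
    fix f assume f: "f \<in> edges \<Lambda>"
    show "gen (Inr f) \<in> carrier CC" using f by (intro gen_in InrI)
    show "gen (Inr f) \<otimes>\<^bsub>CC\<^esub> adj CC (gen (Inr f)) \<otimes>\<^bsub>CC\<^esub> gen (Inr f) = gen (Inr f)"
      using eval_gen_eqI[of "TMult (TMult (?t f) (TStar (?t f))) (?t f)" "?t f"] t[OF f] fam' f by simp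
    show "adj CC (gen (Inr f)) \<otimes>\<^bsub>CC\<^esub> gen (Inr f) = gen (Inl (src \<Lambda> f))"
      using eval_gen_eqI[of "TMult (TStar (?t f)) (?t f)" "?p (src \<Lambda> f)"] t[OF f] p[OF src[OF f]] fam' f by simp
  next
    fix a b f g assume *: "a \<in> edges \<Lambda>" "b \<in> edges \<Lambda>" "f \<in> edges \<Lambda>" "g \<in> edges \<Lambda>"
      "path_equiv \<Lambda> (two_path \<Lambda> a f) (two_path \<Lambda> g b)"
    have "eval A h (TMult (?t a) (?t f)) = eval A h (TMult (?t g) (?t b))" if "(A, h) \<in> F" for A h
      using fam'[OF that] * by simp
    from eval_gen_eqI[OF _ _ this]
    show "gen (Inr a) \<otimes>\<^bsub>CC\<^esub> gen (Inr f) = gen (Inr g) \<otimes>\<^bsub>CC\<^esub> gen (Inr b)"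
      using t * by simp
  next
    fix v i assume v: "v \<in> vertices \<Lambda>"
    let ?S = "{f \<in> edges \<Lambda>. rng \<Lambda> f = v \<and> deg \<Lambda> f = axis i 1}"
    let ?w = "\<lambda>f. TMult (?t f) (TStar (?t f))"
    have "finite ?S"
      using rf v by (auto simp: row_finite_def edges_def elim!: ballE[of _ _ v] intro: finite_subset[rotated])
    then obtain fs where fs: "distinct fs" "set fs = ?S"
      using finite_distinct_list by blast
    have wT: "?w f \<in> TT" if "f \<in> ?S" for f using that by auto
    have "eval A h (?p v) = eval A h (tsum ?w fs)" if F: "(A, h) \<in> F" for A h
    proof -
      interpret A: pre_cstar_algebra A by (rule F_pre[OF F])
      have "eval A h (tsum ?w fs) = finsum A (\<lambda>f. eval A h (?w f)) ?S"
        using A.eval_tsum[of fs h ?w] fs eval_in[OF F wT] by metis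
      then show ?thesis using fam'[OF F] v by simp
    qed
    then have "eval CC gen (?p v) = eval CC gen (tsum ?w fs)"
      by (intro eval_gen_eqI) (use p[OF v] wT fs in \<open>auto simp: TT_def set_tsum\<close>)
    also have "\<dots> = finsum CC (\<lambda>f. eval CC gen (?w f)) ?S"
      using C.eval_tsum[of fs gen ?w] fs wT by (metis (no_types, lifting) eval_gen cls_in_CC const_CS)
    finally show "gen (Inl v) = finsum CC (\<lambda>f. gen (Inr f) \<otimes>\<^bsub>CC\<^esub> adj CC (gen (Inr f))) ?S" by simp
  qed
qed

subsection \<open>Universality\<close>

definition trivial_algebra :: "'a star_algebra" where
  "trivial_algebra = \<lparr>carrier = {undefined}, mult = (\<lambda>_ _. undefined), one = undefined, zero = undefined,
     add = (\<lambda>_ _. undefined), smult = (\<lambda>_ _. undefined), adj = (\<lambda>_. undefined), cnorm = (\<lambda>_. 0)\<rparr>"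

lemma trivial_cstar: "cstar_algebra (trivial_algebra :: 'a star_algebra)"
proof -
  have g: "abelian_group (trivial_algebra :: 'a star_algebra)"
    by (rule abelian_groupI) (auto simp: trivial_algebra_def)
  have c: "cring complex_ring"
    by (rule cringI) (auto intro!: abelian_groupI comm_monoidI exI[of _ "- x" for x] simp: algebra_simps)
  have m: "Module.module complex_ring (trivial_algebra :: 'a star_algebra)"
    by (rule moduleI[OF c g]) (auto simp: trivial_algebra_def)
  have p: "pre_cstar_algebra (trivial_algebra :: 'a star_algebra)"
    by (rule pre_cstar_algebra.intro[OF m], unfold_locales) (auto simp: trivial_algebra_def)
  show ?thesis
    by (rule cstar_algebra.intro[OF p], unfold_locales) (auto simp: trivial_algebra_def)
qed

lemma trivial_CK_family:
  fixes \<Lambda> :: "('m, 'k::finite) graded_category"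
  shows "CK_family \<Lambda> (trivial_algebra :: 'a star_algebra) (\<lambda>_. undefined) (\<lambda>_. undefined)"
proof -
  interpret cstar_algebra "trivial_algebra :: 'a star_algebra" by (rule trivial_cstar)
  have "finsum (trivial_algebra :: 'a star_algebra) (\<lambda>_. undefined) S = undefined" for S :: "'m set"
    using M.finsum_closed[of "\<lambda>_. undefined" S] by (simp add: trivial_algebra_def)
  then show ?thesis
    by (auto simp: CK_family_def is_projection_def is_partial_isometry_def) (auto simp: trivial_algebra_def)
qed

lemma CK_family_sup_seminorm:
  assumes "F \<noteq> {}" and F: "\<And>A h. (A, h) \<in> F \<Longrightarrow> pre_cstar_algebra A \<and> CK_family \<Lambda> A (h \<circ> Inl) (h \<circ> Inr)"
    and "\<And>t. N t = Sup {cnorm A (eval A h t) | A h. (A, h) \<in> F}"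
  shows "sup_seminorm F (vertices \<Lambda> <+> edges \<Lambda>) N"
proof (rule sup_seminorm.intro)
  fix A h assume AF: "(A, h) \<in> F"
  interpret pre_cstar_algebra A using F[OF AF] by blast
  show gen: "h x \<in> carrier A" if "x \<in> vertices \<Lambda> <+> edges \<Lambda>" for x
    using F[OF AF] that by (auto simp: CK_family_def is_projection_def is_partial_isometry_def)
  show "cnorm A (eval A h t) \<le> term_bound t" if "set_star_term t \<subseteq> vertices \<Lambda> <+> edges \<Lambda>" for t
  proof (rule eval_bounded[OF gen _ that])
    fix x assume "x \<in> vertices \<Lambda> <+> edges \<Lambda>"
    then show "cnorm A (h x) \<le> 1"
      using F[OF AF] projection_nrm_le partial_isometry_nrm_le by (auto simp: CK_family_def)
  qed
qed (use assms in auto)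

definition CK_families :: "('m, 'k::finite) graded_category
    \<Rightarrow> ((nat \<Rightarrow> ('m + 'm) star_term) set star_algebra \<times> ('m + 'm \<Rightarrow> (nat \<Rightarrow> ('m + 'm) star_term) set)) set" where
  "CK_families \<Lambda> = {(A, h). cstar_algebra A \<and> CK_family \<Lambda> A (h \<circ> Inl) (h \<circ> Inr)}"

lemma CK_norm_eq:
  fixes \<Lambda> :: "('m, 'k::finite) graded_category"
  shows "CK_norm \<Lambda> t = Sup {cnorm A (eval A h t) | A h. (A, h) \<in> CK_families \<Lambda>}"
proof -
  have 1: "\<exists>P T. h = case_sum P T" for h :: "'m + 'm \<Rightarrow> (nat \<Rightarrow> ('m + 'm) star_term) set"
    by (intro exI[of _ "h \<circ> Inl"] exI[of _ "h \<circ> Inr"]) (simp add: fun_eq_iff split: sum.split)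
  have 2: "(A, case_sum P T) \<in> CK_families \<Lambda> \<longleftrightarrow> cstar_algebra A \<and> CK_family \<Lambda> A P T" for A P T
    by (simp add: CK_families_def comp_def)
  have "{cnorm A (eval A (case_sum P T) t) | A P T.
      cstar_algebra (A :: (nat \<Rightarrow> ('m + 'm) star_term) set star_algebra) \<and> CK_family \<Lambda> A P T}
    = {cnorm A (eval A h t) | A h. (A, h) \<in> CK_families \<Lambda>}" (is "?L = ?R")
  proof
    show "?L \<subseteq> ?R" using 2 by blast
    show "?R \<subseteq> ?L"
    proof
      fix r assume "r \<in> ?R"
      then obtain A h where "r = cnorm A (eval A h t)" "(A, h) \<in> CK_families \<Lambda>" by blast
      moreover obtain P T where "h = case_sum P T" using 1 by blast
      ultimately show "r \<in> ?L" using 2 by blast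
    qed
  qed
  then show ?thesis by (simp add: CK_norm_def)
qed

lemma CK_sup_seminorm: "sup_seminorm (CK_families \<Lambda>) (vertices \<Lambda> <+> edges \<Lambda>) (CK_norm \<Lambda>)"
proof (rule CK_family_sup_seminorm[OF _ _ CK_norm_eq])
  have "(trivial_algebra, \<lambda>_. undefined) \<in> CK_families \<Lambda>"
    using trivial_CK_family[of \<Lambda>] trivial_cstar by (simp add: CK_families_def comp_def)
  then show "CK_families \<Lambda> \<noteq> {}" by blast
qed (auto simp: CK_families_def cstar_algebra_def)

definition CK_gen :: "('m, 'k::finite) graded_category \<Rightarrow> 'm + 'm \<Rightarrow> (nat \<Rightarrow> ('m + 'm) star_term) set" where
  "CK_gen \<Lambda> x = null_equiv (vertices \<Lambda> <+> edges \<Lambda>) (CK_norm \<Lambda>) `` {\<lambda>_. TGen x}"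

abbreviation CK_proj :: "('m, 'k::finite) graded_category \<Rightarrow> 'm \<Rightarrow> (nat \<Rightarrow> ('m + 'm) star_term) set" where
  "CK_proj \<Lambda> v \<equiv> CK_gen \<Lambda> (Inl v)"

abbreviation CK_isom :: "('m, 'k::finite) graded_category \<Rightarrow> 'm \<Rightarrow> (nat \<Rightarrow> ('m + 'm) star_term) set" where
  "CK_isom \<Lambda> f \<equiv> CK_gen \<Lambda> (Inr f)"

theorem CK_algebra_cstar: "cstar_algebra (CK_algebra \<Lambda>)"
  unfolding CK_algebra_def by (rule sup_seminorm.CC_cstar[OF CK_sup_seminorm])

theorem CK_algebra_family:
  assumes "\<And>f. f \<in> edges \<Lambda> \<Longrightarrow> src \<Lambda> f \<in> vertices \<Lambda>" and "row_finite \<Lambda>"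
  shows "CK_family \<Lambda> (CK_algebra \<Lambda>) (CK_proj \<Lambda>) (CK_isom \<Lambda>)"
  using completion_CK_family[OF CK_sup_seminorm _ assms]
  by (simp add: CK_families_def comp_def CK_algebra_def sup_seminorm.gen_def[OF CK_sup_seminorm] CK_gen_def[symmetric])

theorem CK_algebra_dense:
  assumes "U \<in> carrier (CK_algebra \<Lambda>)" "e > 0"
  shows "\<exists>t. set_star_term t \<subseteq> vertices \<Lambda> <+> edges \<Lambda>
    \<and> cnorm (CK_algebra \<Lambda>) (U \<ominus>\<^bsub>CK_algebra \<Lambda>\<^esub> eval (CK_algebra \<Lambda>) (CK_gen \<Lambda>) t) < e"
proof -
  interpret sup_seminorm "CK_families \<Lambda>" "vertices \<Lambda> <+> edges \<Lambda>" "CK_norm \<Lambda>" by (rule CK_sup_seminorm)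
  have "gen = CK_gen \<Lambda>" by (auto simp: gen_def CK_gen_def)
  then show ?thesis using CC_dense[of U e] assms by (simp add: CK_algebra_def TT_def)
qed

theorem CK_algebra_universal:
  fixes B :: "'b star_algebra"
  assumes src: "\<And>f. f \<in> edges \<Lambda> \<Longrightarrow> src \<Lambda> f \<in> vertices \<Lambda>" and rf: "row_finite \<Lambda>"
    and B: "cstar_algebra B" and fam: "CK_family \<Lambda> B Q S"
  shows "\<exists>\<phi>. star_hom (CK_algebra \<Lambda>) B \<phi>
    \<and> (\<forall>v\<in>vertices \<Lambda>. \<phi> (CK_proj \<Lambda> v) = Q v) \<and> (\<forall>f\<in>edges \<Lambda>. \<phi> (CK_isom \<Lambda> f) = S f)
    \<and> (\<forall>U\<in>carrier (CK_algebra \<Lambda>). cnorm B (\<phi> U) \<le> cnorm (CK_algebra \<Lambda>) U)"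
proof -
  let ?X = "vertices \<Lambda> <+> edges \<Lambda>" and ?h = "case_sum Q S"
  interpret sup_seminorm "CK_families \<Lambda>" ?X "CK_norm \<Lambda>" by (rule CK_sup_seminorm)
  interpret B: cstar_algebra B by (rule B)
  define F where "F = {(B, ?h)}"
  define NB where "NB t = Sup {cnorm A (eval A h t) | A h. (A, h) \<in> F}" for t
  have Q: "?h \<circ> Inl = Q" "?h \<circ> Inr = S" by auto
  have famF: "CK_family \<Lambda> A (h \<circ> Inl) (h \<circ> Inr)" if "(A, h) \<in> F" for A h
    using that fam by (simp add: F_def Q)
  have supB: "sup_seminorm F ?X NB"
  proof (rule CK_family_sup_seminorm[OF _ _ NB_def])
    show "pre_cstar_algebra A \<and> CK_family \<Lambda> A (h \<circ> Inl) (h \<circ> Inr)" if "(A, h) \<in> F" for A h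
      using famF[OF that] that B by (simp add: F_def cstar_algebra_def)
  qed (simp add: F_def)
  interpret B': sup_seminorm F ?X NB by (rule supB)
  have "(completion ?X NB, B'.gen) \<in> CK_families \<Lambda>"
    using B'.CC_cstar completion_CK_family[OF supB famF src rf] by (simp add: CK_families_def)
  then have le: "NB t \<le> CK_norm \<Lambda> t" if "t \<in> TT" for t
    using N_ge[of "completion ?X NB" B'.gen t] B'.eval_gen_nrm[of t] that by (simp add: TT_def B'.TT_def)
  have "NB t = cnorm B (eval B ?h t)" for t by (simp add: NB_def F_def)
  with le have le': "cnorm B (eval B ?h t) \<le> CK_norm \<Lambda> t" if "t \<in> TT" for t using that by metis
  have h: "?h x \<in> carrier B" if "x \<in> ?X" for x
    using B'.F_gen[of B ?h x] that by (simp add: F_def)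
  obtain \<phi> where \<phi>: "star_hom CC B \<phi>" "\<forall>x\<in>?X. \<phi> (gen x) = ?h x" "\<forall>U\<in>carrier CC. cnorm B (\<phi> U) \<le> cnorm CC U"
    using extension[OF B h le'] by blast
  have "\<phi> (CK_proj \<Lambda> v) = Q v" if "v \<in> vertices \<Lambda>" for v
    using \<phi>(2) that by (force simp: gen_def CK_gen_def)
  moreover have "\<phi> (CK_isom \<Lambda> f) = S f" if "f \<in> edges \<Lambda>" for f
    using \<phi>(2) that by (force simp: gen_def CK_gen_def)
  ultimately show ?thesis using \<phi>(1,3) by (auto simp: CK_algebra_def)
qed

end

theory Submission
  imports Defs
begin

text \<open>
  A Cuntz-Krieger family \<open>(Q, S)\<close> of the in-split graph \<open>\<Lambda>\<^sub>I\<close> and one \<open>(P, T)\<close> of \<open>\<Lambda>\<close> determine each other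
  inside any C*-algebra. From \<open>(Q, S)\<close> one gets \<open>(P, T)\<close> by adding up copies: \<open>P\<^sub>v = Q\<^bsub>v^1\<^esub> + Q\<^bsub>v^2\<^esub>\<close> and
  \<open>T\<^sub>f = S\<^bsub>f^1\<^esub> + S\<^bsub>f^2\<^esub>\<close> when \<open>s(f) = v\<close>, all other elements being unchanged (\<open>merge_family\<close>). Conversely,
  \<open>Q\<^sub>x\<close> is the sum of \<open>T\<^sub>f T\<^sub>f\<^sup>*\<close> over the edges \<open>f\<close> of one fixed colour whose copies have range \<open>x\<close> in the split
  graph, and the copy of \<open>f\<close> with source \<open>x\<close> is sent to \<open>T\<^sub>f Q\<^sub>x\<close> (\<open>split_family_of_CK\<close>). The universal properties
  turn the two constructions into *-homomorphisms between the algebras; both composites fix the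
  generators, hence are the identity by density (\<open>CK_algebra_endo_id\<close>).

  The pairing condition says that the two paths of a commuting square of \<open>\<Lambda>\<close> lift to paths of the split graph with
  the same range (\<open>rho_square\<close>). Its main consequence is that \<open>Q\<^sub>x\<close> does not depend on the colour. This comes down to
  \<open>T\<^sub>f\<^sup>* T\<^sub>a = 0\<close> whenever \<open>f\<close> and \<open>a\<close>, of any colours, have range \<open>v\<close> and lie in different parts of the
  partition: inserting \<open>P\<^bsub>s(a)\<^esub> = \<Sum> T\<^sub>g T\<^sub>g\<^sup>*\<close> over edges \<open>g\<close> of the colour of \<open>f\<close> and factoring
  \<open>ag = \<mu>\<nu>\<close> with \<open>\<mu>\<close> of that colour, the pairing condition puts \<open>\<mu>\<close> into the part of \<open>a\<close>, so that
  \<open>\<mu> \<noteq> f\<close> and \<open>T\<^sub>f\<^sup>* T\<^sub>\<mu> = 0\<close>.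

  All this relies on edges of one colour with a common range having orthogonal range projections.
  The Cuntz-Krieger relations only say that these projections add up to a projection; that they are then
  orthogonal is a theorem about C*-algebras (\<open>projections_orthogonal\<close>). It is derived here without
  spectral theory, from the fact that the unit of a corner is an extreme point of the unit ball
  (\<open>corner_unit_extreme\<close>).
\<close>

section \<open>Projections whose sum is a projection\<close>

context pre_cstar_algebra
begin

text \<open>Identities between linear combinations of three fixed elements are checked on coefficients.\<close>

lemma lin3_add:
  assumes "x \<in> carrier A" "y \<in> carrier A" "z \<in> carrier A"
  shows "(a \<odot> x \<oplus> b \<odot> y \<oplus> c \<odot> z) \<oplus> (a' \<odot> x \<oplus> b' \<odot> y \<oplus> c' \<odot> z)
    = (a + a') \<odot> x \<oplus> (b + b') \<odot> y \<oplus> (c + c') \<odot> z"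
  using assms by (simp add: smult_add_left M.a_ac)

lemma lin3_smult:
  assumes "x \<in> carrier A" "y \<in> carrier A" "z \<in> carrier A"
  shows "d \<odot> (a \<odot> x \<oplus> b \<odot> y \<oplus> c \<odot> z) = (d * a) \<odot> x \<oplus> (d * b) \<odot> y \<oplus> (d * c) \<odot> z"
  using assms by (simp add: smult_add_right smult_smult)

lemma nrm_smult_real: "y \<in> carrier A \<Longrightarrow> nrm (of_real r \<odot> y) = \<bar>r\<bar> * nrm y"
  by (simp add: nrm_smult)

text \<open>
  If \<open>e + c\<close> and \<open>e - c\<close> are contractions, then, applied to \<open>y\<close>, \<open>e\<close> is their mean and \<open>c\<close> is half their
  difference. Expanding \<open>x y + n c y\<close> accordingly, \<open>n\<close> times, writes it as the expectation of
  \<open>(x + S\<^sub>n) z\<close>, where \<open>S\<^sub>n\<close> is a simple random walk and \<open>z\<close> is a product of \<open>n\<close> of the two contractions applied to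
  \<open>y\<close>; the bound is the quadratic mean of \<open>x + S\<^sub>n\<close>. The induction on \<open>n\<close> is the first step of the walk.
\<close>

lemma contraction_walk:
  assumes e: "e \<in> carrier A" and c: "c \<in> carrier A" "e \<otimes> c = c"
    and le: "nrm (e \<oplus> c) \<le> 1" "nrm (e \<oplus> (-1) \<odot> c) \<le> 1"
    and y: "y \<in> carrier A" "e \<otimes> y = y"
  shows "nrm (of_real x \<odot> y \<oplus> of_nat n \<odot> (c \<otimes> y)) \<le> sqrt (x\<^sup>2 + n) * nrm y"
  using y
proof (induction n arbitrary: x y)
  case 0
  then show ?case using c by (simp add: nrm_smult_real)
next
  case (Suc n)
  note y = Suc.prems
  define u where "u = (e \<oplus> c) \<otimes> y"
  define w where "w = (e \<oplus> (-1) \<odot> c) \<otimes> y"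
  have uw: "u = y \<oplus> c \<otimes> y" "w = y \<oplus> (-1) \<odot> (c \<otimes> y)"
    using y c e by (simp_all add: u_def w_def mult_distrib_right smult_mult_left)
  have cl: "u \<in> carrier A" "w \<in> carrier A" "e \<otimes> u = u" "e \<otimes> w = w"
    using y c e by (simp_all add: uw mult_distrib_left smult_mult_right mult_assoc[symmetric])
  have nu: "nrm u \<le> nrm y" "nrm w \<le> nrm y"
    unfolding u_def w_def using nrm_mult[of "e \<oplus> c" y] nrm_mult[of "e \<oplus> (-1) \<odot> c" y] y c e le
      mult_right_mono[OF le(1) nrm_nonneg[OF y(1)]] mult_right_mono[OF le(2) nrm_nonneg[OF y(1)]] by auto
  let ?L = "\<lambda>a b d. a \<odot> y \<oplus> b \<odot> (c \<otimes> y) \<oplus> d \<odot> (c \<otimes> (c \<otimes> y))"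
  have atoms: "y \<in> carrier A" "c \<otimes> y \<in> carrier A" "c \<otimes> (c \<otimes> y) \<in> carrier A" using y c by auto
  let ?U = "of_real (x + 1) \<odot> u \<oplus> of_nat n \<odot> (c \<otimes> u)"
  let ?W = "of_real (x - 1) \<odot> w \<oplus> of_nat n \<odot> (c \<otimes> w)"
  have L: "u = ?L 1 1 0" "w = ?L 1 (-1) 0" "c \<otimes> u = ?L 0 1 1" "c \<otimes> w = ?L 0 1 (-1)"
    using atoms y c by (simp_all add: uw mult_distrib_left smult_mult_right)
  have "of_real x \<odot> y \<oplus> of_nat (Suc n) \<odot> (c \<otimes> y) = ?L (of_real x) (of_nat (Suc n)) 0"
    using atoms by simp
  also have "\<dots> = (1/2) \<odot> ?U \<oplus> (1/2) \<odot> ?W"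
    unfolding L(3,4) unfolding L(1,2) lin3_smult[OF atoms] lin3_add[OF atoms]
    by (simp add: field_simps) (simp add: add_divide_distrib)
  finally have eq: "of_real x \<odot> y \<oplus> of_nat (Suc n) \<odot> (c \<otimes> y) = (1/2) \<odot> ?U \<oplus> (1/2) \<odot> ?W" .
  have UW: "?U \<in> carrier A" "?W \<in> carrier A" using cl c by auto
  have "nrm (of_real x \<odot> y \<oplus> of_nat (Suc n) \<odot> (c \<otimes> y)) \<le> (1/2) * nrm ?U + (1/2) * nrm ?W"
    unfolding eq using nrm_add[of "(1/2) \<odot> ?U" "(1/2) \<odot> ?W"] UW by (simp add: nrm_smult)
  also have "\<dots> \<le> (1/2) * (sqrt ((x+1)\<^sup>2 + n) * nrm y) + (1/2) * (sqrt ((x-1)\<^sup>2 + n) * nrm y)"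
  proof -
    have "nrm ?U \<le> sqrt ((x+1)\<^sup>2 + n) * nrm u" "nrm ?W \<le> sqrt ((x-1)\<^sup>2 + n) * nrm w"
      using Suc.IH[OF cl(1,3), of "x + 1"] Suc.IH[OF cl(2,4), of "x - 1"] by simp_all
    moreover have "sqrt ((x+1)\<^sup>2 + n) * nrm u \<le> sqrt ((x+1)\<^sup>2 + n) * nrm y"
      "sqrt ((x-1)\<^sup>2 + n) * nrm w \<le> sqrt ((x-1)\<^sup>2 + n) * nrm y"
      using nu by (auto intro: mult_left_mono)
    ultimately show ?thesis by linarith
  qed
  also have "\<dots> = ((sqrt ((x+1)\<^sup>2 + n) + sqrt ((x-1)\<^sup>2 + n)) / 2) * nrm y" by (simp add: algebra_simps)
  also have "(sqrt ((x+1)\<^sup>2 + n) + sqrt ((x-1)\<^sup>2 + n)) / 2 \<le> sqrt (x\<^sup>2 + Suc n)"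
  proof (rule real_le_rsqrt)
    let ?a = "sqrt ((x+1)\<^sup>2 + n)" and ?b = "sqrt ((x-1)\<^sup>2 + n)"
    have "?a\<^sup>2 = (x+1)\<^sup>2 + n" "?b\<^sup>2 = (x-1)\<^sup>2 + n" by (auto intro: real_sqrt_pow2)
    then have "?a\<^sup>2 + ?b\<^sup>2 = 2 * (x\<^sup>2 + Suc n)"
      by (simp only:) (simp add: power2_eq_square algebra_simps)
    moreover have "((?a + ?b) / 2)\<^sup>2 \<le> (?a\<^sup>2 + ?b\<^sup>2) / 2"
      using sum_squares_ge_zero[of "?a - ?b" 0] by (simp add: power2_eq_square field_simps)
    ultimately show "((?a + ?b) / 2)\<^sup>2 \<le> x\<^sup>2 + Suc n" by simp
  qed
  finally show ?case using y by (simp add: mult_right_mono)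
qed

text \<open>
  Taking \<open>x = 0\<close> and \<open>y = e\<close> in \<open>contraction_walk\<close> gives \<open>n \<parallel>c\<parallel> \<le> sqrt n \<parallel>e\<parallel>\<close> for all \<open>n\<close>.
\<close>

lemma corner_unit_extreme:
  assumes e: "e \<in> carrier A" "e \<otimes> e = e" and c: "c \<in> carrier A" "e \<otimes> c = c" "c \<otimes> e = c"
    and le: "nrm (e \<oplus> c) \<le> 1" "nrm (e \<oplus> (-1) \<odot> c) \<le> 1"
  shows "c = \<zero>"
proof (rule ccontr)
  assume "c \<noteq> \<zero>"
  then have pos: "nrm c > 0" using c nrm_nonneg[OF c(1)] nrm_eq_0[OF c(1)] by linarith
  have b: "real n * nrm c \<le> sqrt n * nrm e" for n
    using contraction_walk[OF e(1) c(1,2) le e, of 0 n] c e by (simp add: nrm_smult)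
  obtain n where n: "real n > (nrm e / nrm c)\<^sup>2" using reals_Archimedean2 by blast
  then have n0: "n > 0" using zero_le_power2[of "nrm e / nrm c"] by (cases n) auto
  have "sqrt n * nrm c \<le> nrm e"
    using b[of n] n0 mult_le_cancel_left_pos[of "sqrt n" "sqrt n * nrm c" "nrm e"]
    by (simp add: mult.assoc[symmetric])
  then have "sqrt n \<le> nrm e / nrm c" using pos by (simp add: field_simps)
  then have "n \<le> (nrm e / nrm c)\<^sup>2" using power_mono[of "sqrt n" _ 2] by simp
  then show False using n by simp
qed

text \<open>Multiplication by the symmetry \<open>1 - 2p\<close> is isometric, also in the absence of a unit.\<close>

lemma reflection_nrm:
  assumes p: "is_projection A p" and y: "y \<in> carrier A"
  shows "nrm (y \<oplus> (-2) \<odot> (p \<otimes> y)) = nrm y"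
proof -
  have p': "p \<in> carrier A" "p \<otimes> p = p" "star p = p" using p by (auto simp: is_projection_def)
  let ?z = "y \<oplus> (-2) \<odot> (p \<otimes> y)"
  let ?a = "star y \<otimes> y" and ?b = "star y \<otimes> (p \<otimes> y)"
  have pp: "p \<otimes> (p \<otimes> y) = p \<otimes> y" using p' y mult_assoc[of p p y] by simp
  have cl: "?a \<in> carrier A" "?b \<in> carrier A" "\<zero> \<in> carrier A" using p' y by auto
  have "star ?z \<otimes> ?z = (1 \<odot> ?a \<oplus> (-2) \<odot> ?b \<oplus> 0 \<odot> \<zero>) \<oplus> (0 \<odot> ?a \<oplus> (-2 + 4) \<odot> ?b \<oplus> 0 \<odot> \<zero>)"
    using p' y cl pp
    by (simp add: star_add star_smult star_mult mult_distrib_left mult_distrib_right smult_mult_left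
        smult_mult_right smult_smult smult_add_right mult_assoc smult_add_left[of _ "-2" 4, simplified] M.a_ac)
  also have "\<dots> = ?a" unfolding lin3_add[OF cl] using cl by simp
  finally have "(nrm ?z)\<^sup>2 = (nrm y)\<^sup>2" using nrm_star_mult[of ?z] nrm_star_mult[of y] p' y by simp
  then show ?thesis using p' y by (simp add: power2_eq_iff_nonneg)
qed

lemma sum_projections_nrm:
  assumes "finite J" "\<And>j. j \<in> J \<Longrightarrow> is_projection A (p j)" and y: "y \<in> carrier A"
  shows "nrm (of_nat (card J) \<odot> y \<oplus> (-2) \<odot> (finsum A p J \<otimes> y)) \<le> card J * nrm y"
  using assms(1,2)
proof (induction J)
  case empty
  then show ?case using y by simp
next
  case (insert j J)
  let ?R = "finsum A p J"
  have pc: "p i \<in> carrier A" if "i \<in> insert j J" for i using insert.prems that by (auto simp: is_projection_def)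
  then have R: "?R \<in> carrier A" by (intro M.finsum_closed) auto
  have s: "finsum A p (insert j J) = p j \<oplus> ?R" using insert pc by (intro M.finsum_insert) auto
  have cl: "y \<in> carrier A" "p j \<otimes> y \<in> carrier A" "?R \<otimes> y \<in> carrier A" using y R pc by auto
  have "of_nat (card (insert j J)) \<odot> y \<oplus> (-2) \<odot> (finsum A p (insert j J) \<otimes> y)
     = (of_nat (Suc (card J)) \<odot> y \<oplus> (-2) \<odot> (p j \<otimes> y) \<oplus> (-2) \<odot> (?R \<otimes> y))"
    using s insert.hyps cl R pc by (simp add: mult_distrib_right smult_add_right M.a_assoc)
  also have "\<dots> = (1 \<odot> y \<oplus> (-2) \<odot> (p j \<otimes> y) \<oplus> 0 \<odot> (?R \<otimes> y))
      \<oplus> (of_nat (card J) \<odot> y \<oplus> 0 \<odot> (p j \<otimes> y) \<oplus> (-2) \<odot> (?R \<otimes> y))"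
    unfolding lin3_add[OF cl] by simp
  also have "\<dots> = (y \<oplus> (-2) \<odot> (p j \<otimes> y)) \<oplus> (of_nat (card J) \<odot> y \<oplus> (-2) \<odot> (?R \<otimes> y))"
    using cl by simp
  finally show ?case
    using nrm_add[of "y \<oplus> (-2) \<odot> (p j \<otimes> y)" "of_nat (card J) \<odot> y \<oplus> (-2) \<odot> (?R \<otimes> y)"] insert cl
      reflection_nrm[OF _ y, of "p j"]
    by (auto simp: algebra_simps)
qed

lemma nrm_scaled_le:
  assumes "x \<in> carrier A" "r > 0" "nrm (of_real r \<odot> x) \<le> r"
  shows "nrm x \<le> 1"
  using assms by (simp add: nrm_smult_real)

text \<open>
  Let \<open>e = p\<^sub>j\<close>, \<open>q = p\<^sub>i\<close>, let \<open>R\<close> be the sum of the \<open>m\<close> remaining projections and \<open>P = e + q + R\<close>. Then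
  \<open>(2 + m) e + 2 eqe = 2 ePe + e(m - 2R)e\<close> and \<open>(2 + m) e - 2 eqe = (1 + m) e + e(1 - 2q)e\<close> both have norm
  at most \<open>2 + m\<close>, so \<open>corner_unit_extreme\<close> gives \<open>eqe = 0\<close>. Of \<open>P\<close> only \<open>\<parallel>P\<parallel> \<le> 1\<close> is needed.
\<close>

theorem projections_orthogonal:
  assumes J: "finite J" and pr: "\<And>j. j \<in> J \<Longrightarrow> is_projection A (p j)"
    and sum: "is_projection A (finsum A p J)" and ij: "i \<in> J" "j \<in> J" "i \<noteq> j"
  shows "p i \<otimes> p j = \<zero>"
proof -
  define e where "e = p j"
  define q where "q = p i"
  define K where "K = J - {i, j}"
  define R where "R = finsum A p K"
  define m where "m = card K"
  have e: "e \<in> carrier A" "e \<otimes> e = e" "star e = e" using pr[OF ij(2)] by (auto simp: e_def is_projection_def)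
  have q: "q \<in> carrier A" "q \<otimes> q = q" "star q = q" using pr[OF ij(1)] by (auto simp: q_def is_projection_def)
  have pc: "p k \<in> carrier A" if "k \<in> J" for k using pr that by (auto simp: is_projection_def)
  have R: "R \<in> carrier A" unfolding R_def using pc by (intro M.finsum_closed) (auto simp: K_def)
  have P: "finsum A p J = e \<oplus> (q \<oplus> R)"
  proof -
    have JK: "J = insert j (insert i K)" using ij by (auto simp: K_def)
    have "finsum A p (insert i K) = q \<oplus> R" unfolding q_def R_def
      by (rule M.finsum_insert) (use J pc ij in \<open>auto simp: K_def\<close>)
    moreover have "finsum A p (insert j (insert i K)) = e \<oplus> finsum A p (insert i K)" unfolding e_def
      by (rule M.finsum_insert) (use J pc ij in \<open>auto simp: K_def\<close>)
    ultimately show ?thesis using JK by simp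
  qed
  let ?P = "e \<oplus> (q \<oplus> R)" let ?b = "e \<otimes> (q \<otimes> e)" let ?r = "e \<otimes> (R \<otimes> e)"
  have cl: "e \<in> carrier A" "?b \<in> carrier A" "?r \<in> carrier A" using e q R by auto
  have nle: "nrm (e \<otimes> z) \<le> nrm z" if "z \<in> carrier A" for z
    using nrm_mult[of e z] projection_nrm_le[OF pr[OF ij(2)]] that e
      mult_right_mono[of "nrm e" 1 "nrm z"] by (auto simp: e_def)
  have ne: "nrm e \<le> 1" using projection_nrm_le[OF pr[OF ij(2)]] by (simp add: e_def)
  have nP: "nrm (?P \<otimes> e) \<le> 1"
    using nrm_mult[of ?P e] projection_nrm_le[OF sum] ne mult_le_one[of "nrm ?P" "nrm e"] e q R unfolding P by auto
  have ee: "e \<otimes> (e \<otimes> z) = e \<otimes> z" if "z \<in> carrier A" for z using mult_assoc[of e e z] e that by simp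
  define c where "c = of_real (2 / (2 + m)) \<odot> ?b"
  have "c = \<zero>"
  proof (rule corner_unit_extreme[OF e(1,2)])
    show "c \<in> carrier A" "e \<otimes> c = c" "c \<otimes> e = c"
      using e q cl ee by (simp_all add: c_def smult_mult_left smult_mult_right mult_assoc)
    have tm: "(2 + complex_of_nat m) * complex_of_real (2 / (2 + real m)) = 2"
    proof -
      have "(2 + complex_of_nat m) * complex_of_real (2 / (2 + real m)) = of_real ((2 + real m) * (2 / (2 + real m)))"
        by simp
      also have "(2 + real m) * (2 / (2 + real m)) = 2" by (simp add: field_simps)
      finally show ?thesis by simp
    qed
    have r: "of_real (real (2 + m)) = (2 + of_nat m :: complex)" by simp
    show "nrm (e \<oplus> c) \<le> 1"
    proof (rule nrm_scaled_le)
      let ?x = "2 \<odot> (e \<otimes> (?P \<otimes> e))" and ?y = "e \<otimes> (of_nat m \<odot> e \<oplus> (-2) \<odot> (R \<otimes> e))"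
      have "of_real (real (2 + m)) \<odot> (e \<oplus> c)
          = (2 + of_nat m) \<odot> (1 \<odot> e \<oplus> of_real (2 / (2 + m)) \<odot> ?b \<oplus> 0 \<odot> ?r)"
        unfolding r using cl by (simp add: c_def)
      also have "\<dots> = (2 + of_nat m) \<odot> e \<oplus> 2 \<odot> ?b \<oplus> 0 \<odot> ?r"
        unfolding lin3_smult[OF cl] using tm by simp
      also have "\<dots> = 2 \<odot> (1 \<odot> e \<oplus> 1 \<odot> ?b \<oplus> 1 \<odot> ?r) \<oplus> (of_nat m \<odot> e \<oplus> 0 \<odot> ?b \<oplus> (-2) \<odot> ?r)"
        unfolding lin3_smult[OF cl] lin3_add[OF cl] by simp
      also have "\<dots> = ?x \<oplus> ?y"
        using cl e q R by (simp add: mult_distrib_left mult_distrib_right smult_mult_right M.a_assoc)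
      finally have eq: "of_real (real (2 + m)) \<odot> (e \<oplus> c) = ?x \<oplus> ?y" .
      have "nrm ?x \<le> 2" using nle[of "?P \<otimes> e"] nP e q R by (simp add: nrm_smult)
      moreover have "nrm (of_nat m \<odot> e \<oplus> (-2) \<odot> (R \<otimes> e)) \<le> real m * nrm e"
        unfolding m_def R_def by (rule sum_projections_nrm) (use J pr e in \<open>auto simp: K_def\<close>)
      then have "nrm ?y \<le> m"
        using nle[of "of_nat m \<odot> e \<oplus> (-2) \<odot> (R \<otimes> e)"] ne mult_left_mono[OF ne, of "real m"] e R by simp
      ultimately show "nrm (of_real (real (2 + m)) \<odot> (e \<oplus> c)) \<le> real (2 + m)"
        unfolding eq using nrm_add[of ?x ?y] cl e q R by auto
    qed (use cl in \<open>auto simp: c_def\<close>)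
    show "nrm (e \<oplus> (-1) \<odot> c) \<le> 1"
    proof (rule nrm_scaled_le)
      let ?x = "(1 + of_nat m) \<odot> e" and ?y = "e \<otimes> (e \<oplus> (-2) \<odot> (q \<otimes> e))"
      have "of_real (real (2 + m)) \<odot> (e \<oplus> (-1) \<odot> c)
          = (2 + of_nat m) \<odot> (1 \<odot> e \<oplus> (- of_real (2 / (2 + m))) \<odot> ?b \<oplus> 0 \<odot> ?r)"
        unfolding r using cl by (simp add: c_def smult_smult)
      also have "\<dots> = (2 + of_nat m) \<odot> e \<oplus> (-2) \<odot> ?b \<oplus> 0 \<odot> ?r"
        unfolding lin3_smult[OF cl] using tm by simp
      also have "\<dots> = ((1 + of_nat m) \<odot> e \<oplus> 0 \<odot> ?b \<oplus> 0 \<odot> ?r) \<oplus> (1 \<odot> e \<oplus> (-2) \<odot> ?b \<oplus> 0 \<odot> ?r)"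
        unfolding lin3_add[OF cl] by simp
      also have "\<dots> = ?x \<oplus> ?y"
        using cl e q R by (simp add: mult_distrib_left smult_mult_right)
      finally have eq: "of_real (real (2 + m)) \<odot> (e \<oplus> (-1) \<odot> c) = ?x \<oplus> ?y" .
      have "nrm ?x = (1 + m) * nrm e"
        using nrm_smult_real[of e "1 + real m"] e by simp
      then have "nrm ?x \<le> 1 + m" using mult_left_mono[OF ne, of "1 + real m"] by simp
      moreover have "nrm ?y \<le> 1"
        using nle[of "e \<oplus> (-2) \<odot> (q \<otimes> e)"] reflection_nrm[OF pr[OF ij(1)] e(1)] ne e q by (auto simp: q_def)
      ultimately show "nrm (of_real (real (2 + m)) \<odot> (e \<oplus> (-1) \<odot> c)) \<le> real (2 + m)"
        unfolding eq using nrm_add[of ?x ?y] cl e q by auto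
    qed (use cl in \<open>auto simp: c_def\<close>)
  qed
  then have "(2 / (2 + m)) * nrm ?b = 0" using nrm_smult_real[of ?b "2 / (2 + m)"] cl by (simp add: c_def)
  then have "nrm ?b = 0" by simp
  moreover have "star (q \<otimes> e) \<otimes> (q \<otimes> e) = ?b"
    using e q mult_assoc[of q q e] by (simp add: star_mult mult_assoc)
  ultimately have "nrm (q \<otimes> e) = 0" using nrm_star_mult[of "q \<otimes> e"] e q by simp
  then show ?thesis using e q by (simp add: nrm_eq_0 q_def e_def)
qed

end

section \<open>Finite sums and partial isometries in C*-algebras\<close>

context pre_cstar_algebra
begin

lemma finsum_mult_left:
  assumes "finite S" "\<And>i. i \<in> S \<Longrightarrow> f i \<in> carrier A" "x \<in> carrier A"
  shows "x \<otimes> finsum A f S = finsum A (\<lambda>i. x \<otimes> f i) S"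
  using assms(1,2)
  by (induction S) (use assms(3) in \<open>auto simp: M.finsum_insert mult_distrib_left Pi_def\<close>)

lemma finsum_mult_right:
  assumes "finite S" "\<And>i. i \<in> S \<Longrightarrow> f i \<in> carrier A" "x \<in> carrier A"
  shows "finsum A f S \<otimes> x = finsum A (\<lambda>i. f i \<otimes> x) S"
  using assms(1,2)
  by (induction S) (use assms(3) in \<open>auto simp: M.finsum_insert mult_distrib_right Pi_def\<close>)

lemma star_finsum:
  assumes "finite S" "\<And>i. i \<in> S \<Longrightarrow> f i \<in> carrier A"
  shows "star (finsum A f S) = finsum A (\<lambda>i. star (f i)) S"
  using assms
  by (induction S) (auto simp: M.finsum_insert star_add Pi_def)

lemma finsum_eq_zero: "(\<And>i. i \<in> S \<Longrightarrow> f i = \<zero>) \<Longrightarrow> finsum A f S = \<zero>"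
  using M.finsum_cong'[of S S "\<lambda>_. \<zero>" f] by simp

lemma finsum_eqI: "(\<And>i. i \<in> S \<Longrightarrow> f i = g i) \<Longrightarrow> (\<And>i. i \<in> S \<Longrightarrow> g i \<in> carrier A)
    \<Longrightarrow> finsum A f S = finsum A g S"
  by (rule M.finsum_cong') auto

lemma finsum_single:
  assumes "finite S" "i \<in> S" "f i \<in> carrier A" "\<And>j. j \<in> S \<Longrightarrow> j \<noteq> i \<Longrightarrow> f j = \<zero>"
  shows "finsum A f S = f i"
proof -
  have "finsum A f S = finsum A f (insert i (S - {i}))" using assms(2) by (simp add: insert_absorb)
  also have "\<dots> = f i \<oplus> finsum A f (S - {i})" using assms by (subst M.finsum_insert) (auto simp: Pi_def)
  also have "finsum A f (S - {i}) = \<zero>" using assms(4) by (intro finsum_eq_zero) auto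
  finally show ?thesis using assms by simp
qed

lemma finsum_mono_neutral:
  assumes "finite T" "S \<subseteq> T" "\<And>i. i \<in> S \<Longrightarrow> f i \<in> carrier A" "\<And>i. i \<in> T - S \<Longrightarrow> f i = \<zero>"
  shows "finsum A f T = finsum A f S"
proof -
  have "finsum A f (S \<union> (T - S)) = finsum A f S \<oplus> finsum A f (T - S)"
    using assms by (intro M.finsum_Un_disjoint) (auto simp: Pi_def intro: finite_subset)
  moreover have "finsum A f (T - S) = \<zero>" using assms(4) by (intro finsum_eq_zero) auto
  moreover have "finsum A f S \<in> carrier A" using assms(3) by (intro M.finsum_closed) auto
  ultimately show ?thesis using assms(2) by (simp add: Un_absorb1)
qed

lemma finsum_fibres:
  assumes "finite S" "finite K" "\<pi> ` S \<subseteq> K" "\<And>i. i \<in> S \<Longrightarrow> f i \<in> carrier A"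
  shows "finsum A f S = finsum A (\<lambda>k. finsum A f {i \<in> S. \<pi> i = k}) K"
proof -
  have "S = (\<Union>k\<in>K. {i \<in> S. \<pi> i = k})" using assms(3) by auto
  moreover have "finsum A f (\<Union>k\<in>K. {i \<in> S. \<pi> i = k}) = finsum A (\<lambda>k. finsum A f {i \<in> S. \<pi> i = k}) K"
    using assms by (intro M.add.finprod_UN_disjoint[of K, folded finsum_def]) (auto simp: pairwise_def disjnt_def)
  ultimately show ?thesis by simp
qed

lemma mult_vanish:
  assumes "x \<in> carrier A" "y \<in> carrier A" "z \<in> carrier A" "x \<otimes> y = \<zero>"
  shows "x \<otimes> (y \<otimes> z) = \<zero>"
  using assms mult_assoc[of x y z] by simp

lemma star_mult_self_eq_0: "x \<in> carrier A \<Longrightarrow> star x \<otimes> x = \<zero> \<Longrightarrow> x = \<zero>"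
  using nrm_star_mult[of x] by (simp add: nrm_eq_0)

lemma partial_isometryI:
  assumes t: "t \<in> carrier A" and p: "is_projection A (star t \<otimes> t)"
  shows "is_partial_isometry A t"
proof -
  let ?q = "star t \<otimes> t"
  have q: "?q \<otimes> ?q = ?q" using p by (simp add: is_projection_def)
  define z where "z = t \<otimes> ?q \<oplus> (-1) \<odot> t"
  have z: "z \<in> carrier A" using t by (simp add: z_def)
  have "star z \<otimes> z = (?q \<otimes> ?q \<otimes> ?q \<oplus> (-1) \<odot> (?q \<otimes> ?q)) \<oplus> ((-1) \<odot> (?q \<otimes> ?q) \<oplus> ?q)"
    using t by (simp add: z_def star_add star_mult star_smult mult_distrib_left mult_distrib_right
        smult_mult_left smult_mult_right smult_smult mult_assoc smult_add_right M.a_ac)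
  also have "\<dots> = \<zero>" using t by (simp add: q minus_smult[symmetric] M.r_neg M.l_neg)
  finally have "z = \<zero>" using star_mult_self_eq_0 z by blast
  then have "t \<otimes> ?q \<ominus> t = \<zero>" using t by (simp add: z_def diff_smult)
  then have "t \<otimes> ?q = t" using nrm_diff_eq_0[of "t \<otimes> ?q" t] t by simp
  then show ?thesis using t by (simp add: is_partial_isometry_def mult_assoc)
qed

lemma range_projection: "is_partial_isometry A t \<Longrightarrow> is_projection A (t \<otimes> star t)"
  by (simp add: is_partial_isometry_def is_projection_def star_mult mult_assoc[symmetric])

end

section \<open>The vertex and range relations of Cuntz-Krieger families\<close>

text \<open>
  The Cuntz-Krieger relations other than the one on commuting squares, for an arbitrary coloured graph with vertices \<open>V\<close>, edges
  \<open>E\<close>, range \<open>r\<close>, source \<open>s\<close> and colours \<open>d\<close>, so that they can be used with any convenient indexing. The \<open>T f\<close>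
  need not be assumed to be partial isometries, since this follows from \<open>T\<^sub>f\<^sup>* T\<^sub>f = P\<^bsub>s(f)\<^esub>\<close>.
\<close>

locale ck_system = pre_cstar_algebra A for A :: "'a star_algebra" (structure) +
  fixes V :: "'v set" and E :: "'e set" and r s :: "'e \<Rightarrow> 'v" and d :: "'e \<Rightarrow> nat ^ 'k::finite"
    and P :: "'v \<Rightarrow> 'a" and T :: "'e \<Rightarrow> 'a"
  assumes rng_in: "f \<in> E \<Longrightarrow> r f \<in> V" and src_in: "f \<in> E \<Longrightarrow> s f \<in> V"
    and colour: "f \<in> E \<Longrightarrow> \<exists>i. d f = axis i 1"
    and fin: "w \<in> V \<Longrightarrow> finite {f \<in> E. r f = w \<and> d f = axis i 1}"
    and proj: "w \<in> V \<Longrightarrow> is_projection A (P w)"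
    and orth: "w \<in> V \<Longrightarrow> x \<in> V \<Longrightarrow> w \<noteq> x \<Longrightarrow> P w \<otimes> P x = \<zero>"
    and T_closed [simp]: "f \<in> E \<Longrightarrow> T f \<in> carrier A"
    and initial: "f \<in> E \<Longrightarrow> star (T f) \<otimes> T f = P (s f)"
    and range_sum: "w \<in> V \<Longrightarrow> P w = finsum A (\<lambda>f. T f \<otimes> star (T f)) {f \<in> E. r f = w \<and> d f = axis i 1}"
begin

lemma P_closed [simp]: "w \<in> V \<Longrightarrow> P w \<in> carrier A"
  and P_idem: "w \<in> V \<Longrightarrow> P w \<otimes> P w = P w"
  and star_P: "w \<in> V \<Longrightarrow> star (P w) = P w"
  using proj by (auto simp: is_projection_def)

lemma T_partial_isometry: "f \<in> E \<Longrightarrow> is_partial_isometry A (T f)"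
  by (rule partial_isometryI) (auto simp: initial proj src_in)

lemma T_star_T: "f \<in> E \<Longrightarrow> T f \<otimes> (star (T f) \<otimes> T f) = T f"
  using T_partial_isometry[of f] by (simp add: is_partial_isometry_def mult_assoc)

lemma star_T_T: "f \<in> E \<Longrightarrow> star (T f) \<otimes> (T f \<otimes> star (T f)) = star (T f)"
  using arg_cong[OF T_star_T[of f], of star] by (simp add: star_mult mult_assoc)

lemma T_P: "f \<in> E \<Longrightarrow> T f \<otimes> P (s f) = T f"
  using T_star_T by (simp add: initial)

lemma P_star_T: "f \<in> E \<Longrightarrow> P (s f) \<otimes> star (T f) = star (T f)"
  using arg_cong[OF T_P[of f], of star] by (simp add: star_mult star_P src_in)

lemma orth_same:
  assumes "f \<in> E" "g \<in> E" "f \<noteq> g" "r f = r g" "d f = d g"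
  shows "star (T f) \<otimes> T g = \<zero>"
proof -
  obtain i where i: "d f = axis i 1" using colour assms by blast
  let ?S = "{h \<in> E. r h = r f \<and> d h = axis i 1}"
  have "(T f \<otimes> star (T f)) \<otimes> (T g \<otimes> star (T g)) = \<zero>"
  proof (rule projections_orthogonal[of ?S])
    show "finite ?S" using fin rng_in assms by blast
    show "is_projection A (T h \<otimes> star (T h))" if "h \<in> ?S" for h
      using range_projection T_partial_isometry that by blast
    show "is_projection A (finsum A (\<lambda>h. T h \<otimes> star (T h)) ?S)"
      unfolding range_sum[OF rng_in[OF assms(1)], symmetric] by (rule proj[OF rng_in[OF assms(1)]])
  qed (use assms i in auto)
  then have "star (T f) \<otimes> ((T f \<otimes> star (T f)) \<otimes> (T g \<otimes> star (T g))) \<otimes> T g = \<zero>"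
    using assms by simp
  moreover have "star (T f) \<otimes> ((T f \<otimes> star (T f)) \<otimes> (T g \<otimes> star (T g))) \<otimes> T g
     = (star (T f) \<otimes> (T f \<otimes> star (T f))) \<otimes> (T g \<otimes> (star (T g) \<otimes> T g))"
    using assms(1,2) by (simp add: mult_assoc)
  ultimately show ?thesis using assms(1,2) by (simp only: T_star_T star_T_T)
qed

lemma P_T: assumes f: "f \<in> E" shows "P (r f) \<otimes> T f = T f"
proof -
  obtain i where i: "d f = axis i 1" using colour f by blast
  let ?S = "{h \<in> E. r h = r f \<and> d h = axis i 1}"
  have "P (r f) \<otimes> T f = finsum A (\<lambda>h. T h \<otimes> star (T h) \<otimes> T f) ?S"
    using f rng_in fin by (subst range_sum[of _ i]) (auto intro!: finsum_mult_right)
  also have "\<dots> = T f \<otimes> star (T f) \<otimes> T f"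
  proof (rule finsum_single)
    show "T h \<otimes> star (T h) \<otimes> T f = \<zero>" if "h \<in> ?S" "h \<noteq> f" for h
      using that f orth_same[of h f] i by (simp add: mult_assoc)
  qed (use f i fin rng_in in auto)
  finally show ?thesis using f T_star_T by (simp add: mult_assoc)
qed

lemma star_T_P: "f \<in> E \<Longrightarrow> star (T f) \<otimes> P (r f) = star (T f)"
  using arg_cong[OF P_T[of f], of star] by (simp add: star_mult star_P rng_in)

lemma orth_range:
  assumes "f \<in> E" "g \<in> E" "r f \<noteq> r g"
  shows "star (T f) \<otimes> T g = \<zero>"
proof -
  have "star (T f) \<otimes> T g = star (T f) \<otimes> P (r f) \<otimes> (P (r g) \<otimes> T g)"
    using assms by (simp add: P_T star_T_P)
  also have "\<dots> = star (T f) \<otimes> (P (r f) \<otimes> (P (r g) \<otimes> T g))" using assms rng_in by (simp add: mult_assoc)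
  also have "P (r f) \<otimes> (P (r g) \<otimes> T g) = \<zero>" using assms rng_in by (intro mult_vanish orth) auto
  finally show ?thesis using assms by simp
qed

lemma T_P_other:
  assumes "f \<in> E" "w \<in> V" "w \<noteq> s f" shows "T f \<otimes> P w = \<zero>"
proof -
  have "T f \<otimes> P w = T f \<otimes> P (s f) \<otimes> P w" using T_P assms by simp
  also have "\<dots> = T f \<otimes> (P (s f) \<otimes> P w)" using assms src_in by (intro mult_assoc) auto
  also have "\<dots> = \<zero>" using orth[of "s f" w] src_in assms by simp
  finally show ?thesis .
qed

end

lemma ck_system_reindex:
  assumes "inj_on \<alpha> V" "inj_on \<beta> E"
    and "\<And>f. f \<in> E \<Longrightarrow> r f \<in> V" "\<And>f. f \<in> E \<Longrightarrow> s f \<in> V"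
    and "\<And>f. f \<in> E \<Longrightarrow> r' (\<beta> f) = \<alpha> (r f)" "\<And>f. f \<in> E \<Longrightarrow> s' (\<beta> f) = \<alpha> (s f)"
    and "\<And>f. f \<in> E \<Longrightarrow> d' (\<beta> f) = d f"
    and "\<And>w. w \<in> V \<Longrightarrow> P' (\<alpha> w) = P w" "\<And>f. f \<in> E \<Longrightarrow> T' (\<beta> f) = T f"
  shows "ck_system A (\<alpha> ` V) (\<beta> ` E) r' s' d' P' T' \<longleftrightarrow> ck_system A V E r s d P T"
proof (cases "pre_cstar_algebra A")
  case False
  then show ?thesis by (simp add: ck_system_def)
next
  case True
  then interpret pre_cstar_algebra A .
  have S: "{f \<in> \<beta> ` E. r' f = \<alpha> w \<and> d' f = axis i 1} = \<beta> ` {f \<in> E. r f = w \<and> d f = axis i 1}"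
    if "w \<in> V" for w i
    using assms that by (auto simp: inj_on_eq_iff[OF assms(1)])
  have F: "finite (\<beta> ` {f \<in> E. r f = w \<and> d f = axis i 1}) \<longleftrightarrow> finite {f \<in> E. r f = w \<and> d f = axis i 1}" for w i
    by (rule finite_image_iff) (rule inj_on_subset[OF assms(2)], auto)
  have C: "(\<forall>f\<in>E. T' (\<beta> f) \<in> carrier A) \<longleftrightarrow> (\<forall>f\<in>E. T f \<in> carrier A)" using assms by simp
  have R: "finsum A (\<lambda>f. T' f \<otimes>\<^bsub>A\<^esub> adj A (T' f)) (\<beta> ` {f \<in> E. r f = w \<and> d f = axis i 1})
     = finsum A (\<lambda>f. T f \<otimes>\<^bsub>A\<^esub> adj A (T f)) {f \<in> E. r f = w \<and> d f = axis i 1}"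
    if c: "\<forall>f\<in>E. T f \<in> carrier A" for w i
  proof -
    have "finsum A (\<lambda>f. T' f \<otimes>\<^bsub>A\<^esub> adj A (T' f)) (\<beta> ` {f \<in> E. r f = w \<and> d f = axis i 1})
      = finsum A (\<lambda>f. T' (\<beta> f) \<otimes>\<^bsub>A\<^esub> adj A (T' (\<beta> f))) {f \<in> E. r f = w \<and> d f = axis i 1}"
      by (rule M.finsum_reindex) (use c assms(9) in \<open>auto intro: inj_on_subset[OF assms(2)]\<close>)
    also have "\<dots> = finsum A (\<lambda>f. T f \<otimes>\<^bsub>A\<^esub> adj A (T f)) {f \<in> E. r f = w \<and> d f = axis i 1}"
      by (rule finsum_eqI) (use c assms(9) in auto)
    finally show ?thesis .
  qed
  show ?thesis
  proof (cases "\<forall>f\<in>E. T f \<in> carrier A")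
    case False
    then show ?thesis using C by (auto simp: ck_system_def ck_system_axioms_def)
  next
    case c: True
    show ?thesis
      unfolding ck_system_def ck_system_axioms_def
      using assms(3-9) c by (simp add: True all_simps imp_conjL Ball_def[symmetric] S F R inj_on_eq_iff[OF assms(1)] del: One_nat_def)
  qed
qed

text \<open>The remaining relation: commuting squares of edges go to commuting squares of partial isometries.\<close>

definition square_relation :: "('m, 'k::finite) graded_category \<Rightarrow> 'a star_algebra \<Rightarrow> ('m \<Rightarrow> 'a) \<Rightarrow> bool" where
  "square_relation \<Lambda> A T \<longleftrightarrow> (\<forall>a\<in>edges \<Lambda>. \<forall>b\<in>edges \<Lambda>. \<forall>f\<in>edges \<Lambda>. \<forall>g\<in>edges \<Lambda>.
        path_equiv \<Lambda> (two_path \<Lambda> a f) (two_path \<Lambda> g b) \<longrightarrow> T a \<otimes>\<^bsub>A\<^esub> T f = T g \<otimes>\<^bsub>A\<^esub> T b)"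

lemma sum_eq_1_axis:
  fixes x :: "nat ^ 'k::finite"
  assumes "(\<Sum>i\<in>UNIV. x $ i) = 1"
  shows "\<exists>i. x = axis i 1"
proof -
  obtain i where i: "x $ i = 1" "\<And>j. j \<noteq> i \<Longrightarrow> x $ j = 0"
    using assms sum_eq_1_iff[of UNIV "\<lambda>i. x $ i"] by auto
  then have "x = axis i 1" by (auto simp: vec_eq_iff axis_def)
  then show ?thesis by blast
qed

lemma CK_family_iff:
  assumes A: "pre_cstar_algebra A" and "row_finite \<Lambda>"
    and cl: "\<And>f. f \<in> edges \<Lambda> \<Longrightarrow> rng \<Lambda> f \<in> vertices \<Lambda>" "\<And>f. f \<in> edges \<Lambda> \<Longrightarrow> src \<Lambda> f \<in> vertices \<Lambda>"
  shows "CK_family \<Lambda> A P T \<longleftrightarrow>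
    ck_system A (vertices \<Lambda>) (edges \<Lambda>) (rng \<Lambda>) (src \<Lambda>) (deg \<Lambda>) P T \<and> square_relation \<Lambda> A T"
proof
  assume L: "CK_family \<Lambda> A P T"
  note L' = L[unfolded CK_family_def]
  have "ck_system A (vertices \<Lambda>) (edges \<Lambda>) (rng \<Lambda>) (src \<Lambda>) (deg \<Lambda>) P T"
  proof (rule ck_system.intro[OF A], rule ck_system_axioms.intro)
    show "finite {f \<in> edges \<Lambda>. rng \<Lambda> f = w \<and> deg \<Lambda> f = axis i 1}" if "w \<in> vertices \<Lambda>" for w i
      by (rule finite_subset[of _ "{l \<in> Mor \<Lambda>. deg \<Lambda> l = axis i 1 \<and> rng \<Lambda> l = w}"])
        (use that assms(2) in \<open>auto simp: row_finite_def edges_def\<close>)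
    show "\<exists>i. deg \<Lambda> f = axis i 1" if "f \<in> edges \<Lambda>" for f
      using that by (intro sum_eq_1_axis) (simp add: edges_def)
    show "T f \<in> carrier A" if "f \<in> edges \<Lambda>" for f
      using L' that by (auto simp: is_partial_isometry_def)
  qed (use L' cl in \<open>simp_all\<close>)
  then show "ck_system A (vertices \<Lambda>) (edges \<Lambda>) (rng \<Lambda>) (src \<Lambda>) (deg \<Lambda>) P T \<and> square_relation \<Lambda> A T"
    using L' by (simp add: square_relation_def)
next
  assume R: "ck_system A (vertices \<Lambda>) (edges \<Lambda>) (rng \<Lambda>) (src \<Lambda>) (deg \<Lambda>) P T \<and> square_relation \<Lambda> A T"
  then interpret ck_system A "vertices \<Lambda>" "edges \<Lambda>" "rng \<Lambda>" "src \<Lambda>" "deg \<Lambda>" P T by blast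
  show "CK_family \<Lambda> A P T"
    unfolding CK_family_def
  proof (intro conjI)
    show "\<forall>w\<in>vertices \<Lambda>. \<forall>i. P w = finsum A (\<lambda>f. T f \<otimes>\<^bsub>A\<^esub> adj A (T f))
        {f \<in> edges \<Lambda>. rng \<Lambda> f = w \<and> deg \<Lambda> f = axis i 1}"
      by (intro ballI allI range_sum)
  qed (use R proj T_partial_isometry orth initial in \<open>auto simp: square_relation_def\<close>)
qed

section \<open>Paths in the split graph\<close>

text \<open>The vertices of the split graph lying over a vertex \<open>w\<close>.\<close>

definition copies :: "'m \<Rightarrow> 'm \<Rightarrow> 'm split set" where
  "copies v w = (if w = v then {First v, Second v} else {Orig w})"

text \<open>
  The copy of the edge \<open>f\<close> whose source is \<open>x\<close>, for \<open>x\<close> a copy of the source of \<open>f\<close>.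
\<close>

primrec copy :: "'m \<Rightarrow> 'm split \<Rightarrow> 'm split" where
  "copy f (Orig x) = Orig f"
| "copy f (First x) = First f"
| "copy f (Second x) = Second f"

lemma unsplit_copy [simp]: "unsplit (copy f x) = f"
  by (cases x) auto

lemma copies_unsplit: "x \<in> copies v w \<Longrightarrow> unsplit x = w"
  by (auto simp: copies_def split: if_splits)

lemma finite_copies [simp]: "finite (copies v w)"
  by (simp add: copies_def)

lemma axis_sum: "(\<Sum>i\<in>UNIV. (axis j 1 :: nat ^ 'k::finite) $ i) = 1"
  by (simp add: axis_def if_distrib cong: if_cong)

context kgraph
begin

lemma foldl_cmp:
  assumes "l \<in> Mor \<Lambda>" "is_path (skeleton \<Lambda>) (src \<Lambda> l, fs)"
  shows "foldl (cmp \<Lambda>) l fs \<in> Mor \<Lambda> \<and> deg \<Lambda> (foldl (cmp \<Lambda>) l fs) = deg \<Lambda> l + sum_list (map (deg \<Lambda>) fs)"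
  using assms
proof (induction fs arbitrary: l)
  case (Cons f fs)
  then have f: "f \<in> Mor \<Lambda>" "rng \<Lambda> f = src \<Lambda> l" "is_path (skeleton \<Lambda>) (src \<Lambda> f, fs)"
    by (auto simp: skeleton_def edges_def)
  have "cmp \<Lambda> l f \<in> Mor \<Lambda>" "src \<Lambda> (cmp \<Lambda> l f) = src \<Lambda> f" "deg \<Lambda> (cmp \<Lambda> l f) = deg \<Lambda> l + deg \<Lambda> f"
    using cmp_closed src_cmp deg_cmp f Cons.prems by auto
  then show ?case using Cons.IH[of "cmp \<Lambda> l f"] f by (auto simp: add.assoc)
qed auto

text \<open>
  A morphism of degree \<open>0\<close> is an identity, as \<open>r(w) w\<close> and \<open>w s(w)\<close> are two factorizations of it for \<open>0 = 0 + 0\<close>.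
\<close>

lemma vertex_ident: assumes "w \<in> vertices \<Lambda>" shows "rng \<Lambda> w = w" "src \<Lambda> w = w"
proof -
  have w: "w \<in> Mor \<Lambda>" "deg \<Lambda> w = 0 + 0" using assms by (auto simp: vertices_def)
  from factorization[OF w]
  have u: "(\<mu>, \<nu>) = (\<mu>', \<nu>')" if "\<mu> \<in> Mor \<Lambda> \<and> \<nu> \<in> Mor \<Lambda> \<and> src \<Lambda> \<mu> = rng \<Lambda> \<nu>
      \<and> deg \<Lambda> \<mu> = 0 \<and> deg \<Lambda> \<nu> = 0 \<and> w = cmp \<Lambda> \<mu> \<nu>"
    "\<mu>' \<in> Mor \<Lambda> \<and> \<nu>' \<in> Mor \<Lambda> \<and> src \<Lambda> \<mu>' = rng \<Lambda> \<nu>'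
      \<and> deg \<Lambda> \<mu>' = 0 \<and> deg \<Lambda> \<nu>' = 0 \<and> w = cmp \<Lambda> \<mu>' \<nu>'" for \<mu> \<nu> \<mu>' \<nu>'
    using that by (elim ex1E) blast
  have "(rng \<Lambda> w, w) = (w, src \<Lambda> w)"
    by (rule u) (use w rng_closed src_closed rng_ident src_ident deg_ident cmp_rng_left cmp_src_right in auto)
  then show "rng \<Lambda> w = w" "src \<Lambda> w = w" by auto
qed

lemma edge_ends: assumes "f \<in> edges \<Lambda>" shows "rng \<Lambda> f \<in> vertices \<Lambda>" "src \<Lambda> f \<in> vertices \<Lambda>"
  using assms rng_closed src_closed deg_ident by (auto simp: edges_def vertices_def)

lemma path_morphism_deg:
  assumes "is_path (skeleton \<Lambda>) p"
  shows "deg \<Lambda> (path_morphism \<Lambda> p) = sum_list (map (deg \<Lambda>) (snd p))"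
proof -
  obtain w fs where p: "p = (w, fs)" by (cases p)
  have "w \<in> vertices \<Lambda>" using assms p by (cases fs) (auto simp: skeleton_def)
  then show ?thesis
    using foldl_cmp[of w fs] assms p vertex_ident[of w] by (auto simp: path_morphism_def vertices_def)
qed

lemma path_morphism_edge: "f \<in> edges \<Lambda> \<Longrightarrow> path_morphism \<Lambda> (rng \<Lambda> f, [f]) = f"
  by (simp add: path_morphism_def cmp_rng_left edges_def)

lemma path_morphism_two: "a \<in> edges \<Lambda> \<Longrightarrow> path_morphism \<Lambda> (two_path \<Lambda> a f) = cmp \<Lambda> a f"
  by (simp add: path_morphism_def two_path_def cmp_rng_left edges_def)

lemma is_path_two:
  assumes "a \<in> edges \<Lambda>" "f \<in> edges \<Lambda>"
  shows "is_path (skeleton \<Lambda>) (two_path \<Lambda> a f) \<longleftrightarrow> src \<Lambda> a = rng \<Lambda> f"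
  using assms edge_ends by (auto simp: two_path_def skeleton_def)

lemma path_equiv_two:
  assumes "a \<in> edges \<Lambda>" "f \<in> edges \<Lambda>" "g \<in> edges \<Lambda>" "b \<in> edges \<Lambda>"
  shows "path_equiv \<Lambda> (two_path \<Lambda> a f) (two_path \<Lambda> g b)
    \<longleftrightarrow> src \<Lambda> a = rng \<Lambda> f \<and> src \<Lambda> g = rng \<Lambda> b \<and> cmp \<Lambda> a f = cmp \<Lambda> g b"
  using assms by (auto simp: path_equiv_def is_path_two path_morphism_two)

lemma square_ends:
  assumes "a \<in> edges \<Lambda>" "f \<in> edges \<Lambda>" "g \<in> edges \<Lambda>" "b \<in> edges \<Lambda>"
    "src \<Lambda> a = rng \<Lambda> f" "src \<Lambda> g = rng \<Lambda> b" "cmp \<Lambda> a f = cmp \<Lambda> g b"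
  shows "rng \<Lambda> a = rng \<Lambda> g" "src \<Lambda> f = src \<Lambda> b"
  using rng_cmp[of a f] rng_cmp[of g b] src_cmp[of a f] src_cmp[of g b] assms by (auto simp: edges_def)

end

locale in_splitting = kgraph \<Lambda> for \<Lambda> :: "('m, 'k::finite) graded_category" +
  fixes v :: 'm and E1 E2 :: "'m set"
  assumes rf: "row_finite \<Lambda>"
    and v: "v \<in> vertices \<Lambda>"
    and partition: "edge_partition_at \<Lambda> v E1 E2"
    and pairing: "pairing_condition \<Lambda> v E1 E2"
begin

abbreviation "G \<equiv> split_graph \<Lambda> v E1"
abbreviation "R \<equiv> split_equiv \<Lambda> v E1"
abbreviation "\<Gamma> \<equiv> in_split \<Lambda> v E1"

text \<open>
  An edge of the split graph is determined by the edge \<open>f\<close> of \<open>\<Lambda>\<close> below it and its source, so the edges are encoded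
  as the pairs in \<open>EE\<close>. All copies of \<open>f\<close> have the same range, \<open>\<rho> f\<close>. The vertices are \<open>X\<close>.
\<close>

definition X :: "'m split set" where "X = (\<Union>w\<in>vertices \<Lambda>. copies v w)"

definition EE :: "('m \<times> 'm split) set" where "EE = (SIGMA f:edges \<Lambda>. copies v (src \<Lambda> f))"

definition \<rho> :: "'m \<Rightarrow> 'm split" where "\<rho> f = split_rng \<Lambda> v E1 (Orig f)"

lemma rho_copies: "\<rho> f \<in> copies v (rng \<Lambda> f)"
  by (auto simp: \<rho>_def split_rng_def copies_def)

lemma rho_X: "f \<in> edges \<Lambda> \<Longrightarrow> \<rho> f \<in> X"
  using rho_copies edge_ends by (auto simp: X_def)

lemma unsplit_rho [simp]: "unsplit (\<rho> f) = rng \<Lambda> f"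
  using rho_copies copies_unsplit by metis

lemma X_iff: "x \<in> X \<longleftrightarrow> unsplit x \<in> vertices \<Lambda> \<and> x \<in> copies v (unsplit x)"
  by (auto simp: X_def dest: copies_unsplit)

lemma copies_iff: "w \<in> vertices \<Lambda> \<Longrightarrow> x \<in> copies v w \<longleftrightarrow> x \<in> X \<and> unsplit x = w"
  by (auto simp: X_def dest: copies_unsplit)

text \<open>
  In a commuting square with range \<open>v\<close>, the pairing condition puts both edges with range \<open>v\<close> into the same part;
  for any other range, \<open>\<rho>\<close> depends on the range only.
\<close>

lemma rho_square:
  assumes "a \<in> edges \<Lambda>" "f \<in> edges \<Lambda>" "g \<in> edges \<Lambda>" "b \<in> edges \<Lambda>"
    "src \<Lambda> a = rng \<Lambda> f" "src \<Lambda> g = rng \<Lambda> b" "cmp \<Lambda> a f = cmp \<Lambda> g b"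
  shows "\<rho> a = \<rho> g"
proof -
  have r: "rng \<Lambda> a = rng \<Lambda> g" using square_ends[OF assms] by simp
  show ?thesis
  proof (cases "rng \<Lambda> a = v")
    case True
    have "path_equiv \<Lambda> (two_path \<Lambda> a f) (two_path \<Lambda> g b)" using assms path_equiv_two by blast
    then have "(a \<in> E1 \<and> g \<in> E1) \<or> (a \<in> E2 \<and> g \<in> E2)"
      using pairing True r assms(1-4) unfolding pairing_condition_def by metis
    then have "a \<in> E1 \<longleftrightarrow> g \<in> E1" using partition by (auto simp: edge_partition_at_def)
    then show ?thesis using r by (simp add: \<rho>_def split_rng_def)
  qed (use r in \<open>simp add: \<rho>_def split_rng_def\<close>)
qed

lemma gverts_G: "gverts G = X"
  using v by (auto simp: split_graph_def X_def copies_def)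

lemma gedges_G: "gedges G = (\<lambda>(f, x). copy f x) ` EE"
  by (force simp: split_graph_def EE_def copies_def image_iff split: if_splits)

lemma EE_D: "(f, x) \<in> EE \<Longrightarrow> f \<in> edges \<Lambda> \<and> x \<in> X \<and> unsplit x = src \<Lambda> f"
  using edge_ends by (auto simp: EE_def X_def dest: copies_unsplit)

lemma EE_iff: "(f, x) \<in> EE \<longleftrightarrow> f \<in> edges \<Lambda> \<and> x \<in> X \<and> unsplit x = src \<Lambda> f"
  using copies_iff edge_ends by (auto simp: EE_def)

lemma G_copy [simp]:
  "grng G (copy f x) = \<rho> f" "gcol G (copy f x) = deg \<Lambda> f"
  by (simp_all add: split_graph_def \<rho>_def split_rng_def)

lemma gsrc_copy [simp]: "(f, x) \<in> EE \<Longrightarrow> gsrc G (copy f x) = x"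
  by (cases x) (auto simp: split_graph_def EE_def copies_def split: if_splits)

lemma is_path_G_Cons: "is_path G (w, e # es) \<longleftrightarrow>
    (\<exists>f x. e = copy f x \<and> (f, x) \<in> EE \<and> w = \<rho> f \<and> is_path G (x, es))"
  using rho_X by (auto simp: gverts_G gedges_G dest: EE_D) (auto dest: EE_D)

lemma is_path_par: assumes "is_path G p" shows "is_path (skeleton \<Lambda>) (par p)"
proof -
  have "is_path (skeleton \<Lambda>) (unsplit w, map unsplit es)" if "is_path G (w, es)" for w es
    using that
  proof (induction es arbitrary: w)
    case Nil
    then show ?case by (simp add: gverts_G skeleton_def X_iff)
  next
    case (Cons e es)
    then obtain f x where e: "e = copy f x" "(f, x) \<in> EE" "w = \<rho> f" "is_path G (x, es)"
      unfolding is_path_G_Cons by blast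
    then show ?case using Cons.IH[OF e(4)] EE_D[OF e(2)] edge_ends by (auto simp: skeleton_def)
  qed
  then show ?thesis using assms by (cases p) (auto simp: par_def)
qed

lemma R_iff: "(p, q) \<in> R \<longleftrightarrow> is_path G p \<and> is_path G q
    \<and> path_morphism \<Lambda> (par p) = path_morphism \<Lambda> (par q) \<and> path_rng p = path_rng q
    \<and> path_src G p = path_src G q"
  using is_path_par[of p] is_path_par[of q] by (auto simp: split_equiv_def path_equiv_def)

lemma equiv_R: "equiv {p. is_path G p} R"
  by (rule equivI) (auto simp: refl_on_def R_iff intro: symI transI)

lemma path_deg_G: "is_path G p \<Longrightarrow> path_deg G p = deg \<Lambda> (path_morphism \<Lambda> (par p))"
proof -
  assume p: "is_path G p"
  have "gcol G = deg \<Lambda> \<circ> unsplit" by (auto simp: split_graph_def)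
  then show ?thesis using path_morphism_deg[OF is_path_par[OF p]] by (simp add: path_deg_def par_def)
qed

lemma path_length: "is_path G p \<Longrightarrow> (\<Sum>i\<in>UNIV. path_deg G p $ i) = length (snd p)"
proof -
  have "(\<Sum>i\<in>UNIV. path_deg G (w, es) $ i) = length es" if "is_path G (w, es)" for w es
    using that
  proof (induction es arbitrary: w)
    case (Cons e es)
    then obtain f x where e: "e = copy f x" "(f, x) \<in> EE" "is_path G (x, es)"
      unfolding is_path_G_Cons by blast
    then show ?case using Cons.IH[OF e(3)] EE_D[OF e(2)]
      by (simp add: path_deg_def sum.distrib edges_def)
  qed (simp add: path_deg_def)
  then show "is_path G p \<Longrightarrow> (\<Sum>i\<in>UNIV. path_deg G p $ i) = length (snd p)" by (cases p) auto
qed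

section \<open>Vertices, edges and commuting squares of the in-split graph\<close>

text \<open>
  Paths of length at most \<open>1\<close> are equivalent only to themselves, so the vertices and edges of the in-split graph are
  the singletons \<open>vcl x\<close> and \<open>ecl (f, x)\<close>.
\<close>

definition vcl :: "'m split \<Rightarrow> ('m split, 'm split) path set" where "vcl x = {(x, [])}"

definition ecl :: "'m \<times> 'm split \<Rightarrow> ('m split, 'm split) path set" where
  "ecl e = {(\<rho> (fst e), [copy (fst e) (snd e)])}"

lemma path_vertex: "x \<in> X \<Longrightarrow> is_path G (x, [])"
  by (simp add: gverts_G)

lemma path_edge: "(f, x) \<in> EE \<Longrightarrow> is_path G (\<rho> f, [copy f x])"
  using EE_D by (auto simp: is_path_G_Cons gverts_G simp del: is_path.simps(2))

lemma R_length: assumes "(p, q) \<in> R" shows "length (snd p) = length (snd q)"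
proof -
  have "path_deg G p = path_deg G q" using assms by (auto simp: R_iff path_deg_G)
  then show ?thesis using path_length[of p] path_length[of q] assms by (auto simp: R_iff)
qed

lemma R_vertex: assumes "x \<in> X" shows "R `` {(x, [])} = vcl x"
proof -
  have "q = (x, [])" if "((x, []), q) \<in> R" for q
    using R_length[OF that] that by (cases q) (auto simp: R_iff path_rng_def)
  moreover have "((x, []), (x, [])) \<in> R" using path_vertex[OF assms] by (auto simp: R_iff)
  ultimately show ?thesis by (auto simp: vcl_def)
qed

lemma R_edge: assumes fx: "(f, x) \<in> EE" shows "R `` {(\<rho> f, [copy f x])} = ecl (f, x)"
proof -
  have "q = (\<rho> f, [copy f x])" if R: "((\<rho> f, [copy f x]), q) \<in> R" for q
  proof -
    obtain w e where q: "q = (w, [e])"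
      using R_length[OF R] by (cases q) (auto simp: Suc_length_conv)
    then obtain g y where g: "e = copy g y" "(g, y) \<in> EE" "w = \<rho> g"
      using R by (auto simp: R_iff is_path_G_Cons simp del: is_path.simps(2))
    have "f = g" using R EE_D[OF fx] EE_D[OF g(2)]
      by (simp add: R_iff par_def q g path_morphism_edge)
    moreover have "x = y" using R fx g by (simp add: R_iff path_src_def q)
    ultimately show ?thesis using q g by simp
  qed
  moreover have "((\<rho> f, [copy f x]), (\<rho> f, [copy f x])) \<in> R" using path_edge[OF fx] by (auto simp: R_iff)
  ultimately show ?thesis by (auto simp: ecl_def)
qed

lemma in_split_sel: "Mor \<Gamma> = {p. is_path G p} // R" "rng \<Gamma> = (\<lambda>U. \<Union>p\<in>U. R `` {(path_rng p, [])})"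
  "src \<Gamma> = (\<lambda>U. \<Union>p\<in>U. R `` {(path_src G p, [])})"
  "cmp \<Gamma> = (\<lambda>U V. \<Union>p\<in>U. \<Union>q\<in>V. R `` {path_append p q})"
  "deg \<Gamma> = (\<lambda>U. the_elem (path_deg G ` U))"
  by (simp_all add: in_split_def Let_def)

lemma deg_class: assumes "is_path G p" shows "deg \<Gamma> (R `` {p}) = path_deg G p"
proof -
  have "path_deg G ` (R `` {p}) = {path_deg G p}"
    using assms by (auto simp: R_iff path_deg_G image_iff)
  then show ?thesis by (simp add: in_split_sel)
qed

lemma vertices_in_split: "vertices \<Gamma> = vcl ` X"
proof (intro equalityI subsetI)
  fix U assume "U \<in> vertices \<Gamma>"
  then obtain p where p: "is_path G p" "U = R `` {p}" "path_deg G p = 0"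
    using deg_class by (auto simp: vertices_def in_split_sel(1) quotient_def)
  then have "snd p = []" using path_length[OF p(1)] by simp
  then obtain x where "p = (x, [])" by (cases p) auto
  then show "U \<in> vcl ` X" using p R_vertex by (auto simp: gverts_G)
next
  fix U assume "U \<in> vcl ` X"
  then obtain x where x: "x \<in> X" "U = R `` {(x, [])}" using R_vertex by auto
  then show "U \<in> vertices \<Gamma>"
    using deg_class[OF path_vertex[OF x(1)]] path_vertex[OF x(1)]
    by (auto simp: vertices_def in_split_sel(1) path_deg_def intro: quotientI)
qed

lemma edges_in_split: "edges \<Gamma> = ecl ` EE"
proof (intro equalityI subsetI)
  fix U assume "U \<in> edges \<Gamma>"
  then obtain p where p: "is_path G p" "U = R `` {p}" "(\<Sum>i\<in>UNIV. path_deg G p $ i) = 1"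
    using deg_class by (auto simp: edges_def in_split_sel(1) quotient_def)
  then have "length (snd p) = 1" using path_length[OF p(1)] by simp
  then obtain w e where q: "p = (w, [e])" by (cases p) (auto simp: length_Suc_conv)
  then obtain f x where "e = copy f x" "(f, x) \<in> EE" "w = \<rho> f"
    using p(1) by (auto simp: is_path_G_Cons simp del: is_path.simps(2))
  then show "U \<in> ecl ` EE" using p(2) q R_edge by auto
next
  fix U assume "U \<in> ecl ` EE"
  then obtain f x where x: "(f, x) \<in> EE" "U = R `` {(\<rho> f, [copy f x])}" using R_edge by auto
  then show "U \<in> edges \<Gamma>"
    using deg_class[OF path_edge[OF x(1)]] path_edge[OF x(1)] path_length[OF path_edge[OF x(1)]]
    by (auto simp: edges_def in_split_sel(1) intro: quotientI)
qed

lemma deg_ecl: "e \<in> EE \<Longrightarrow> deg \<Gamma> (ecl e) = deg \<Lambda> (fst e)"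
  using deg_class[OF path_edge, of "fst e" "snd e"] R_edge[of "fst e" "snd e"] by (simp add: path_deg_def)

lemma rng_ecl: "e \<in> EE \<Longrightarrow> rng \<Gamma> (ecl e) = vcl (\<rho> (fst e))"
  using R_vertex[OF rho_X, of "fst e"] by (auto simp: in_split_sel ecl_def path_rng_def EE_def)

lemma src_ecl: "e \<in> EE \<Longrightarrow> src \<Gamma> (ecl e) = vcl (snd e)"
  using R_vertex[of "snd e"] EE_D[of "fst e" "snd e"] by (cases e) (auto simp: in_split_sel ecl_def path_src_def)

lemma vcl_eq [simp]: "vcl x = vcl y \<longleftrightarrow> x = y"
  by (simp add: vcl_def)

lemma inj_vcl: "inj_on vcl Y"
  by (auto simp: inj_on_def vcl_def)

lemma inj_ecl: "inj_on ecl EE"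
proof (rule inj_onI)
  fix e e' assume *: "e \<in> EE" "e' \<in> EE" "ecl e = ecl e'"
  obtain f x g y where e: "e = (f, x)" "e' = (g, y)" by (cases e, cases e')
  have c: "copy f x = copy g y" using * e by (simp add: ecl_def)
  have "f = g" using arg_cong[OF c, of unsplit] by simp
  moreover have "x = y" using arg_cong[OF c, of "gsrc G"] * e by simp
  ultimately show "e = e'" using e by simp
qed

lemma row_finite_in_split: "row_finite \<Gamma>"
  unfolding row_finite_def
proof (intro ballI allI)
  fix U i assume "U \<in> vertices \<Gamma>"
  then obtain x where x: "x \<in> X" "U = vcl x" by (auto simp: vertices_in_split)
  let ?F = "{f \<in> Mor \<Lambda>. deg \<Lambda> f = axis i 1 \<and> rng \<Lambda> f = unsplit x}"
  have "{l \<in> Mor \<Gamma>. deg \<Gamma> l = axis i 1 \<and> rng \<Gamma> l = U} \<subseteq> ecl ` (SIGMA f:?F. copies v (src \<Lambda> f))"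
  proof
    fix l assume l: "l \<in> {l \<in> Mor \<Gamma>. deg \<Gamma> l = axis i 1 \<and> rng \<Gamma> l = U}"
    then have "l \<in> edges \<Gamma>" using axis_sum[of i] by (simp add: edges_def)
    then obtain e where e: "e \<in> EE" "l = ecl e" by (auto simp: edges_in_split)
    then have "\<rho> (fst e) = x" using l x by (simp add: rng_ecl vcl_def)
    then have "rng \<Lambda> (fst e) = unsplit x" by auto
    then show "l \<in> ecl ` (SIGMA f:?F. copies v (src \<Lambda> f))"
      using e l by (auto simp: EE_def edges_def deg_ecl)
  qed
  moreover have "finite ?F" using rf x by (simp add: row_finite_def X_iff)
  ultimately show "finite {l \<in> Mor \<Gamma>. deg \<Gamma> l = axis i 1 \<and> rng \<Gamma> l = U}"
    by (auto elim!: finite_subset)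
qed

lemma edge_ends_in_split:
  assumes "f \<in> edges \<Gamma>" shows "rng \<Gamma> f \<in> vertices \<Gamma>" "src \<Gamma> f \<in> vertices \<Gamma>"
  using assms rho_X EE_D by (auto simp: edges_in_split vertices_in_split rng_ecl src_ecl EE_def)

lemma path_equiv_in_split:
  assumes a: "(a, y) \<in> EE" "(f, x) \<in> EE" and g: "(g, y') \<in> EE" "(b, x') \<in> EE"
  shows "path_equiv \<Gamma> (two_path \<Gamma> (ecl (a, y)) (ecl (f, x))) (two_path \<Gamma> (ecl (g, y')) (ecl (b, x')))
    \<longleftrightarrow> y = \<rho> f \<and> y' = \<rho> b \<and> x = x' \<and> cmp \<Lambda> a f = cmp \<Lambda> g b"
proof -
  have P: "is_path (skeleton \<Gamma>) (two_path \<Gamma> (ecl (a, y)) (ecl (f, x))) \<longleftrightarrow> y = \<rho> f"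
    if "(a, y) \<in> EE" "(f, x) \<in> EE" for a y f x
    using that rho_X EE_D[OF that(1)] EE_D[OF that(2)]
    by (auto simp: two_path_def skeleton_def edges_in_split vertices_in_split rng_ecl src_ecl)
  have M: "path_morphism \<Gamma> (two_path \<Gamma> (ecl (a, \<rho> f)) (ecl (f, x))) = R `` {(\<rho> a, [copy a (\<rho> f), copy f x])}"
    if "(a, \<rho> f) \<in> EE" "(f, x) \<in> EE" for a f x
  proof -
    have "cmp \<Gamma> (rng \<Gamma> (ecl (a, \<rho> f))) (ecl (a, \<rho> f)) = ecl (a, \<rho> f)"
      unfolding rng_ecl[OF that(1)]
      using R_edge[OF that(1)] by (simp add: in_split_sel(4) vcl_def ecl_def path_append_def)
    then show ?thesis
      by (simp add: path_morphism_def two_path_def) (simp add: in_split_sel(4) ecl_def path_append_def)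
  qed
  have Q: "is_path G (\<rho> a, [copy a (\<rho> f), copy f x])" if "(a, \<rho> f) \<in> EE" "(f, x) \<in> EE" for a f x
    using that path_edge[OF that(2)] by (auto simp: is_path_G_Cons simp del: is_path.simps(2))
  have "R `` {(\<rho> a, [copy a (\<rho> f), copy f x])} = R `` {(\<rho> g, [copy g (\<rho> b), copy b x'])}
      \<longleftrightarrow> x = x' \<and> cmp \<Lambda> a f = cmp \<Lambda> g b" if y: "y = \<rho> f" "y' = \<rho> b"
  proof -
    have 1: "(a, \<rho> f) \<in> EE" "(g, \<rho> b) \<in> EE" using a g y by auto
    have ed: "a \<in> edges \<Lambda>" "f \<in> edges \<Lambda>" "g \<in> edges \<Lambda>" "b \<in> edges \<Lambda>"
      "src \<Lambda> a = rng \<Lambda> f" "src \<Lambda> g = rng \<Lambda> b" using 1 a(2) g(2) by (auto simp: EE_iff)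
    have "R `` {(\<rho> a, [copy a (\<rho> f), copy f x])} = R `` {(\<rho> g, [copy g (\<rho> b), copy b x'])}
      \<longleftrightarrow> ((\<rho> a, [copy a (\<rho> f), copy f x]), (\<rho> g, [copy g (\<rho> b), copy b x'])) \<in> R"
      using Q 1 a(2) g(2) by (intro eq_equiv_class_iff[OF equiv_R]) auto
    also have "\<dots> \<longleftrightarrow> cmp \<Lambda> a f = cmp \<Lambda> g b \<and> \<rho> a = \<rho> g \<and> x = x'"
      using Q[OF 1(1) a(2)] Q[OF 1(2) g(2)] a(2) g(2) path_morphism_two[OF ed(1)] path_morphism_two[OF ed(3)]
      by (auto simp: R_iff par_def path_rng_def path_src_def two_path_def)
    also have "\<dots> \<longleftrightarrow> x = x' \<and> cmp \<Lambda> a f = cmp \<Lambda> g b" using rho_square[OF ed] by auto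
    finally show ?thesis .
  qed
  then show ?thesis using P[OF a] P[OF g] M a g by (auto simp: path_equiv_def)
qed

text \<open>
  The relation on commuting squares for the in-split graph. A commuting square of \<open>\<Lambda>\<^sub>I\<close> with source \<open>x\<close> is a commuting
  square \<open>af = gb\<close> of \<open>\<Lambda>\<close> together with a copy \<open>x\<close> of \<open>s(f)\<close>: the first edges \<open>(f, x)\<close> and \<open>(b, x)\<close> then
  determine the sources \<open>\<rho> f\<close> and \<open>\<rho> b\<close> of the second ones.
\<close>

definition split_square_relation :: "'a star_algebra \<Rightarrow> ('m \<times> 'm split \<Rightarrow> 'a) \<Rightarrow> bool" where
  "split_square_relation A s \<longleftrightarrow>
    (\<forall>a f g b x. a \<in> edges \<Lambda> \<longrightarrow> f \<in> edges \<Lambda> \<longrightarrow> g \<in> edges \<Lambda> \<longrightarrow> b \<in> edges \<Lambda> \<longrightarrow> src \<Lambda> a = rng \<Lambda> f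
      \<longrightarrow> src \<Lambda> g = rng \<Lambda> b \<longrightarrow> cmp \<Lambda> a f = cmp \<Lambda> g b \<longrightarrow> x \<in> copies v (src \<Lambda> f)
      \<longrightarrow> s (a, \<rho> f) \<otimes>\<^bsub>A\<^esub> s (f, x) = s (g, \<rho> b) \<otimes>\<^bsub>A\<^esub> s (b, x))"

text \<open>A Cuntz-Krieger family of the in-split graph, indexed by \<open>X\<close> and \<open>EE\<close> instead of classes of paths.\<close>

definition split_family :: "'a star_algebra \<Rightarrow> ('m split \<Rightarrow> 'a) \<Rightarrow> ('m \<times> 'm split \<Rightarrow> 'a) \<Rightarrow> bool" where
  "split_family A q s \<longleftrightarrow>
    ck_system A X EE (\<rho> \<circ> fst) snd (deg \<Lambda> \<circ> fst) q s \<and> split_square_relation A s"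

lemma square_relation_in_split_iff:
  assumes st: "\<And>e. e \<in> EE \<Longrightarrow> T (ecl e) = s e"
  shows "square_relation \<Gamma> A T \<longleftrightarrow> split_square_relation A s" (is "?L = ?R")
proof
  assume L: ?L
  show ?R
    unfolding split_square_relation_def
  proof (intro allI impI)
    fix a f g b x
    assume ed: "a \<in> edges \<Lambda>" "f \<in> edges \<Lambda>" "g \<in> edges \<Lambda>" "b \<in> edges \<Lambda>"
      "src \<Lambda> a = rng \<Lambda> f" "src \<Lambda> g = rng \<Lambda> b" "cmp \<Lambda> a f = cmp \<Lambda> g b" and x: "x \<in> copies v (src \<Lambda> f)"
    have e: "(a, \<rho> f) \<in> EE" "(f, x) \<in> EE" "(g, \<rho> b) \<in> EE" "(b, x) \<in> EE"
      using ed x rho_copies square_ends[OF ed] by (auto simp: EE_def)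
    have "path_equiv \<Gamma> (two_path \<Gamma> (ecl (a, \<rho> f)) (ecl (f, x))) (two_path \<Gamma> (ecl (g, \<rho> b)) (ecl (b, x)))"
      using path_equiv_in_split[OF e] ed by simp
    moreover have "ecl (a, \<rho> f) \<in> edges \<Gamma>" "ecl (f, x) \<in> edges \<Gamma>" "ecl (g, \<rho> b) \<in> edges \<Gamma>" "ecl (b, x) \<in> edges \<Gamma>"
      using e by (auto simp: edges_in_split)
    ultimately have "T (ecl (a, \<rho> f)) \<otimes>\<^bsub>A\<^esub> T (ecl (f, x)) = T (ecl (g, \<rho> b)) \<otimes>\<^bsub>A\<^esub> T (ecl (b, x))"
      using L unfolding square_relation_def by blast
    then show "s (a, \<rho> f) \<otimes>\<^bsub>A\<^esub> s (f, x) = s (g, \<rho> b) \<otimes>\<^bsub>A\<^esub> s (b, x)" using e st by simp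
  qed
next
  assume R: ?R
  show ?L
    unfolding square_relation_def
  proof (intro ballI impI)
    fix a' b' f' g' assume "a' \<in> edges \<Gamma>" "b' \<in> edges \<Gamma>" "f' \<in> edges \<Gamma>" "g' \<in> edges \<Gamma>"
      and pe: "path_equiv \<Gamma> (two_path \<Gamma> a' f') (two_path \<Gamma> g' b')"
    then obtain a y b x' f x g y' where e: "(a, y) \<in> EE" "(f, x) \<in> EE" "(g, y') \<in> EE" "(b, x') \<in> EE"
      and eq: "a' = ecl (a, y)" "f' = ecl (f, x)" "g' = ecl (g, y')" "b' = ecl (b, x')"
      by (fastforce simp: edges_in_split)
    have "y = \<rho> f \<and> y' = \<rho> b \<and> x = x' \<and> cmp \<Lambda> a f = cmp \<Lambda> g b"
      using pe path_equiv_in_split[OF e] by (simp add: eq)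
    then show "T a' \<otimes>\<^bsub>A\<^esub> T f' = T g' \<otimes>\<^bsub>A\<^esub> T b'"
      using R[unfolded split_square_relation_def, rule_format, of a f g b x] e EE_D[OF e(1)] EE_D[OF e(2)] EE_D[OF e(3)] EE_D[OF e(4)] st eq
      by (auto simp: EE_def)
  qed
qed

lemma CK_family_in_split_iff:
  assumes A: "pre_cstar_algebra A"
    and P: "\<And>x. x \<in> X \<Longrightarrow> P (vcl x) = q x" and T: "\<And>e. e \<in> EE \<Longrightarrow> T (ecl e) = s e"
  shows "CK_family \<Gamma> A P T \<longleftrightarrow> split_family A q s"
proof -
  have "ck_system A (vcl ` X) (ecl ` EE) (rng \<Gamma>) (src \<Gamma>) (deg \<Gamma>) P T
    \<longleftrightarrow> ck_system A X EE (\<rho> \<circ> fst) snd (deg \<Lambda> \<circ> fst) q s"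
    by (rule ck_system_reindex[OF inj_vcl inj_ecl])
      (use P T rho_X EE_D in \<open>auto simp: rng_ecl src_ecl deg_ecl EE_def X_def\<close>)
  then show ?thesis
    using CK_family_iff[OF A row_finite_in_split edge_ends_in_split, of P T] square_relation_in_split_iff[of T s A] T
    unfolding split_family_def vertices_in_split edges_in_split by simp
qed

end

section \<open>Passing between families of the graph and of its in-splitting\<close>

context in_splitting
begin

lemma finite_edges_into:
  assumes "w \<in> vertices \<Lambda>" shows "finite {f \<in> edges \<Lambda>. rng \<Lambda> f = w \<and> deg \<Lambda> f = axis i 1}"
  by (rule finite_subset[of _ "{l \<in> Mor \<Lambda>. deg \<Lambda> l = axis i 1 \<and> rng \<Lambda> l = w}"])
    (use assms rf in \<open>auto simp: row_finite_def edges_def\<close>)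

lemma finsum_split_edges:
  assumes A: "pre_cstar_algebra A" and F: "finite F" "F \<subseteq> edges \<Lambda>"
    and h: "\<And>e. e \<in> EE \<Longrightarrow> h e \<in> carrier A"
  shows "finsum A h {e \<in> EE. fst e \<in> F} = finsum A (\<lambda>f. finsum A (\<lambda>x. h (f, x)) (copies v (src \<Lambda> f))) F"
proof -
  interpret pre_cstar_algebra A by (rule A)
  have fin: "finite {e \<in> EE. fst e \<in> F}"
    by (rule finite_subset[of _ "SIGMA f:F. copies v (src \<Lambda> f)"]) (use F in \<open>auto simp: EE_def\<close>)
  have "finsum A h {e \<in> EE. fst e \<in> F} = finsum A (\<lambda>f. finsum A h {e \<in> {e \<in> EE. fst e \<in> F}. fst e = f}) F"
    by (rule finsum_fibres[OF fin F(1)]) (use h in auto)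
  also have "\<dots> = finsum A (\<lambda>f. finsum A (\<lambda>x. h (f, x)) (copies v (src \<Lambda> f))) F"
  proof (rule finsum_eqI)
    fix f assume f: "f \<in> F"
    have "{e \<in> {e \<in> EE. fst e \<in> F}. fst e = f} = Pair f ` copies v (src \<Lambda> f)"
      using f F by (auto simp: EE_def)
    moreover have "finsum A h (Pair f ` copies v (src \<Lambda> f)) = finsum A (\<lambda>x. h (f, x)) (copies v (src \<Lambda> f))"
      by (rule M.finsum_reindex) (use f F h in \<open>auto simp: EE_def inj_on_def\<close>)
    ultimately show "finsum A h {e \<in> {e \<in> EE. fst e \<in> F}. fst e = f}
        = finsum A (\<lambda>x. h (f, x)) (copies v (src \<Lambda> f))" by simp
    show "finsum A (\<lambda>x. h (f, x)) (copies v (src \<Lambda> f)) \<in> carrier A"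
      by (rule M.finsum_closed) (use f F h in \<open>auto simp: EE_def\<close>)
  qed
  finally show ?thesis .
qed

text \<open>
  \<open>merge_proj\<close> and \<open>merge_isom\<close> add up copies, producing a family of \<open>\<Lambda>\<close> from one of the in-split graph;
  \<open>split_proj\<close> and \<open>split_isom\<close>, which depend on an auxiliary colour \<open>i\<close>, go the other way.
\<close>

definition merge_proj :: "'a star_algebra \<Rightarrow> ('m split \<Rightarrow> 'a) \<Rightarrow> 'm \<Rightarrow> 'a" where
  "merge_proj A q w = finsum A q (copies v w)"

definition merge_isom :: "'a star_algebra \<Rightarrow> ('m \<times> 'm split \<Rightarrow> 'a) \<Rightarrow> 'm \<Rightarrow> 'a" where
  "merge_isom A s f = finsum A (\<lambda>x. s (f, x)) (copies v (src \<Lambda> f))"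

definition split_proj :: "'a star_algebra \<Rightarrow> ('m \<Rightarrow> 'a) \<Rightarrow> 'k \<Rightarrow> 'm split \<Rightarrow> 'a" where
  "split_proj A T i x = finsum A (\<lambda>f. T f \<otimes>\<^bsub>A\<^esub> adj A (T f)) {f \<in> edges \<Lambda>. \<rho> f = x \<and> deg \<Lambda> f = axis i 1}"

definition split_isom :: "'a star_algebra \<Rightarrow> ('m \<Rightarrow> 'a) \<Rightarrow> 'k \<Rightarrow> 'm \<times> 'm split \<Rightarrow> 'a" where
  "split_isom A T i e = T (fst e) \<otimes>\<^bsub>A\<^esub> split_proj A T i (snd e)"

text \<open>
  The last two claims say that splitting the merged family gives back the original one, for every colour.
\<close>

lemma merge_family:
  assumes fam: "split_family A q s"
  shows "CK_family \<Lambda> A (merge_proj A q) (merge_isom A s)"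
    and "f \<in> edges \<Lambda> \<Longrightarrow> x \<in> copies v (src \<Lambda> f) \<Longrightarrow> merge_isom A s f \<otimes>\<^bsub>A\<^esub> q x = s (f, x)"
    and "x \<in> X \<Longrightarrow> split_proj A (merge_isom A s) i x = q x"
proof -
  interpret S: ck_system A X EE "\<rho> \<circ> fst" snd "deg \<Lambda> \<circ> fst" q s
    using fam by (simp add: split_family_def)
  note A = S.pre_cstar_algebra_axioms
  let ?P = "merge_proj A q" and ?T = "merge_isom A s"
  have qX: "x \<in> X" if "x \<in> copies v w" "w \<in> vertices \<Lambda>" for x w using that copies_iff by blast
  have sE: "(f, x) \<in> EE" if "f \<in> edges \<Lambda>" "x \<in> copies v (src \<Lambda> f)" for f x using that by (simp add: EE_def)
  have T_cl [simp]: "?T f \<in> carrier A" if "f \<in> edges \<Lambda>" for f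
    unfolding merge_isom_def by (rule S.M.finsum_closed) (use that sE in auto)
  have P_cl [simp]: "?P w \<in> carrier A" if "w \<in> vertices \<Lambda>" for w
    unfolding merge_proj_def by (rule S.M.finsum_closed) (use that qX in auto)
  have Tq: "?T f \<otimes>\<^bsub>A\<^esub> q x = s (f, x)" if f: "f \<in> edges \<Lambda>" and x: "x \<in> copies v (src \<Lambda> f)" for f x
  proof -
    have xX: "x \<in> X" using x qX edge_ends f by blast
    have "?T f \<otimes>\<^bsub>A\<^esub> q x = finsum A (\<lambda>y. s (f, y) \<otimes>\<^bsub>A\<^esub> q x) (copies v (src \<Lambda> f))"
      unfolding merge_isom_def by (rule S.finsum_mult_right) (use f xX sE in auto)
    also have "\<dots> = s (f, x) \<otimes>\<^bsub>A\<^esub> q x"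
      by (rule S.finsum_single) (use f x xX sE S.T_P_other in auto)
    also have "\<dots> = s (f, x)" using S.T_P[OF sE[OF f x]] by simp
    finally show ?thesis .
  qed
  then show "f \<in> edges \<Lambda> \<Longrightarrow> x \<in> copies v (src \<Lambda> f) \<Longrightarrow> ?T f \<otimes>\<^bsub>A\<^esub> q x = s (f, x)" .
  have Ts: "?T f \<otimes>\<^bsub>A\<^esub> adj A (s (f, x)) = s (f, x) \<otimes>\<^bsub>A\<^esub> adj A (s (f, x))"
    if f: "f \<in> edges \<Lambda>" and x: "x \<in> copies v (src \<Lambda> f)" for f x
  proof -
    have xX: "x \<in> X" using x qX edge_ends f by blast
    have "?T f \<otimes>\<^bsub>A\<^esub> adj A (s (f, x)) = ?T f \<otimes>\<^bsub>A\<^esub> (q x \<otimes>\<^bsub>A\<^esub> adj A (s (f, x)))"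
      using S.P_star_T[OF sE[OF f x]] by simp
    also have "\<dots> = ?T f \<otimes>\<^bsub>A\<^esub> q x \<otimes>\<^bsub>A\<^esub> adj A (s (f, x))"
      using f xX sE[OF f x] by (simp add: S.mult_assoc)
    finally show ?thesis using Tq[OF f x] by simp
  qed
  have star_T: "adj A (?T f) = finsum A (\<lambda>x. adj A (s (f, x))) (copies v (src \<Lambda> f))" if "f \<in> edges \<Lambda>" for f
    unfolding merge_isom_def by (rule S.star_finsum) (use that sE in auto)
  have TT: "?T f \<otimes>\<^bsub>A\<^esub> adj A (?T f)
      = finsum A (\<lambda>x. s (f, x) \<otimes>\<^bsub>A\<^esub> adj A (s (f, x))) (copies v (src \<Lambda> f))" if f: "f \<in> edges \<Lambda>" for f
  proof -
    have "?T f \<otimes>\<^bsub>A\<^esub> adj A (?T f) = finsum A (\<lambda>x. ?T f \<otimes>\<^bsub>A\<^esub> adj A (s (f, x))) (copies v (src \<Lambda> f))"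
      unfolding star_T[OF f] by (rule S.finsum_mult_left) (use f sE in auto)
    also have "\<dots> = finsum A (\<lambda>x. s (f, x) \<otimes>\<^bsub>A\<^esub> adj A (s (f, x))) (copies v (src \<Lambda> f))"
      by (rule S.finsum_eqI) (use f sE Ts in auto)
    finally show ?thesis .
  qed
  have starTs: "adj A (?T f) \<otimes>\<^bsub>A\<^esub> s (f, x) = q x" if f: "f \<in> edges \<Lambda>" and x: "x \<in> copies v (src \<Lambda> f)" for f x
  proof -
    have "adj A (?T f) \<otimes>\<^bsub>A\<^esub> s (f, x) = finsum A (\<lambda>y. adj A (s (f, y)) \<otimes>\<^bsub>A\<^esub> s (f, x)) (copies v (src \<Lambda> f))"
      unfolding star_T[OF f] by (rule S.finsum_mult_right) (use f x sE in auto)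
    also have "\<dots> = adj A (s (f, x)) \<otimes>\<^bsub>A\<^esub> s (f, x)"
      by (rule S.finsum_single) (use f x sE S.orth_same in auto)
    also have "\<dots> = q x" using S.initial[OF sE[OF f x]] by simp
    finally show ?thesis .
  qed
  have starTT: "adj A (?T f) \<otimes>\<^bsub>A\<^esub> ?T f = ?P (src \<Lambda> f)" if f: "f \<in> edges \<Lambda>" for f
  proof -
    have "adj A (?T f) \<otimes>\<^bsub>A\<^esub> ?T f = finsum A (\<lambda>x. adj A (?T f) \<otimes>\<^bsub>A\<^esub> s (f, x)) (copies v (src \<Lambda> f))"
      by (subst (2) merge_isom_def, rule S.finsum_mult_left) (use f sE in auto)
    also have "\<dots> = ?P (src \<Lambda> f)"
      unfolding merge_proj_def by (rule S.finsum_eqI) (use f starTs qX edge_ends in auto)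
    finally show ?thesis .
  qed
  have Pq: "?P w \<otimes>\<^bsub>A\<^esub> q x = (if x \<in> copies v w then q x else \<zero>\<^bsub>A\<^esub>)" if w: "w \<in> vertices \<Lambda>" and x: "x \<in> X" for w x
  proof -
    have e: "?P w \<otimes>\<^bsub>A\<^esub> q x = finsum A (\<lambda>y. q y \<otimes>\<^bsub>A\<^esub> q x) (copies v w)"
      unfolding merge_proj_def by (rule S.finsum_mult_right) (use w x qX in auto)
    show ?thesis
    proof (cases "x \<in> copies v w")
      case True
      have "finsum A (\<lambda>y. q y \<otimes>\<^bsub>A\<^esub> q x) (copies v w) = q x \<otimes>\<^bsub>A\<^esub> q x"
        by (rule S.finsum_single) (use w x True qX S.orth in auto)
      then show ?thesis using e True S.P_idem x by simp
    next
      case False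
      have "finsum A (\<lambda>y. q y \<otimes>\<^bsub>A\<^esub> q x) (copies v w) = \<zero>\<^bsub>A\<^esub>"
      proof (rule S.finsum_eq_zero)
        fix y assume y: "y \<in> copies v w"
        show "q y \<otimes>\<^bsub>A\<^esub> q x = \<zero>\<^bsub>A\<^esub>" by (rule S.orth) (use y False w x qX in auto)
      qed
      then show ?thesis using e False by simp
    qed
  qed
  have PP: "?P w \<otimes>\<^bsub>A\<^esub> ?P u = finsum A (\<lambda>x. ?P w \<otimes>\<^bsub>A\<^esub> q x) (copies v u)"
    if "w \<in> vertices \<Lambda>" "u \<in> vertices \<Lambda>" for w u
    by (subst (2) merge_proj_def, rule S.finsum_mult_left) (use that qX in auto)
  have proj: "is_projection A (?P w)" if w: "w \<in> vertices \<Lambda>" for w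
    unfolding is_projection_def
  proof (intro conjI)
    have "finsum A (\<lambda>x. ?P w \<otimes>\<^bsub>A\<^esub> q x) (copies v w) = finsum A q (copies v w)"
      by (rule S.finsum_eqI) (use w qX Pq in auto)
    then show "?P w \<otimes>\<^bsub>A\<^esub> ?P w = ?P w" using PP[OF w w] by (simp add: merge_proj_def)
    have "adj A (?P w) = finsum A (\<lambda>x. adj A (q x)) (copies v w)"
      unfolding merge_proj_def by (rule S.star_finsum) (use w qX in auto)
    also have "\<dots> = ?P w" unfolding merge_proj_def by (rule S.finsum_eqI) (use w qX S.star_P in auto)
    finally show "adj A (?P w) = ?P w" .
  qed (use w in auto)
  have orth: "?P w \<otimes>\<^bsub>A\<^esub> ?P u = \<zero>\<^bsub>A\<^esub>" if w: "w \<in> vertices \<Lambda>" "u \<in> vertices \<Lambda>" "w \<noteq> u" for w u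
    unfolding PP[OF w(1,2)]
  proof (rule S.finsum_eq_zero)
    fix x assume x: "x \<in> copies v u"
    then have "x \<notin> copies v w" using copies_unsplit[of x v] w(3) by metis
    then show "?P w \<otimes>\<^bsub>A\<^esub> q x = \<zero>\<^bsub>A\<^esub>" using Pq[OF w(1) qX[OF x w(2)]] by simp
  qed
  let ?h = "\<lambda>e. s e \<otimes>\<^bsub>A\<^esub> adj A (s e)"
  have sumF: "finsum A (\<lambda>f. ?T f \<otimes>\<^bsub>A\<^esub> adj A (?T f)) F = finsum A ?h {e \<in> EE. fst e \<in> F}"
    if F: "finite F" "F \<subseteq> edges \<Lambda>" for F
  proof -
    have "finsum A (\<lambda>f. ?T f \<otimes>\<^bsub>A\<^esub> adj A (?T f)) F
      = finsum A (\<lambda>f. finsum A (\<lambda>x. ?h (f, x)) (copies v (src \<Lambda> f))) F"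
      by (rule S.finsum_eqI) (use F TT sE in \<open>auto intro!: S.M.finsum_closed\<close>)
    also have "\<dots> = finsum A ?h {e \<in> EE. fst e \<in> F}"
      by (rule finsum_split_edges[OF A F, symmetric]) auto
    finally show ?thesis .
  qed
  show sp: "split_proj A ?T i x = q x" if x: "x \<in> X" for x i
  proof -
    let ?F = "{f \<in> edges \<Lambda>. \<rho> f = x \<and> deg \<Lambda> f = axis i 1}"
    have "finite ?F"
      by (rule finite_subset[OF _ finite_edges_into[of "unsplit x" i]]) (use x X_iff in auto)
    then have "split_proj A ?T i x = finsum A ?h {e \<in> EE. fst e \<in> ?F}"
      unfolding split_proj_def by (rule sumF) auto
    also have "{e \<in> EE. fst e \<in> ?F} = {e \<in> EE. (\<rho> \<circ> fst) e = x \<and> (deg \<Lambda> \<circ> fst) e = axis i 1}"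
      by (auto simp: EE_def)
    finally show ?thesis using S.range_sum[OF x, of i] by simp
  qed
  have range_sum: "?P w = finsum A (\<lambda>f. ?T f \<otimes>\<^bsub>A\<^esub> adj A (?T f)) {f \<in> edges \<Lambda>. rng \<Lambda> f = w \<and> deg \<Lambda> f = axis i 1}"
    if w: "w \<in> vertices \<Lambda>" for w i
  proof -
    let ?F = "{f \<in> edges \<Lambda>. rng \<Lambda> f = w \<and> deg \<Lambda> f = axis i 1}"
    have "finsum A (\<lambda>f. ?T f \<otimes>\<^bsub>A\<^esub> adj A (?T f)) ?F
      = finsum A (\<lambda>x. finsum A (\<lambda>f. ?T f \<otimes>\<^bsub>A\<^esub> adj A (?T f)) {f \<in> ?F. \<rho> f = x}) (copies v w)"
      by (rule S.finsum_fibres[OF finite_edges_into[OF w]]) (use rho_copies in auto)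
    also have "\<dots> = ?P w"
      unfolding merge_proj_def
    proof (rule S.finsum_eqI)
      fix x assume x: "x \<in> copies v w"
      have "{f \<in> ?F. \<rho> f = x} = {f \<in> edges \<Lambda>. \<rho> f = x \<and> deg \<Lambda> f = axis i 1}"
        using copies_unsplit[OF x] by auto
      then show "finsum A (\<lambda>f. ?T f \<otimes>\<^bsub>A\<^esub> adj A (?T f)) {f \<in> ?F. \<rho> f = x} = q x"
        using sp[OF qX[OF x w], of i] by (simp add: split_proj_def)
      show "q x \<in> carrier A" using qX[OF x w] by simp
    qed
    finally show ?thesis by simp
  qed
  have "ck_system A (vertices \<Lambda>) (edges \<Lambda>) (rng \<Lambda>) (src \<Lambda>) (deg \<Lambda>) ?P ?T"
  proof (rule ck_system.intro[OF A], rule ck_system_axioms.intro)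
    show "\<exists>i. deg \<Lambda> f = axis i 1" if "f \<in> edges \<Lambda>" for f
      using that by (intro sum_eq_1_axis) (simp add: edges_def)
    show "?P w = finsum A (\<lambda>f. ?T f \<otimes>\<^bsub>A\<^esub> adj A (?T f)) {f \<in> edges \<Lambda>. rng \<Lambda> f = w \<and> deg \<Lambda> f = axis i 1}"
      if "w \<in> vertices \<Lambda>" for w i using range_sum[OF that] .
  qed (use edge_ends finite_edges_into proj orth starTT in auto)
  moreover have "square_relation \<Lambda> A ?T"
    unfolding square_relation_def
  proof (intro ballI impI)
    have TaTf: "?T a \<otimes>\<^bsub>A\<^esub> ?T f = finsum A (\<lambda>x. s (a, \<rho> f) \<otimes>\<^bsub>A\<^esub> s (f, x)) (copies v (src \<Lambda> f))"
      if af: "a \<in> edges \<Lambda>" "f \<in> edges \<Lambda>" "src \<Lambda> a = rng \<Lambda> f" for a f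
    proof -
      have "?T a \<otimes>\<^bsub>A\<^esub> ?T f = finsum A (\<lambda>x. ?T a \<otimes>\<^bsub>A\<^esub> s (f, x)) (copies v (src \<Lambda> f))"
        by (subst (2) merge_isom_def, rule S.finsum_mult_left) (use af sE in auto)
      also have "\<dots> = finsum A (\<lambda>x. s (a, \<rho> f) \<otimes>\<^bsub>A\<^esub> s (f, x)) (copies v (src \<Lambda> f))"
      proof (rule S.finsum_eqI)
        fix x assume x: "x \<in> copies v (src \<Lambda> f)"
        note e = sE[OF af(2) x]
        have r: "\<rho> f \<in> copies v (src \<Lambda> a)" using rho_copies[of f] af by simp
        have "?T a \<otimes>\<^bsub>A\<^esub> s (f, x) = ?T a \<otimes>\<^bsub>A\<^esub> (q (\<rho> f) \<otimes>\<^bsub>A\<^esub> s (f, x))"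
          using S.P_T[OF e] by simp
        also have "\<dots> = ?T a \<otimes>\<^bsub>A\<^esub> q (\<rho> f) \<otimes>\<^bsub>A\<^esub> s (f, x)"
          using af e rho_X by (simp add: S.mult_assoc)
        finally show "?T a \<otimes>\<^bsub>A\<^esub> s (f, x) = s (a, \<rho> f) \<otimes>\<^bsub>A\<^esub> s (f, x)" using Tq[OF af(1) r] by simp
        show "s (a, \<rho> f) \<otimes>\<^bsub>A\<^esub> s (f, x) \<in> carrier A" using e sE[OF af(1) r] by simp
      qed
      finally show ?thesis .
    qed
    fix a b f g assume ed: "a \<in> edges \<Lambda>" "b \<in> edges \<Lambda>" "f \<in> edges \<Lambda>" "g \<in> edges \<Lambda>"
      and "path_equiv \<Lambda> (two_path \<Lambda> a f) (two_path \<Lambda> g b)"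
    then have sq: "src \<Lambda> a = rng \<Lambda> f" "src \<Lambda> g = rng \<Lambda> b" "cmp \<Lambda> a f = cmp \<Lambda> g b"
      using path_equiv_two by auto
    have "src \<Lambda> f = src \<Lambda> b" using square_ends ed sq by blast
    moreover have "finsum A (\<lambda>x. s (a, \<rho> f) \<otimes>\<^bsub>A\<^esub> s (f, x)) (copies v (src \<Lambda> f))
        = finsum A (\<lambda>x. s (g, \<rho> b) \<otimes>\<^bsub>A\<^esub> s (b, x)) (copies v (src \<Lambda> f))"
    proof (rule S.finsum_eqI)
      fix x assume x: "x \<in> copies v (src \<Lambda> f)"
      show "s (a, \<rho> f) \<otimes>\<^bsub>A\<^esub> s (f, x) = s (g, \<rho> b) \<otimes>\<^bsub>A\<^esub> s (b, x)"
        using fam ed sq x unfolding split_family_def split_square_relation_def by blast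
      have "\<rho> b \<in> copies v (src \<Lambda> g)" using rho_copies[of b] sq by simp
      then show "s (g, \<rho> b) \<otimes>\<^bsub>A\<^esub> s (b, x) \<in> carrier A"
        using ed sE x \<open>src \<Lambda> f = src \<Lambda> b\<close> by simp
    qed
    ultimately show "?T a \<otimes>\<^bsub>A\<^esub> ?T f = ?T g \<otimes>\<^bsub>A\<^esub> ?T b" using TaTf ed sq by simp
  qed
  ultimately show "CK_family \<Lambda> A ?P ?T"
    using CK_family_iff[OF A rf edge_ends] by blast
qed

text \<open>
  The last two claims say that merging the split family gives back the original one.
\<close>

lemma split_family_of_CK:
  assumes A: "pre_cstar_algebra A" and fam: "CK_family \<Lambda> A P T"
  shows "split_family A (split_proj A T i) (split_isom A T i)"
    and "w \<in> vertices \<Lambda> \<Longrightarrow> merge_proj A (split_proj A T i) w = P w"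
    and "f \<in> edges \<Lambda> \<Longrightarrow> merge_isom A (split_isom A T i) f = T f"
proof -
  have L: "ck_system A (vertices \<Lambda>) (edges \<Lambda>) (rng \<Lambda>) (src \<Lambda>) (deg \<Lambda>) P T" and ck2: "square_relation \<Lambda> A T"
    using fam CK_family_iff[OF A rf edge_ends] by blast+
  interpret L: ck_system A "vertices \<Lambda>" "edges \<Lambda>" "rng \<Lambda>" "src \<Lambda>" "deg \<Lambda>" P T by (rule L)
  let ?F = "\<lambda>i x. {f \<in> edges \<Lambda>. \<rho> f = x \<and> deg \<Lambda> f = axis i 1}"
  let ?q = "split_proj A T"
  have finF: "finite (?F i x)" if x: "x \<in> X" for i x
    by (rule finite_subset[OF _ finite_edges_into[of "unsplit x" i]]) (use x X_iff in auto)
  \<comment> \<open>The pairing condition, through \<open>rho_square\<close>, covers edges of different colours.\<close>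
  have orth: "adj A (T f) \<otimes>\<^bsub>A\<^esub> T a = \<zero>\<^bsub>A\<^esub>" if f: "f \<in> edges \<Lambda>" and a: "a \<in> edges \<Lambda>" and ne: "\<rho> f \<noteq> \<rho> a" for f a
  proof (cases "rng \<Lambda> f = rng \<Lambda> a")
    case False
    then show ?thesis using L.orth_range f a by blast
  next
    case True
    obtain i where i: "deg \<Lambda> f = axis i 1" using L.colour[OF f] by blast
    let ?S = "{g \<in> edges \<Lambda>. rng \<Lambda> g = src \<Lambda> a \<and> deg \<Lambda> g = axis i 1}"
    have finS: "finite ?S" using finite_edges_into edge_ends a by blast
    have "adj A (T f) \<otimes>\<^bsub>A\<^esub> T a = adj A (T f) \<otimes>\<^bsub>A\<^esub> (T a \<otimes>\<^bsub>A\<^esub> P (src \<Lambda> a))"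
      using L.T_P[OF a] by simp
    also have "\<dots> = adj A (T f) \<otimes>\<^bsub>A\<^esub> T a \<otimes>\<^bsub>A\<^esub> P (src \<Lambda> a)"
      using f a edge_ends by (simp add: L.mult_assoc)
    also have "P (src \<Lambda> a) = finsum A (\<lambda>g. T g \<otimes>\<^bsub>A\<^esub> adj A (T g)) ?S"
      using L.range_sum edge_ends a by blast
    also have "adj A (T f) \<otimes>\<^bsub>A\<^esub> T a \<otimes>\<^bsub>A\<^esub> \<dots> = finsum A (\<lambda>g. adj A (T f) \<otimes>\<^bsub>A\<^esub> T a \<otimes>\<^bsub>A\<^esub> (T g \<otimes>\<^bsub>A\<^esub> adj A (T g))) ?S"
      by (rule L.finsum_mult_left[OF finS]) (use f a in auto)
    also have "\<dots> = \<zero>\<^bsub>A\<^esub>"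
    proof (rule L.finsum_eq_zero)
      fix g assume g: "g \<in> ?S"
      have ga: "a \<in> Mor \<Lambda>" "g \<in> Mor \<Lambda>" "src \<Lambda> a = rng \<Lambda> g" using a g by (auto simp: edges_def)
      have "cmp \<Lambda> a g \<in> Mor \<Lambda>" "deg \<Lambda> (cmp \<Lambda> a g) = deg \<Lambda> a + axis i 1"
        using cmp_closed[OF ga] deg_cmp[OF ga] g by auto
      from ex1_implies_ex[OF factorization[OF this]] obtain \<mu> \<nu> where m: "\<mu> \<in> Mor \<Lambda>" "\<nu> \<in> Mor \<Lambda>" "src \<Lambda> \<mu> = rng \<Lambda> \<nu>"
        "deg \<Lambda> \<mu> = axis i 1" "deg \<Lambda> \<nu> = deg \<Lambda> a" "cmp \<Lambda> a g = cmp \<Lambda> \<mu> \<nu>"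
        by auto
      have ed: "\<mu> \<in> edges \<Lambda>" "\<nu> \<in> edges \<Lambda>" using m a axis_sum[of i] by (auto simp: edges_def)
      have ag: "T a \<otimes>\<^bsub>A\<^esub> T g = T \<mu> \<otimes>\<^bsub>A\<^esub> T \<nu>"
        using ck2 path_equiv_two[of a g \<mu> \<nu>] a g ed m ga unfolding square_relation_def by auto
      have "\<rho> a = \<rho> \<mu>" using rho_square[of a g \<mu> \<nu>] a g ed m ga by auto
      then have "\<mu> \<noteq> f" "rng \<Lambda> \<mu> = rng \<Lambda> a" using ne square_ends[of a g \<mu> \<nu>] a g ed m ga by auto
      then have z: "adj A (T f) \<otimes>\<^bsub>A\<^esub> T \<mu> = \<zero>\<^bsub>A\<^esub>" using L.orth_same[OF f ed(1)] True i m by auto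
      have "adj A (T f) \<otimes>\<^bsub>A\<^esub> T a \<otimes>\<^bsub>A\<^esub> (T g \<otimes>\<^bsub>A\<^esub> adj A (T g))
          = adj A (T f) \<otimes>\<^bsub>A\<^esub> (T a \<otimes>\<^bsub>A\<^esub> T g \<otimes>\<^bsub>A\<^esub> adj A (T g))"
        using f a g by (simp add: L.mult_assoc)
      also have "\<dots> = adj A (T f) \<otimes>\<^bsub>A\<^esub> T \<mu> \<otimes>\<^bsub>A\<^esub> (T \<nu> \<otimes>\<^bsub>A\<^esub> adj A (T g))"
        unfolding ag using f a g ed by (simp add: L.mult_assoc)
      also have "\<dots> = \<zero>\<^bsub>A\<^esub>" using z g ed by simp
      finally show "adj A (T f) \<otimes>\<^bsub>A\<^esub> T a \<otimes>\<^bsub>A\<^esub> (T g \<otimes>\<^bsub>A\<^esub> adj A (T g)) = \<zero>\<^bsub>A\<^esub>" .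
    qed
    finally show ?thesis .
  qed
  have q_cl [simp]: "?q i x \<in> carrier A" for i x
    unfolding split_proj_def by (rule L.M.finsum_closed) auto
  have q_star: "adj A (?q i x) = ?q i x" if x: "x \<in> X" for i x
  proof -
    have "adj A (?q i x) = finsum A (\<lambda>f. adj A (T f \<otimes>\<^bsub>A\<^esub> adj A (T f))) (?F i x)"
      unfolding split_proj_def by (rule L.star_finsum[OF finF[OF x]]) auto
    also have "\<dots> = ?q i x"
      unfolding split_proj_def by (rule L.finsum_eqI) (auto simp: L.star_mult)
    finally show ?thesis .
  qed
  \<comment> \<open>Whatever the colour of \<open>f\<close> and the colour \<open>i\<close> used to form \<open>q\<^sub>x\<close>.\<close>
  have qT: "?q i x \<otimes>\<^bsub>A\<^esub> T f = (if \<rho> f = x then T f else \<zero>\<^bsub>A\<^esub>)" if x: "x \<in> X" and f: "f \<in> edges \<Lambda>" for i x f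
  proof -
    have e: "?q i x \<otimes>\<^bsub>A\<^esub> T f = finsum A (\<lambda>g. T g \<otimes>\<^bsub>A\<^esub> adj A (T g) \<otimes>\<^bsub>A\<^esub> T f) (?F i x)"
      unfolding split_proj_def by (rule L.finsum_mult_right[OF finF[OF x]]) (use f in auto)
    have z: "T g \<otimes>\<^bsub>A\<^esub> adj A (T g) \<otimes>\<^bsub>A\<^esub> T f = \<zero>\<^bsub>A\<^esub>" if "g \<in> edges \<Lambda>" "\<rho> g \<noteq> \<rho> f" for g
      using orth[OF that(1) f that(2)] that f by (simp add: L.mult_assoc)
    show ?thesis
    proof (cases "\<rho> f = x")
      case False
      then show ?thesis unfolding e using z by (auto intro!: L.finsum_eq_zero)
    next
      case True
      let ?W = "{g \<in> edges \<Lambda>. rng \<Lambda> g = rng \<Lambda> f \<and> deg \<Lambda> g = axis i 1}"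
      have finW: "finite ?W" using finite_edges_into edge_ends f by blast
      have "T f = P (rng \<Lambda> f) \<otimes>\<^bsub>A\<^esub> T f" using L.P_T[OF f] by simp
      also have "P (rng \<Lambda> f) = finsum A (\<lambda>g. T g \<otimes>\<^bsub>A\<^esub> adj A (T g)) ?W"
        using L.range_sum edge_ends f by blast
      also have "\<dots> \<otimes>\<^bsub>A\<^esub> T f = finsum A (\<lambda>g. T g \<otimes>\<^bsub>A\<^esub> adj A (T g) \<otimes>\<^bsub>A\<^esub> T f) ?W"
        by (rule L.finsum_mult_right[OF finW]) (use f in auto)
      also have "\<dots> = finsum A (\<lambda>g. T g \<otimes>\<^bsub>A\<^esub> adj A (T g) \<otimes>\<^bsub>A\<^esub> T f) (?F i x)"
      proof (rule L.finsum_mono_neutral[OF finW])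
        show "?F i x \<subseteq> ?W"
        proof
          fix g assume "g \<in> ?F i x"
          then have "g \<in> edges \<Lambda>" "\<rho> g = \<rho> f" "deg \<Lambda> g = axis i 1" using True by auto
          then show "g \<in> ?W" using unsplit_rho[of g] unsplit_rho[of f] by simp
        qed
      qed (use f z True in auto)
      finally show ?thesis using e True by simp
    qed
  qed
  have qq: "?q i x \<otimes>\<^bsub>A\<^esub> ?q j y = (if x = y then ?q j y else \<zero>\<^bsub>A\<^esub>)" if x: "x \<in> X" and y: "y \<in> X" for i j x y
  proof -
    have e: "?q i x \<otimes>\<^bsub>A\<^esub> ?q j y = finsum A (\<lambda>f. ?q i x \<otimes>\<^bsub>A\<^esub> (T f \<otimes>\<^bsub>A\<^esub> adj A (T f))) (?F j y)"
      by (subst (2) split_proj_def, rule L.finsum_mult_left[OF finF[OF y]]) auto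
    have t: "?q i x \<otimes>\<^bsub>A\<^esub> (T f \<otimes>\<^bsub>A\<^esub> adj A (T f)) = (if x = y then T f \<otimes>\<^bsub>A\<^esub> adj A (T f) else \<zero>\<^bsub>A\<^esub>)"
      if "f \<in> ?F j y" for f
      using that L.mult_assoc[of "?q i x" "T f" "adj A (T f)", symmetric] qT[OF x] by auto
    show ?thesis
    proof (cases "x = y")
      case True
      have "finsum A (\<lambda>f. ?q i x \<otimes>\<^bsub>A\<^esub> (T f \<otimes>\<^bsub>A\<^esub> adj A (T f))) (?F j y) = ?q j y"
        unfolding split_proj_def[of A T j y] by (rule L.finsum_eqI) (use t True in auto)
      then show ?thesis unfolding e using True by simp
    next
      case False
      then show ?thesis unfolding e using t by (auto intro!: L.finsum_eq_zero)
    qed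
  qed
  \<comment> \<open>The two colours give self-adjoint elements each of which is a left unit for the other.\<close>
  have indep: "?q i x = ?q j x" if x: "x \<in> X" for i j x
    using arg_cong[OF qq[OF x x, of j i], of "adj A"] qq[OF x x, of i j] q_star[OF x]
    by (simp add: L.star_mult)
  have qX: "x \<in> X" if "x \<in> copies v w" "w \<in> vertices \<Lambda>" for x w using that copies_iff by blast
  show sumq: "merge_proj A (?q i) w = P w" if w: "w \<in> vertices \<Lambda>" for w i
  proof -
    let ?W = "{g \<in> edges \<Lambda>. rng \<Lambda> g = w \<and> deg \<Lambda> g = axis i 1}"
    have "P w = finsum A (\<lambda>g. T g \<otimes>\<^bsub>A\<^esub> adj A (T g)) ?W" using L.range_sum[OF w] .
    also have "\<dots> = finsum A (\<lambda>x. finsum A (\<lambda>g. T g \<otimes>\<^bsub>A\<^esub> adj A (T g)) {g \<in> ?W. \<rho> g = x}) (copies v w)"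
      by (rule L.finsum_fibres[OF finite_edges_into[OF w]]) (use rho_copies in auto)
    also have "\<dots> = finsum A (?q i) (copies v w)"
    proof (rule L.finsum_eqI)
      fix x assume x: "x \<in> copies v w"
      have "{g \<in> ?W. \<rho> g = x} = ?F i x" using copies_unsplit[OF x] by auto
      then show "finsum A (\<lambda>g. T g \<otimes>\<^bsub>A\<^esub> adj A (T g)) {g \<in> ?W. \<rho> g = x} = ?q i x"
        by (simp add: split_proj_def)
    qed auto
    finally show ?thesis by (simp add: merge_proj_def)
  qed
  have Pq: "P w \<otimes>\<^bsub>A\<^esub> ?q i x = ?q i x" if w: "w \<in> vertices \<Lambda>" and x: "x \<in> copies v w" for w i x
  proof -
    have "P w \<otimes>\<^bsub>A\<^esub> ?q i x = finsum A (\<lambda>f. P w \<otimes>\<^bsub>A\<^esub> (T f \<otimes>\<^bsub>A\<^esub> adj A (T f))) (?F i x)"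
      by (subst split_proj_def, rule L.finsum_mult_left[OF finF[OF qX[OF x w]]]) (use w in auto)
    also have "\<dots> = ?q i x"
    proof (subst split_proj_def, rule L.finsum_eqI)
      fix f assume f: "f \<in> ?F i x"
      then have "rng \<Lambda> f = w" using copies_unsplit[OF x] by auto
      then show "P w \<otimes>\<^bsub>A\<^esub> (T f \<otimes>\<^bsub>A\<^esub> adj A (T f)) = T f \<otimes>\<^bsub>A\<^esub> adj A (T f)"
        using L.mult_assoc[of "P w" "T f" "adj A (T f)", symmetric] L.P_T[of f] f w by simp
    qed auto
    finally show ?thesis .
  qed
  show "merge_isom A (split_isom A T i) f = T f" if f: "f \<in> edges \<Lambda>" for f
  proof -
    have "T f = T f \<otimes>\<^bsub>A\<^esub> merge_proj A (?q i) (src \<Lambda> f)" using sumq edge_ends[OF f] L.T_P[OF f] by simp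
    also have "\<dots> = finsum A (\<lambda>x. T f \<otimes>\<^bsub>A\<^esub> ?q i x) (copies v (src \<Lambda> f))"
      unfolding merge_proj_def by (rule L.finsum_mult_left) (use f in auto)
    finally show ?thesis by (simp add: merge_isom_def split_isom_def)
  qed
  let ?s = "split_isom A T i"
  have s_cl [simp]: "?s e \<in> carrier A" if "e \<in> EE" for e using that by (auto simp: split_isom_def EE_def)
  have ss: "?s (f, x) \<otimes>\<^bsub>A\<^esub> adj A (?s (f, x)) = T f \<otimes>\<^bsub>A\<^esub> (?q i x \<otimes>\<^bsub>A\<^esub> adj A (T f))" if "(f, x) \<in> EE" for f x
  proof -
    have x: "x \<in> X" "f \<in> edges \<Lambda>" using EE_D[OF that] by auto
    have "?s (f, x) \<otimes>\<^bsub>A\<^esub> adj A (?s (f, x)) = T f \<otimes>\<^bsub>A\<^esub> (?q i x \<otimes>\<^bsub>A\<^esub> ?q i x \<otimes>\<^bsub>A\<^esub> adj A (T f))"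
      using x q_star[OF x(1)] by (simp add: split_isom_def L.star_mult L.mult_assoc)
    then show ?thesis using qq[OF x(1) x(1)] by simp
  qed
  have "ck_system A X EE (\<rho> \<circ> fst) snd (deg \<Lambda> \<circ> fst) (?q i) ?s"
  proof (rule ck_system.intro[OF A], rule ck_system_axioms.intro)
    fix e assume e: "e \<in> EE"
    then obtain f x where fx: "e = (f, x)" "f \<in> edges \<Lambda>" "x \<in> copies v (src \<Lambda> f)" "x \<in> X"
      using EE_D by (cases e) (auto simp: EE_def)
    show "(\<rho> \<circ> fst) e \<in> X" "snd e \<in> X" using fx rho_X by auto
    show "\<exists>i. (deg \<Lambda> \<circ> fst) e = axis i 1" using L.colour fx by auto
    have "adj A (?s e) \<otimes>\<^bsub>A\<^esub> ?s e = ?q i x \<otimes>\<^bsub>A\<^esub> ((adj A (T f) \<otimes>\<^bsub>A\<^esub> T f) \<otimes>\<^bsub>A\<^esub> ?q i x)"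
      using fx q_star by (simp add: split_isom_def L.star_mult L.mult_assoc)
    also have "\<dots> = ?q i x" using L.initial Pq qq fx edge_ends by simp
    finally show "adj A (?s e) \<otimes>\<^bsub>A\<^esub> ?s e = ?q i (snd e)" using fx by simp
  next
    fix x j assume x: "x \<in> X"
    have D: "{e \<in> EE. (\<rho> \<circ> fst) e = x \<and> (deg \<Lambda> \<circ> fst) e = axis j 1} = {e \<in> EE. fst e \<in> ?F j x}"
      by (auto simp: EE_def)
    show "finite {e \<in> EE. (\<rho> \<circ> fst) e = x \<and> (deg \<Lambda> \<circ> fst) e = axis j 1}"
      by (rule finite_subset[of _ "SIGMA f:?F j x. copies v (src \<Lambda> f)"]) (use finF[OF x] in \<open>auto simp: EE_def\<close>)
    show "is_projection A (?q i x)" using qq x q_star by (simp add: is_projection_def)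
    have "finsum A (\<lambda>e. ?s e \<otimes>\<^bsub>A\<^esub> adj A (?s e)) {e \<in> EE. fst e \<in> ?F j x}
      = finsum A (\<lambda>f. finsum A (\<lambda>y. ?s (f, y) \<otimes>\<^bsub>A\<^esub> adj A (?s (f, y))) (copies v (src \<Lambda> f))) (?F j x)"
      by (rule finsum_split_edges[OF A finF[OF x]]) auto
    also have "\<dots> = ?q j x"
    proof (subst split_proj_def, rule L.finsum_eqI)
      fix f assume f: "f \<in> ?F j x"
      have "finsum A (\<lambda>y. ?s (f, y) \<otimes>\<^bsub>A\<^esub> adj A (?s (f, y))) (copies v (src \<Lambda> f))
        = finsum A (\<lambda>y. T f \<otimes>\<^bsub>A\<^esub> (?q i y \<otimes>\<^bsub>A\<^esub> adj A (T f))) (copies v (src \<Lambda> f))"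
        by (rule L.finsum_eqI) (use f ss in \<open>auto simp: EE_def\<close>)
      also have "\<dots> = T f \<otimes>\<^bsub>A\<^esub> finsum A (\<lambda>y. ?q i y \<otimes>\<^bsub>A\<^esub> adj A (T f)) (copies v (src \<Lambda> f))"
        by (rule L.finsum_mult_left[symmetric]) (use f in auto)
      also have "finsum A (\<lambda>y. ?q i y \<otimes>\<^bsub>A\<^esub> adj A (T f)) (copies v (src \<Lambda> f)) = merge_proj A (?q i) (src \<Lambda> f) \<otimes>\<^bsub>A\<^esub> adj A (T f)"
        unfolding merge_proj_def by (rule L.finsum_mult_right[symmetric]) (use f in auto)
      also have "\<dots> = adj A (T f)" using sumq edge_ends f L.P_star_T by simp
      finally show "finsum A (\<lambda>y. ?s (f, y) \<otimes>\<^bsub>A\<^esub> adj A (?s (f, y))) (copies v (src \<Lambda> f)) = T f \<otimes>\<^bsub>A\<^esub> adj A (T f)" .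
    qed auto
    finally show "?q i x = finsum A (\<lambda>e. ?s e \<otimes>\<^bsub>A\<^esub> adj A (?s e)) {e \<in> EE. (\<rho> \<circ> fst) e = x \<and> (deg \<Lambda> \<circ> fst) e = axis j 1}"
      unfolding D using indep[OF x, of i j] by simp
  qed (use qq in auto)
  moreover have "?s (a, \<rho> f) \<otimes>\<^bsub>A\<^esub> ?s (f, x) = ?s (g, \<rho> b) \<otimes>\<^bsub>A\<^esub> ?s (b, x)"
    if ed: "a \<in> edges \<Lambda>" "f \<in> edges \<Lambda>" "g \<in> edges \<Lambda>" "b \<in> edges \<Lambda>"
      "src \<Lambda> a = rng \<Lambda> f" "src \<Lambda> g = rng \<Lambda> b" "cmp \<Lambda> a f = cmp \<Lambda> g b" for a f g b x
  proof -
    have e: "?s (a, \<rho> f) \<otimes>\<^bsub>A\<^esub> ?s (f, x) = T a \<otimes>\<^bsub>A\<^esub> T f \<otimes>\<^bsub>A\<^esub> ?q i x" if af: "a \<in> edges \<Lambda>" "f \<in> edges \<Lambda>" for a f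
    proof -
      have "?s (a, \<rho> f) \<otimes>\<^bsub>A\<^esub> ?s (f, x) = T a \<otimes>\<^bsub>A\<^esub> (?q i (\<rho> f) \<otimes>\<^bsub>A\<^esub> T f \<otimes>\<^bsub>A\<^esub> ?q i x)"
        using af by (simp add: split_isom_def L.mult_assoc)
      then show ?thesis using qT[OF rho_X] af by (simp add: L.mult_assoc)
    qed
    have "T a \<otimes>\<^bsub>A\<^esub> T f = T g \<otimes>\<^bsub>A\<^esub> T b"
      using ck2 ed path_equiv_two[of a f g b] unfolding square_relation_def by blast
    then show ?thesis using e ed by simp
  qed
  ultimately show "split_family A (?q i) ?s" unfolding split_family_def split_square_relation_def by blast
qed

end

section \<open>Homomorphisms of universal algebras\<close>

lemma star_hom_zero:
  assumes "pre_cstar_algebra A" "pre_cstar_algebra B" "star_hom A B \<phi>"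
  shows "\<phi> \<zero>\<^bsub>A\<^esub> = \<zero>\<^bsub>B\<^esub>"
proof -
  interpret A: pre_cstar_algebra A by fact
  interpret B: pre_cstar_algebra B by fact
  have "\<phi> (0 \<odot>\<^bsub>A\<^esub> \<zero>\<^bsub>A\<^esub>) = 0 \<odot>\<^bsub>B\<^esub> \<phi> \<zero>\<^bsub>A\<^esub>" using assms(3) A.M.zero_closed unfolding star_hom_def by blast
  moreover have "\<phi> \<zero>\<^bsub>A\<^esub> \<in> carrier B" using assms(3) A.M.zero_closed unfolding star_hom_def by blast
  ultimately show ?thesis by simp
qed

lemma star_hom_finsum:
  assumes "pre_cstar_algebra A" "pre_cstar_algebra B" "star_hom A B \<phi>" "finite S"
    "\<And>i. i \<in> S \<Longrightarrow> f i \<in> carrier A"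
  shows "\<phi> (finsum A f S) = finsum B (\<lambda>i. \<phi> (f i)) S"
proof -
  interpret A: pre_cstar_algebra A by fact
  interpret B: pre_cstar_algebra B by fact
  show ?thesis using assms(4,5)
  proof (induction S)
    case empty
    then show ?case using star_hom_zero[OF assms(1-3)] by simp
  next
    case (insert i S)
    then have "finsum A f S \<in> carrier A" by (intro A.M.finsum_closed) auto
    then show ?case using insert assms(3)
      by (subst A.M.finsum_insert, auto) (subst B.M.finsum_insert, auto simp: star_hom_def)
  qed
qed

lemma star_hom_comp: "star_hom A B \<phi> \<Longrightarrow> star_hom B C \<psi> \<Longrightarrow> star_hom A C (\<psi> \<circ> \<phi>)"
  by (simp add: star_hom_def)

lemma star_hom_eval:
  assumes "pre_cstar_algebra A" "pre_cstar_algebra B" "star_hom A B \<phi>"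
    and h: "\<And>x. x \<in> X \<Longrightarrow> h x \<in> carrier A" "set_star_term t \<subseteq> X"
  shows "\<phi> (eval A h t) = eval B (\<phi> \<circ> h) t"
  using h(2)
proof (induction t)
  case TZero
  then show ?case using star_hom_zero[OF assms(1-3)] by simp
qed (use assms(3) pre_cstar_algebra.eval_closed[OF assms(1), of X h] h(1) in \<open>auto simp: star_hom_def\<close>)

lemma eval_cong: "(\<And>x. x \<in> set_star_term t \<Longrightarrow> h x = k x) \<Longrightarrow> eval A h t = eval A k t"
  by (induction t) auto

text \<open>A contractive endomorphism of the universal algebra that fixes the generators is the identity.\<close>

lemma CK_algebra_endo_id:
  assumes src: "\<And>f. f \<in> edges \<Lambda> \<Longrightarrow> src \<Lambda> f \<in> vertices \<Lambda>" and rf: "row_finite \<Lambda>"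
    and hom: "star_hom (CK_algebra \<Lambda>) (CK_algebra \<Lambda>) \<theta>"
    and le: "\<And>U. U \<in> carrier (CK_algebra \<Lambda>) \<Longrightarrow> cnorm (CK_algebra \<Lambda>) (\<theta> U) \<le> cnorm (CK_algebra \<Lambda>) U"
    and fix_gen: "\<And>w. w \<in> vertices \<Lambda> \<Longrightarrow> \<theta> (CK_proj \<Lambda> w) = CK_proj \<Lambda> w"
      "\<And>f. f \<in> edges \<Lambda> \<Longrightarrow> \<theta> (CK_isom \<Lambda> f) = CK_isom \<Lambda> f"
    and U: "U \<in> carrier (CK_algebra \<Lambda>)"
  shows "\<theta> U = U"
proof -
  let ?A = "CK_algebra \<Lambda>"
  interpret A: cstar_algebra ?A by (rule CK_algebra_cstar)
  let ?X = "vertices \<Lambda> <+> edges \<Lambda>"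
  have gen: "CK_gen \<Lambda> x \<in> carrier ?A" if "x \<in> ?X" for x
    using CK_algebra_family[OF src rf] that
    by (auto simp: CK_family_def is_projection_def is_partial_isometry_def)
  have chi: "\<theta> y \<in> carrier ?A" if "y \<in> carrier ?A" for y using hom that by (simp add: star_hom_def)
  have diff: "\<theta> (x \<ominus>\<^bsub>?A\<^esub> y) = \<theta> x \<ominus>\<^bsub>?A\<^esub> \<theta> y" if "x \<in> carrier ?A" "y \<in> carrier ?A" for x y
    using hom that by (simp add: A.diff_smult star_hom_def)
  have "cnorm ?A (\<theta> U \<ominus>\<^bsub>?A\<^esub> U) \<le> e" if e: "e > 0" for e
  proof -
    have "e / 2 > 0" using e by simp
    from CK_algebra_dense[OF U this] obtain t where t: "set_star_term t \<subseteq> ?X"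
      and close: "cnorm ?A (U \<ominus>\<^bsub>?A\<^esub> eval ?A (CK_gen \<Lambda>) t) < e / 2" by blast
    let ?y = "eval ?A (CK_gen \<Lambda>) t"
    have y: "?y \<in> carrier ?A" using A.eval_closed[of ?X "CK_gen \<Lambda>"] gen t by blast
    have "\<theta> ?y = eval ?A (\<theta> \<circ> CK_gen \<Lambda>) t"
      by (rule star_hom_eval[of _ _ _ ?X]) (use A.pre_cstar_algebra_axioms hom gen t in auto)
    also have "\<dots> = ?y" by (rule eval_cong) (use t fix_gen in auto)
    finally have "\<theta> U \<ominus>\<^bsub>?A\<^esub> ?y = \<theta> (U \<ominus>\<^bsub>?A\<^esub> ?y)" using diff[OF U y] by simp
    then have "cnorm ?A (\<theta> U \<ominus>\<^bsub>?A\<^esub> ?y) \<le> cnorm ?A (U \<ominus>\<^bsub>?A\<^esub> ?y)" using le U y by simp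
    moreover have "cnorm ?A (\<theta> U \<ominus>\<^bsub>?A\<^esub> U) \<le> cnorm ?A (\<theta> U \<ominus>\<^bsub>?A\<^esub> ?y) + cnorm ?A (?y \<ominus>\<^bsub>?A\<^esub> U)"
      by (rule A.nrm_diff_triangle[OF chi[OF U] y U])
    ultimately show ?thesis using close A.nrm_diff_commute[OF U y] by linarith
  qed
  then have "cnorm ?A (\<theta> U \<ominus>\<^bsub>?A\<^esub> U) \<le> 0" by (rule field_le_epsilon[of _ 0, simplified])
  moreover have "0 \<le> cnorm ?A (\<theta> U \<ominus>\<^bsub>?A\<^esub> U)"
    by (rule A.nrm_nonneg, rule A.M.minus_closed[OF chi[OF U] U])
  ultimately show ?thesis using A.nrm_diff_eq_0[OF chi[OF U] U] by simp
qed

section \<open>The isomorphism\<close>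

theorem theorem3p13:
  fixes \<Lambda> :: "('m, 'k::finite) graded_category"
    and v :: 'm and E1 E2 :: "'m set"
  assumes "kgraph \<Lambda>" and "row_finite \<Lambda>" and "source_free \<Lambda>"
    and "v \<in> vertices \<Lambda>"
    and "edge_partition_at \<Lambda> v E1 E2"
    and "pairing_condition \<Lambda> v E1 E2"
  shows "star_isomorphic (CK_algebra (in_split \<Lambda> v E1)) (CK_algebra \<Lambda>)"
proof -
  interpret in_splitting \<Lambda> v E1 E2
    using assms by (simp add: in_splitting_def in_splitting_axioms_def)
  let ?C = "CK_algebra \<Lambda>" and ?D = "CK_algebra \<Gamma>"
  interpret C: cstar_algebra ?C by (rule CK_algebra_cstar)
  interpret D: cstar_algebra ?D by (rule CK_algebra_cstar)
  note C = C.cstar_algebra_axioms C.pre_cstar_algebra_axioms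
    and D = D.cstar_algebra_axioms D.pre_cstar_algebra_axioms
  \<comment> \<open>Any colour can be used to split the vertex projections.\<close>
  define i :: 'k where "i = undefined"
  let ?P = "CK_proj \<Lambda>" and ?T = "CK_isom \<Lambda>"
  have PT: "CK_family \<Lambda> ?C ?P ?T" by (rule CK_algebra_family[OF edge_ends(2) rf])
  have Pc: "?P w \<in> carrier ?C" if "w \<in> vertices \<Lambda>" for w
    using PT that by (simp add: CK_family_def is_projection_def)
  have Tc: "?T f \<in> carrier ?C" if "f \<in> edges \<Lambda>" for f
    using PT that by (simp add: CK_family_def is_partial_isometry_def)
  define Q where "Q x = CK_proj \<Gamma> (vcl x)" for x
  define S where "S e = CK_isom \<Gamma> (ecl e)" for e
  have QSfam: "CK_family \<Gamma> ?D (CK_proj \<Gamma>) (CK_isom \<Gamma>)"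
    by (rule CK_algebra_family[OF edge_ends_in_split(2) row_finite_in_split])
  then have QS: "split_family ?D Q S"
    by (subst CK_family_in_split_iff[OF D(2), symmetric]) (simp_all add: Q_def S_def)
  have Qc: "Q x \<in> carrier ?D" if "x \<in> X" for x
    using QSfam that by (simp add: CK_family_def is_projection_def Q_def vertices_in_split)
  have Sc: "S e \<in> carrier ?D" if "e \<in> EE" for e
    using QSfam that by (simp add: CK_family_def is_partial_isometry_def S_def edges_in_split)
  let ?q = "split_proj ?C ?T i" and ?s = "split_isom ?C ?T i"
  note split = split_family_of_CK[OF C(2) PT, where i = i]
  note merge = merge_family[OF QS]
  from CK_algebra_universal[OF edge_ends(2) rf D(1) merge(1)]
  obtain \<phi> where \<phi>: "star_hom ?C ?D \<phi>" "\<And>w. w \<in> vertices \<Lambda> \<Longrightarrow> \<phi> (?P w) = merge_proj ?D Q w"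
    "\<And>f. f \<in> edges \<Lambda> \<Longrightarrow> \<phi> (?T f) = merge_isom ?D S f"
    "\<And>U. U \<in> carrier ?C \<Longrightarrow> cnorm ?D (\<phi> U) \<le> cnorm ?C U" by blast
  define p where "p U = ?q (inv_into X vcl U)" for U
  define t where "t U = ?s (inv_into EE ecl U)" for U
  have p: "p (vcl x) = ?q x" if "x \<in> X" for x using that inj_vcl by (simp add: p_def)
  have t: "t (ecl e) = ?s e" if "e \<in> EE" for e using that inj_ecl by (simp add: t_def)
  have "CK_family \<Gamma> ?C p t"
    using CK_family_in_split_iff[OF C(2), of p ?q t ?s] p t split(1) by blast
  from CK_algebra_universal[OF edge_ends_in_split(2) row_finite_in_split C(1) this]
  obtain \<psi> where \<psi>0: "star_hom ?D ?C \<psi>" "\<And>w. w \<in> vertices \<Gamma> \<Longrightarrow> \<psi> (CK_proj \<Gamma> w) = p w"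
    "\<And>f. f \<in> edges \<Gamma> \<Longrightarrow> \<psi> (CK_isom \<Gamma> f) = t f"
    "\<And>U. U \<in> carrier ?D \<Longrightarrow> cnorm ?C (\<psi> U) \<le> cnorm ?D U" by blast
  have \<psi>: "\<psi> (Q x) = ?q x" if "x \<in> X" for x
    using \<psi>0(2) that p by (simp add: Q_def vertices_in_split)
  have \<psi>': "\<psi> (S e) = ?s e" if "e \<in> EE" for e
    using \<psi>0(3) that t by (simp add: S_def edges_in_split)
  have phi_c: "\<phi> U \<in> carrier ?D" if "U \<in> carrier ?C" for U using \<phi>(1) that by (simp add: star_hom_def)
  have psi_c: "\<psi> U \<in> carrier ?C" if "U \<in> carrier ?D" for U using \<psi>0(1) that by (simp add: star_hom_def)
  have 1: "(\<psi> \<circ> \<phi>) U = U" if U: "U \<in> carrier ?C" for U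
  proof (rule CK_algebra_endo_id[OF edge_ends(2) rf star_hom_comp[OF \<phi>(1) \<psi>0(1)] _ _ _ U])
    show "cnorm ?C ((\<psi> \<circ> \<phi>) U) \<le> cnorm ?C U" if "U \<in> carrier ?C" for U
      using \<phi>(4)[OF that] \<psi>0(4)[OF phi_c[OF that]] by simp
    fix w assume w: "w \<in> vertices \<Lambda>"
    have X: "x \<in> X" if "x \<in> copies v w" for x using that w copies_iff by blast
    have "\<psi> (merge_proj ?D Q w) = finsum ?C (\<lambda>x. \<psi> (Q x)) (copies v w)"
      unfolding merge_proj_def by (rule star_hom_finsum[OF D(2) C(2) \<psi>0(1)]) (use X Qc in auto)
    also have "\<dots> = merge_proj ?C ?q w"
      unfolding merge_proj_def
      by (rule C.finsum_eqI) (use X \<psi> psi_c Qc in \<open>auto simp flip: \<psi>\<close>)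
    finally show "(\<psi> \<circ> \<phi>) (?P w) = ?P w" using \<phi>(2)[OF w] split(2)[OF w] by simp
  next
    fix f assume f: "f \<in> edges \<Lambda>"
    have X: "(f, x) \<in> EE" if "x \<in> copies v (src \<Lambda> f)" for x using that f by (simp add: EE_def)
    have "\<psi> (merge_isom ?D S f) = finsum ?C (\<lambda>x. \<psi> (S (f, x))) (copies v (src \<Lambda> f))"
      unfolding merge_isom_def by (rule star_hom_finsum[OF D(2) C(2) \<psi>0(1)]) (use X Sc in auto)
    also have "\<dots> = merge_isom ?C ?s f"
      unfolding merge_isom_def
      by (rule C.finsum_eqI) (use X \<psi>' psi_c Sc in \<open>auto simp flip: \<psi>'\<close>)
    finally show "(\<psi> \<circ> \<phi>) (?T f) = ?T f" using \<phi>(3)[OF f] split(3)[OF f] by simp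
  qed
  have phi_q: "\<phi> (?q x) = Q x" if x: "x \<in> X" for x
  proof -
    let ?F = "{f \<in> edges \<Lambda>. \<rho> f = x \<and> deg \<Lambda> f = axis i 1}"
    have fin: "finite ?F"
      by (rule finite_subset[OF _ finite_edges_into[of "unsplit x" i]]) (use x X_iff in auto)
    have "\<phi> (?q x) = finsum ?D (\<lambda>f. \<phi> (?T f \<otimes>\<^bsub>?C\<^esub> adj ?C (?T f))) ?F"
      unfolding split_proj_def by (rule star_hom_finsum[OF C(2) D(2) \<phi>(1) fin]) (use Tc in auto)
    also have "\<dots> = split_proj ?D (merge_isom ?D S) i x"
      unfolding split_proj_def
    proof (rule D.finsum_eqI)
      fix f assume "f \<in> ?F"
      then have f: "f \<in> edges \<Lambda>" by simp
      show "\<phi> (?T f \<otimes>\<^bsub>?C\<^esub> adj ?C (?T f)) = merge_isom ?D S f \<otimes>\<^bsub>?D\<^esub> adj ?D (merge_isom ?D S f)"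
        using \<phi>(1,3) Tc[OF f] f by (simp add: star_hom_def)
      show "merge_isom ?D S f \<otimes>\<^bsub>?D\<^esub> adj ?D (merge_isom ?D S f) \<in> carrier ?D"
        using phi_c[OF Tc[OF f]] \<phi>(3)[OF f] by simp
    qed
    also have "\<dots> = Q x" by (rule merge(3)[OF x])
    finally show ?thesis .
  qed
  have 2: "(\<phi> \<circ> \<psi>) U = U" if U: "U \<in> carrier ?D" for U
  proof (rule CK_algebra_endo_id[OF edge_ends_in_split(2) row_finite_in_split star_hom_comp[OF \<psi>0(1) \<phi>(1)] _ _ _ U])
    show "cnorm ?D ((\<phi> \<circ> \<psi>) U) \<le> cnorm ?D U" if "U \<in> carrier ?D" for U
      using \<psi>0(4)[OF that] \<phi>(4)[OF psi_c[OF that]] by simp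
    fix V assume "V \<in> vertices \<Gamma>"
    then obtain x where x: "x \<in> X" "V = vcl x" by (auto simp: vertices_in_split)
    then show "(\<phi> \<circ> \<psi>) (CK_proj \<Gamma> V) = CK_proj \<Gamma> V" using \<psi>[OF x(1)] phi_q[OF x(1)] by (simp add: Q_def)
  next
    fix V assume "V \<in> edges \<Gamma>"
    then obtain f x where e: "(f, x) \<in> EE" "V = ecl (f, x)" by (auto simp: edges_in_split)
    have x: "x \<in> X" "f \<in> edges \<Lambda>" "x \<in> copies v (src \<Lambda> f)" using e EE_D by (auto simp: EE_def)
    have "?q x \<in> carrier ?C" using psi_c[OF Qc[OF x(1)]] \<psi>[OF x(1)] by simp
    then have "\<phi> (?s (f, x)) = merge_isom ?D S f \<otimes>\<^bsub>?D\<^esub> Q x"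
      using \<phi>(1,3) Tc[OF x(2)] phi_q[OF x(1)] x by (simp add: split_isom_def star_hom_def)
    then show "(\<phi> \<circ> \<psi>) (CK_isom \<Gamma> V) = CK_isom \<Gamma> V"
      using \<psi>'[OF e(1)] merge(2)[OF x(2,3)] e by (simp add: S_def)
  qed
  have "bij_betw \<psi> (carrier ?D) (carrier ?C)"
    by (rule bij_betw_byWitness[of _ \<phi>]) (use 1 2 phi_c psi_c in auto)
  then show ?thesis using \<psi>0(1) unfolding star_isomorphic_def by blast
qed

end
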